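(* Let $\ell\ge 1$. The Baxter operator $\mathcal{Q}^{\mathfrak{gl}_{\ell+1}}(\lambda)$ satisfies the following identities (products of operators are compositions, i.e. convolutions of integral kernels; $\lambda,\lambda',\gamma$ are complex parameters for which the kernel integrals involved converge absolutely): $$\mathcal{Q}^{\mathfrak{gl}_{\ell+1}}(\lambda)\cdot \mathcal{Q}^{\mathfrak{gl}_{\ell+1}}(\lambda')=\mathcal{Q}^{\mathfrak{gl}_{\ell+1}}(\lambda')\cdot \mathcal{Q}^{\mathfrak{gl}_{\ell+1}}(\lambda),$$ $$\mathcal{Q}^{\mathfrak{gl}_{\ell+1}}(\gamma)\cdot Q^{\mathfrak{gl}_{\ell+1}}_{\mathfrak{gl}_{\ell}}(\lambda)=\Gamma(\imath\gamma-\imath\lambda)\; Q^{\mathfrak{gl}_{\ell+1}}_{\mathfrak{gl}_{\ell}}(\lambda)\cdot \mathcal{Q}^{\mathfrak{gl}_{\ell}}(\gamma),$$ $$\mathcal{Q}^{\mathfrak{gl}_{\ell+1}}(\lambda)\cdot T^{\mathfrak{gl}_{\ell+1}}(\lambda')=T^{\mathfrak{gl}_{\ell+1}}(\lambda')\cdot \mathcal{Q}^{\mathfrak{gl}_{\ell+1}}(\lambda),$$ $$\mathcal{Q}^{\mathfrak{gl}_{\ell+1}}(\lambda-\imath)=\imath^{\ell+1}\; T^{\mathfrak{gl}_{\ell+1}}(\lambda)\cdot \mathcal{Q}^{\mathfrak{gl}_{\ell+1}}(\lambda).$$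
   Context: Here $\imath=\sqrt{-1}$. An integral operator with kernel $K(\underline{x},\underline{y})$ acts by $(Kf)(\underline{x})=\int K(\underline{x},\underline{y})f(\underline{y})\,d\underline{y}$. Baxter operator: for $n\ge1$, $\mathcal{Q}^{\mathfrak{gl}_{n}}(\lambda)$ is the integral operator on functions on $\mathbb{R}^{n}$ with kernel $$\mathcal{Q}^{\mathfrak{gl}_{n}}(\underline{x},\underline{y}|\lambda)=\exp\Big\{\imath\lambda\sum_{i=1}^{n}(x_i-y_i)-\sum_{k=1}^{n-1}\big(e^{x_k-y_k}+e^{y_k-x_{k+1}}\big)-e^{x_{n}-y_{n}}\Big\}.$$ Recursive operator: $Q^{\mathfrak{gl}_{\ell+1}}_{\mathfrak{gl}_{\ell}}(\lambda)$ maps functions on $\mathbb{R}^\ell$ to functions on $\mathbb{R}^{\ell+1}$ and has kernel ($\underline{x}\in\mathbb{R}^{\ell+1}$, $\underline{y}\in\mathbb{R}^{\ell}$) $$Q^{\mathfrak{gl}_{\ell+1}}_{\mathfrak{gl}_{\ell}}(\underline{x},\underline{y}|\lambda)=\exp\Big\{\imath\lambda\Big(\sum_{i=1}^{\ell+1}x_i-\sum_{i=1}^{\ell}y_i\Big)-\sum_{i=1}^{\ell}\big(e^{x_i-y_i}+e^{y_i-x_{i+1}}\big)\Big\}.$$ Whittaker function: with $x_{\ell+1,i}:=x_i$, $$\Psi^{\mathfrak{gl}_{\ell+1}}_{\lambda_1,\ldots,\lambda_{\ell+1}}(x_1,\ldots,x_{\ell+1})=\int_{\mathbb{R}^{\ell(\ell+1)/2}}\prod_{k=1}^{\ell}\prod_{i=1}^k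 dx_{k,i}\; \exp\Big\{\imath\sum_{k=1}^{\ell+1}\lambda_k\Big(\sum_{i=1}^k x_{k,i}-\sum_{i=1}^{k-1}x_{k-1,i}\Big)-\sum_{k=1}^{\ell}\sum_{i=1}^{k}\big(e^{x_{k+1,i}-x_{k,i}}+e^{x_{k,i}-x_{k+1,i+1}}\big)\Big\}.$$ Toda Hamiltonians: $\mathcal{H}_j^{\mathfrak{gl}_{\ell+1}}(\underline{x},\partial_{\underline{x}})$, $1\le j\le \ell+1$, are the commuting quantum Hamiltonians (differential operators on $\mathbb{R}^{\ell+1}$) of the $\mathfrak{gl}_{\ell+1}$-Toda chain, and $\mathcal{H}_0:=1$. They are normalized so that $$t^{\mathfrak{gl}_{\ell+1}}(\underline{x},\partial_{\underline{x}}|\lambda)=\sum_{j=0}^{\ell+1}(-1)^j\lambda^{\ell+1-j}\mathcal{H}_j^{\mathfrak{gl}_{\ell+1}}(\underline{x},\partial_{\underline{x}})$$ satisfies $t^{\mathfrak{gl}_{\ell+1}}(\underline{x},\partial_{\underline{x}}|\lambda)\Psi^{\mathfrak{gl}_{\ell+1}}_{\underline\lambda}(\underline{x})=\prod_{j=1}^{\ell+1}(\lambda-\lambda_j)\,\Psi^{\mathfrak{gl}_{\ell+1}}_{\underline\lambda}(\underline{x})$ for all $\underline\lambda$. In particular $\mathcal{H}_1=-\imath\sum_i\partial_{x_i}$ and $\tfrac12\mathcal{H}_1^2-\mathcal{H}_2=-\tfrac12\sum_{i=1}^{\ell+1}\partial_{x_i}^2+\sum_{i=1}^{\ell}e^{x_i-x_{i+1}}$.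 $T^{\mathfrak{gl}_{\ell+1}}(\lambda)$ is the operator with kernel $T^{\mathfrak{gl}_{\ell+1}}(\underline{x},\underline{y}|\lambda)=t^{\mathfrak{gl}_{\ell+1}}(\underline{x},\partial_{\underline{x}}|\lambda)\,\delta^{(\ell+1)}(\underline{x}-\underline{y})$. *)

theory Defs
  imports "HOL-Analysis.Analysis"
begin

text \<open>
  Since the statement relates \<open>\<real>\<^sup>l\<close> and \<open>\<real>\<^sup>l\<^sup>+\<^sup>1\<close>, points of \<open>\<real>\<^sup>n\<close> are functions on \<open>nat\<close>, extensional
  outside the index set \<open>{1..n}\<close>; Lebesgue measure is the product of the one-dimensional ones.
\<close>

definition Rn :: "nat \<Rightarrow> (nat \<Rightarrow> real) set" where
  "Rn n = (\<Pi>\<^sub>E i\<in>{1..n}. UNIV)"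

definition leb :: "nat \<Rightarrow> (nat \<Rightarrow> real) measure" where
  "leb n = (\<Pi>\<^sub>M i\<in>{1..n}. lborel)"

type_synonym cfun = "(nat \<Rightarrow> real) \<Rightarrow> complex"
type_synonym kernel = "(nat \<Rightarrow> real) \<Rightarrow> cfun"
type_synonym oper = "cfun \<Rightarrow> cfun"


subsection \<open>Integral operators\<close>

definition int_op :: "nat \<Rightarrow> kernel \<Rightarrow> oper" where
  "int_op n K f x = (LINT y|leb n. K x y * f y)"

definition kernel_comp :: "nat \<Rightarrow> kernel \<Rightarrow> kernel \<Rightarrow> kernel" where
  "kernel_comp n K L x z = (LINT y|leb n. K x y * L y z)"

text \<open>
  Absolute convergence of all the integrals defining the kernel of the product of
  \<open>K\<close> (functions on \<open>\<real>\<^sup>n\<close> to functions on \<open>\<real>\<^sup>m\<close>) and \<open>L\<close> (functions on \<open>\<real>\<^sup>k\<close> to functions on \<open>\<real>\<^sup>n\<close>).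
\<close>

definition kernel_comp_conv :: "nat \<Rightarrow> nat \<Rightarrow> nat \<Rightarrow> kernel \<Rightarrow> kernel \<Rightarrow> bool" where
  "kernel_comp_conv m n k K L \<longleftrightarrow>
     (\<forall>x\<in>Rn m. \<forall>z\<in>Rn k. integrable (leb n) (\<lambda>y. K x y * L y z))"

definition baxter_Q :: "nat \<Rightarrow> complex \<Rightarrow> kernel" where
  "baxter_Q n lam x y =
     exp (\<i> * lam * of_real (\<Sum>i=1..n. x i - y i)
          - of_real (\<Sum>k=1..<n. exp (x k - y k) + exp (y k - x (k + 1)))
          - of_real (exp (x n - y n)))"

text \<open>\<open>recursive_Q l\<close> maps functions on \<open>\<real>\<^sup>l\<close> to functions on \<open>\<real>\<^sup>l\<^sup>+\<^sup>1\<close>.\<close>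

definition recursive_Q :: "nat \<Rightarrow> complex \<Rightarrow> kernel" where
  "recursive_Q l lam x y =
     exp (\<i> * lam * of_real ((\<Sum>i=1..l+1. x i) - (\<Sum>i=1..l. y i))
          - of_real (\<Sum>i=1..l. exp (x i - y i) + exp (y i - x (i + 1))))"


subsection \<open>Whittaker functions\<close>

text \<open>
  Here \<open>n = l + 1\<close>. The integration variables \<open>X (k, i)\<close>, \<open>1 \<le> i \<le> k \<le> l\<close>, are completed by
  \<open>X (n, i) = x i\<close>. For \<open>k = 1\<close> the sum over the row \<open>k - 1\<close> is empty.
\<close>

definition triangle :: "nat \<Rightarrow> (nat \<times> nat) set" where
  "triangle l = {(k, i). 1 \<le> i \<and> i \<le> k \<and> k \<le> l}"

definition givental_integrand ::
    "nat \<Rightarrow> (nat \<Rightarrow> complex) \<Rightarrow> (nat \<times> nat \<Rightarrow> real) \<Rightarrow> complex" where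
  "givental_integrand n lam X =
     exp (\<i> * (\<Sum>k=1..n. lam k * of_real ((\<Sum>i=1..k. X (k, i)) - (\<Sum>i=1..k-1. X (k - 1, i))))
          - of_real (\<Sum>k=1..<n. \<Sum>i=1..k.
              exp (X (k + 1, i) - X (k, i)) + exp (X (k, i) - X (k + 1, i + 1))))"

definition whittaker :: "nat \<Rightarrow> (nat \<Rightarrow> complex) \<Rightarrow> cfun" where
  "whittaker n lam x =
     (LINT T|(\<Pi>\<^sub>M p\<in>triangle (n - 1). lborel).
        givental_integrand n lam (\<lambda>(k, i). if k = n then x i else T (k, i)))"


subsection \<open>Differential operators on \<open>\<real>\<^sup>n\<close>\<close>

definition partial :: "nat \<Rightarrow> oper" where
  "partial i f x = vector_derivative (\<lambda>s. f (x(i := s))) (at (x i))"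

text \<open>All iterated partial derivatives exist and are continuous.\<close>

definition smooth :: "nat \<Rightarrow> cfun \<Rightarrow> bool" where
  "smooth n f \<longleftrightarrow>
     (\<forall>w\<in>lists {1..n}.
        continuous_on (Rn n) (foldr partial w f) \<and>
        (\<forall>i\<in>{1..n}. \<forall>x\<in>Rn n. (\<lambda>s. foldr partial w f (x(i := s))) differentiable at (x i)))"

definition test_fun :: "nat \<Rightarrow> cfun \<Rightarrow> bool" where
  "test_fun n f \<longleftrightarrow>
     smooth n f \<and> (\<exists>R. \<forall>x\<in>Rn n. (\<exists>i\<in>{1..n}. \<bar>x i\<bar> > R) \<longrightarrow> f x = 0)"

text \<open>\<open>multi_partial n \<alpha>\<close> is \<open>\<partial>\<^sub>n\<^bsup>\<alpha> n\<^esup> \<dots> \<partial>\<^sub>1\<^bsup>\<alpha> 1\<^esup>\<close>; the value \<open>\<alpha> 0\<close> and those beyond \<open>n\<close> are irrelevant.\<close>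

primrec multi_partial :: "nat \<Rightarrow> (nat \<Rightarrow> nat) \<Rightarrow> oper" where
  "multi_partial 0 \<alpha> f = f"
| "multi_partial (Suc k) \<alpha> f = (partial (Suc k) ^^ \<alpha> (Suc k)) (multi_partial k \<alpha> f)"

definition diff_op :: "nat \<Rightarrow> oper \<Rightarrow> bool" where
  "diff_op n D \<longleftrightarrow>
     (\<exists>A a. finite A \<and> (\<forall>\<alpha>\<in>A. smooth n (a \<alpha>)) \<and>
        D = (\<lambda>f x. \<Sum>\<alpha>\<in>A. a \<alpha> x * multi_partial n \<alpha> f x))"


subsection \<open>Toda Hamiltonians\<close>

definition toda_t :: "nat \<Rightarrow> (nat \<Rightarrow> oper) \<Rightarrow> complex \<Rightarrow> oper" where
  "toda_t n H lam f x = (\<Sum>j=0..n. (-1) ^ j * lam ^ (n - j) * H j f x)"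

text \<open>
  The Hamiltonians are commuting differential operators, normalized by their joint eigenvalues on the
  Whittaker functions. The equations for all spectral parameters determine the coefficients of the
  operators, so at most one family \<open>H 0, \<dots>, H n\<close> (as operators on smooth functions) qualifies.
\<close>

definition toda_hamiltonians :: "nat \<Rightarrow> (nat \<Rightarrow> oper) \<Rightarrow> bool" where
  "toda_hamiltonians n H \<longleftrightarrow>
     H 0 = (\<lambda>f. f) \<and>
     (\<forall>j\<in>{1..n}. diff_op n (H j)) \<and>
     (\<forall>i\<in>{1..n}. \<forall>j\<in>{1..n}. \<forall>f. smooth n f \<longrightarrow>
        (\<forall>x\<in>Rn n. H i (H j f) x = H j (H i f) x)) \<and>
     (\<forall>\<mu> lam. \<forall>x\<in>Rn n.
        toda_t n H \<mu> (whittaker n lam) x = (\<Prod>j=1..n. \<mu> - lam j) * whittaker n lam x)"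

text \<open>
  The kernel \<open>t(x, \<partial>\<^sub>x) \<delta>(x - y)\<close> is a distribution; the operator it defines is \<open>f \<mapsto> t f\<close>. Convolving it
  from the left with a smooth kernel \<open>K\<close>, i.e. \<open>\<integral> (D\<^sub>x \<delta>(x - z)) K(z, y) dz\<close>, gives \<open>D\<^sub>x K(x, y)\<close>.
\<close>

definition op_kernel_comp :: "oper \<Rightarrow> kernel \<Rightarrow> kernel" where
  "op_kernel_comp D K x y = D (\<lambda>z. K z y) x"

end

theory Submission
  imports Defs
begin

text \<open>
  The Baxter kernel and the recursive kernel belong to one family, \<open>toda_kernel n m lam\<close>, which binds a chain of \<open>m + 1\<close> particles \<open>x\<close>
  to a chain of \<open>n\<close> particles \<open>y\<close> by the factors \<open>A k = exp (x k - y k)\<close> and \<open>B k = exp (y k - x (k + 1))\<close>.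

  Commutativity and the recursive relation. In a product of two kernels the intermediate variables decouple: the integrand is a product of
  factors \<open>exp (- w * y k - a k * exp (- y k) - b k * exp (y k))\<close>. The reflection of \<open>y k\<close> to \<open>ln (a k / b k) - y k\<close> preserves the
  potential and reverses the sign of \<open>w\<close>, and the product of the quotients \<open>a k / b k\<close> telescopes to the exponential of the sum of
  all \<open>x i\<close> and \<open>z i\<close>. This is just the factor that exchanges the spectral parameters (\<open>sum_pivot\<close>). In the recursive relation one variable has
  \<open>b k = 0\<close> and contributes the Gamma function.

  The relations with the Hamiltonians. Let \<open>toda_T \<mu> n\<close> be the determinant of the Lax matrix, expanded by its three-term recursion. On a
  kernel it acts as multiplication by a continuant in the \<open>A k\<close> and \<open>B k\<close>, and so does its formal adjoint in the variables \<open>y\<close>. Two identities between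
  the continuants (\<open>tau_tau_adj\<close>) yield everything. At \<open>\<mu> = lam\<close> the continuant is a product, which is the
  shift relation. For the Baxter kernel the two continuants agree, so \<open>toda_T\<close> commutes with the Baxter operator after integration by
  parts. For the recursive kernel they agree up to the factor \<open>\<mu> - lam\<close>, so by induction \<open>toda_T\<close> has the required
  eigenvalues on the Whittaker functions (\<open>toda_T_psi\<close>).

  Identification of the Hamiltonians. These are given only by their action on the Whittaker functions, so it has to be shown that a differential operator
  is determined by this action (\<open>whittaker_jets_span\<close>). For imaginary spectral parameters, a translation of the variables in the Givental integral
  exhibits the Whittaker function as a plane wave times a Laplace transform, in the bonds \<open>exp (x j - x (j + 1))\<close>, of a measure that can be normalized to
  total mass \<open>1\<close> and whose first moments are bounded independently of the parameters (\<open>wp_laplace\<close>). If the exponents of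
  the plane wave are \<open>T ^ (B ^ i)\<close> with large \<open>T\<close>, the derivative with multi-index \<open>\<alpha>\<close> is of the exact order
  \<open>T ^ (\<Sum>i. \<alpha> i * B ^ i)\<close>. These orders are distinct for a sufficiently large base \<open>B\<close>, so no nontrivial combination of derivatives can vanish on all Whittaker functions.
  Hence \<open>toda_t n H \<mu>\<close> and \<open>toda_T \<mu> n\<close> agree on smooth functions.
\<close>

section \<open>Products of Lebesgue measures\<close>

interpretation lborel_prod: product_sigma_finite "\<lambda>_::'i. lborel :: real measure"
  by standard

lemma emeasure_lborel_isometry:
  fixes e h :: real
  assumes "\<bar>e\<bar> = 1" and [measurable]: "A \<in> sets borel"
  shows "emeasure lborel ((\<lambda>t. e * t + h) -` A) = emeasure lborel A"
proof -
  have "emeasure lborel A = (\<integral>\<^sup>+t. indicator A t \<partial>lborel)" by simp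
  also have "\<dots> = (\<integral>\<^sup>+t. indicator A (h + e * t) \<partial>lborel)"
    using assms by (subst nn_integral_real_affine[where c=e and t=h]) auto
  also have "\<dots> = (\<integral>\<^sup>+t. indicator ((\<lambda>t. e * t + h) -` A) t \<partial>lborel)"
    by (intro nn_integral_cong) (auto simp: indicator_def add.commute)
  also have "\<dots> = emeasure lborel ((\<lambda>t. e * t + h) -` A)"
    by (intro nn_integral_indicator) (auto intro!: measurable_sets_borel[of _ borel])
  finally show ?thesis by simp
qed

text \<open>
  One statement serves three purposes: reflections of the coordinates (commutativity of the Baxter
  operators), translations (the Laplace form of the Whittaker functions) and a change of the index set
  (a row of the Givental triangle becomes a point of \<open>\<real>\<^sup>n\<close>).
\<close>

lemma distr_PiM_lborel_coordinatewise:
  fixes \<sigma> :: "'i \<Rightarrow> 'j" and e h :: "'i \<Rightarrow> real"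
  assumes I: "finite I" and \<sigma>: "bij_betw \<sigma> I J" and e: "\<And>i. i \<in> I \<Longrightarrow> \<bar>e i\<bar> = 1"
  shows "(\<lambda>y. \<lambda>i\<in>I. e i * y (\<sigma> i) + h i) \<in> measurable (PiM J (\<lambda>_. lborel)) (PiM I (\<lambda>_. lborel))"
    and "distr (PiM J (\<lambda>_. lborel)) (PiM I (\<lambda>_. lborel)) (\<lambda>y. \<lambda>i\<in>I. e i * y (\<sigma> i) + h i)
         = PiM I (\<lambda>_. lborel)"
proof -
  let ?T = "\<lambda>y. \<lambda>i\<in>I. e i * y (\<sigma> i) + h i"
  have J: "finite J" using I \<sigma> bij_betw_finite by auto
  have \<sigma>J: "\<And>i. i \<in> I \<Longrightarrow> \<sigma> i \<in> J" using \<sigma> by (auto simp: bij_betw_def)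
  show m: "?T \<in> measurable (PiM J (\<lambda>_. lborel)) (PiM I (\<lambda>_. lborel))"
  proof (intro measurable_restrict)
    fix i assume "i \<in> I"
    then have "(\<lambda>y. y (\<sigma> i)) \<in> measurable (PiM J (\<lambda>_. lborel)) (lborel :: real measure)"
      by (intro measurable_component_singleton \<sigma>J)
    then show "(\<lambda>y. e i * y (\<sigma> i) + h i) \<in> measurable (PiM J (\<lambda>_. lborel)) lborel"
      by simp
  qed
  show "distr (PiM J (\<lambda>_. lborel)) (PiM I (\<lambda>_. lborel)) ?T = PiM I (\<lambda>_. lborel)"
  proof (rule lborel_prod.PiM_eqI[OF I])
    fix A :: "'i \<Rightarrow> real set" assume A: "\<And>i. i \<in> I \<Longrightarrow> A i \<in> sets lborel"
    let ?s = "the_inv_into I \<sigma>"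
    have inv: "\<And>i. i \<in> I \<Longrightarrow> ?s (\<sigma> i) = i"
      using \<sigma> by (auto simp: bij_betw_def the_inv_into_f_f)
    have surj: "\<And>j. j \<in> J \<Longrightarrow> \<exists>i\<in>I. j = \<sigma> i" using \<sigma> by (auto simp: bij_betw_def)
    have eq: "?T -` (Pi\<^sub>E I A) \<inter> space (PiM J (\<lambda>_. lborel))
        = Pi\<^sub>E J (\<lambda>j. (\<lambda>t. e (?s j) * t + h (?s j)) -` A (?s j))"
    proof (rule set_eqI)
      fix y
      have "(\<forall>j\<in>J. e (?s j) * y j + h (?s j) \<in> A (?s j)) \<longleftrightarrow> (\<forall>i\<in>I. e i * y (\<sigma> i) + h i \<in> A i)"
        using inv surj \<sigma>J by (metis (no_types, lifting))
      then show "y \<in> ?T -` (Pi\<^sub>E I A) \<inter> space (PiM J (\<lambda>_. lborel)) \<longleftrightarrow>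
        y \<in> Pi\<^sub>E J (\<lambda>j. (\<lambda>t. e (?s j) * t + h (?s j)) -` A (?s j))"
        by (auto simp: space_PiM PiE_iff)
    qed
    have "emeasure (distr (PiM J (\<lambda>_. lborel)) (PiM I (\<lambda>_. lborel)) ?T) (Pi\<^sub>E I A)
        = emeasure (PiM J (\<lambda>_. lborel)) (Pi\<^sub>E J (\<lambda>j. (\<lambda>t. e (?s j) * t + h (?s j)) -` A (?s j)))"
      using A m by (subst emeasure_distr) (auto intro!: sets_PiM_I_finite I simp: eq)
    also have "\<dots> = (\<Prod>j\<in>J. emeasure lborel ((\<lambda>t. e (?s j) * t + h (?s j)) -` A (?s j)))"
    proof (rule lborel_prod.emeasure_PiM[OF J])
      fix j assume "j \<in> J"
      then have "A (?s j) \<in> sets borel" using surj inv A by fastforce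
      then show "(\<lambda>t. e (?s j) * t + h (?s j)) -` A (?s j) \<in> sets lborel"
        by (auto intro!: measurable_sets_borel[of _ borel])
    qed
    also have "\<dots> = (\<Prod>i\<in>I. emeasure lborel (A i))"
    proof (rule prod.reindex_bij_betw[OF \<sigma>, symmetric, THEN trans])
      show "(\<Prod>i\<in>I. emeasure lborel ((\<lambda>t. e (?s (\<sigma> i)) * t + h (?s (\<sigma> i))) -` A (?s (\<sigma> i))))
          = (\<Prod>i\<in>I. emeasure lborel (A i))"
        using A e by (intro prod.cong refl) (simp add: inv emeasure_lborel_isometry)
    qed
    finally show "emeasure (distr (PiM J (\<lambda>_. lborel)) (PiM I (\<lambda>_. lborel)) ?T) (Pi\<^sub>E I A)
        = (\<Prod>i\<in>I. emeasure lborel (A i))" .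
  qed simp
qed

lemma nn_integral_PiM_lborel_coordinatewise:
  fixes \<sigma> :: "'i \<Rightarrow> 'j" and e h :: "'i \<Rightarrow> real"
  assumes "finite I" and "bij_betw \<sigma> I J" and "\<And>i. i \<in> I \<Longrightarrow> \<bar>e i\<bar> = 1"
    and f: "f \<in> borel_measurable (PiM I (\<lambda>_. lborel))"
  shows "(\<integral>\<^sup>+y. f (\<lambda>i\<in>I. e i * y (\<sigma> i) + h i) \<partial>PiM J (\<lambda>_. lborel)) = (\<integral>\<^sup>+y. f y \<partial>PiM I (\<lambda>_. lborel))"
proof -
  let ?T = "\<lambda>y. \<lambda>i\<in>I. e i * y (\<sigma> i) + h i"
  have d: "?T \<in> measurable (PiM J (\<lambda>_. lborel)) (PiM I (\<lambda>_. lborel))"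
    "distr (PiM J (\<lambda>_. lborel)) (PiM I (\<lambda>_. lborel)) ?T = PiM I (\<lambda>_. lborel)"
    by (rule distr_PiM_lborel_coordinatewise; use assms in auto)+
  have "(\<integral>\<^sup>+y. f y \<partial>PiM I (\<lambda>_. lborel)) = (\<integral>\<^sup>+y. f y \<partial>distr (PiM J (\<lambda>_. lborel)) (PiM I (\<lambda>_. lborel)) (\<lambda>y. \<lambda>i\<in>I. e i * y (\<sigma> i) + h i))"
    by (simp add: d(2))
  then show ?thesis using f by (subst (asm) nn_integral_distr[OF d(1)]) auto
qed

lemma integral_PiM_lborel_reflection:
  fixes f :: "('i \<Rightarrow> real) \<Rightarrow> 'b::{banach, second_countable_topology}"
  assumes "finite I" and f: "f \<in> borel_measurable (PiM I (\<lambda>_. lborel))"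
  shows "(LINT y|PiM I (\<lambda>_. lborel). f (\<lambda>i\<in>I. h i - y i)) = (LINT y|PiM I (\<lambda>_. lborel). f y)"
proof -
  note d = distr_PiM_lborel_coordinatewise[where h=h and e="\<lambda>_. -1" and \<sigma>="\<lambda>i. i", OF assms(1), of I]
  have "(LINT y|PiM I (\<lambda>_. lborel). f y) = (LINT y|distr (PiM I (\<lambda>_. lborel)) (PiM I (\<lambda>_. lborel)) (\<lambda>y. \<lambda>i\<in>I. (-1) * y i + h i). f y)"
    by (subst d(2)) (auto simp: bij_betw_def)
  also have "\<dots> = (LINT y|PiM I (\<lambda>_. lborel). f (\<lambda>i\<in>I. (-1) * y i + h i))"
    using d(1) f by (subst integral_distr) (auto simp: bij_betw_def)
  also have "\<dots> = (LINT y|PiM I (\<lambda>_. lborel). f (\<lambda>i\<in>I. h i - y i))" by simp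
  finally show ?thesis by simp
qed

lemma integrable_exp_minus_abs: "integrable lborel (\<lambda>s::real. exp (- \<bar>s\<bar>))"
proof -
  have 1: "set_integrable lborel {0..} (\<lambda>s::real. exp (- s))"
  proof -
    have "(\<lambda>s::real. exp (- 1 * s)) absolutely_integrable_on {0..}"
      by (intro nonnegative_absolutely_integrable_1 integrable_on_exp_minus_to_infinity) auto
    then show ?thesis by (simp add: set_integrable_def integrable_completion)
  qed
  then have "integrable lborel (\<lambda>s::real. indicator {0..} s * exp (- s))"
    by (simp add: set_integrable_def)
  moreover from this have "integrable lborel (\<lambda>s::real. indicator {0..} (0 + (-1) * s) * exp (- (0 + (-1) * s)))"
    by (subst lborel_integrable_real_affine_iff) auto
  ultimately have "integrable lborel (\<lambda>s::real. indicator {0..} s * exp (- s) + indicator {0..} (-s) * exp s)"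
    by (intro Bochner_Integration.integrable_add) auto
  then show ?thesis
    by (rule Bochner_Integration.integrable_bound) (auto simp: indicator_def)
qed

lemma gamma_substitution_real:
  fixes f :: "real \<Rightarrow> real"
  assumes f: "f absolutely_integrable_on {0<..}" and [measurable]: "f \<in> borel_measurable borel"
  shows "integrable lborel (\<lambda>v. exp v * f (exp v))"
    and "(LINT v|lborel. exp v * f (exp v)) = integral {0<..} f"
proof -
  have im: "exp ` (UNIV :: real set) = {0<..}"
    by (auto simp: image_iff) (metis exp_ln)
  have "(\<lambda>v. \<bar>exp v\<bar> * f (exp v)) absolutely_integrable_on UNIV \<and>
      integral UNIV (\<lambda>v. \<bar>exp v\<bar> * f (exp v)) = integral {0<..} f"
    using f by (subst has_absolute_integral_change_of_variables_1')
      (auto simp: im inj_on_def intro!: derivative_eq_intros)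
  then have *: "integrable lebesgue (\<lambda>v. exp v * f (exp v))" 
    "integral UNIV (\<lambda>v. exp v * f (exp v)) = integral {0<..} f"
    by (auto simp: set_integrable_def)
  show i: "integrable lborel (\<lambda>v. exp v * f (exp v))"
    using * by (subst (asm) integrable_completion) auto
  have "((\<lambda>v. exp v * f (exp v)) has_integral (LINT v|lborel. exp v * f (exp v))) UNIV"
    using has_integral_integral_lborel[OF i] .
  then show "(LINT v|lborel. exp v * f (exp v)) = integral {0<..} f"
    using * by (simp add: integral_unique)
qed

lemma gamma_integral_exp:
  assumes z: "Re z > 0"
  shows "integrable lborel (\<lambda>v. exp (z * of_real v - of_real (exp v)))"
    and "(LINT v|lborel. exp (z * of_real v - of_real (exp v))) = Gamma z"
proof -
  let ?g = "\<lambda>t. exp ((z - 1) * of_real (ln t)) / complex_of_real (exp t)"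
  have gm [measurable]: "?g \<in> borel_measurable borel" by measurable
  have eq: "?g t = of_real t powr (z - 1) / of_real (exp t)" if "t \<in> {0<..}" for t
    using that by (simp add: powr_def Ln_of_real)
  have a: "?g absolutely_integrable_on {0<..}"
    using absolutely_integrable_Gamma_integral'[OF z] by (subst set_integrable_cong[OF refl refl eq]) auto
  have hi: "(?g has_integral Gamma z) {0<..}"
    using Gamma_integral_complex'[OF z] by (subst has_integral_cong[OF eq]) auto
  have aR: "(\<lambda>t. Re (?g t)) absolutely_integrable_on {0<..}" and aI: "(\<lambda>t. Im (?g t)) absolutely_integrable_on {0<..}"
    using absolutely_integrable_linear[OF a bounded_linear_Re] absolutely_integrable_linear[OF a bounded_linear_Im]
    by (auto simp: o_def)
  have iR: "integral {0<..} (\<lambda>t. Re (?g t)) = Re (Gamma z)" and iI: "integral {0<..} (\<lambda>t. Im (?g t)) = Im (Gamma z)"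
    using has_integral_linear[OF hi bounded_linear_Re] has_integral_linear[OF hi bounded_linear_Im]
    by (auto simp: o_def intro!: integral_unique)
  have key: "complex_of_real (exp v) * ?g (exp v) = exp (z * of_real v - of_real (exp v))" for v
    by (simp add: exp_diff algebra_simps flip: exp_of_real)
  have kR: "exp v * Re (?g (exp v)) = Re (exp (z * of_real v - of_real (exp v)))" 
    and kI: "exp v * Im (?g (exp v)) = Im (exp (z * of_real v - of_real (exp v)))" for v
    unfolding key[symmetric] by simp_all
  have R: "integrable lborel (\<lambda>v. Re (exp (z * of_real v - of_real (exp v))))"
     "(LINT v|lborel. Re (exp (z * of_real v - of_real (exp v)))) = Re (Gamma z)"
    using gamma_substitution_real[OF aR] iR unfolding kR by auto
  have I: "integrable lborel (\<lambda>v. Im (exp (z * of_real v - of_real (exp v))))"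
     "(LINT v|lborel. Im (exp (z * of_real v - of_real (exp v)))) = Im (Gamma z)"
    using gamma_substitution_real[OF aI] iI unfolding kI by auto
  show i: "integrable lborel (\<lambda>v. exp (z * of_real v - of_real (exp v)))"
  proof -
    have "integrable lborel (\<lambda>v. complex_of_real (Re (exp (z * of_real v - of_real (exp v))))
        + \<i> * complex_of_real (Im (exp (z * of_real v - of_real (exp v)))))"
      by (intro Bochner_Integration.integrable_add integrable_mult_right integrable_of_real R(1) I(1))
    then show ?thesis by (simp only: complex_eq[symmetric])
  qed
  show "(LINT v|lborel. exp (z * of_real v - of_real (exp v))) = Gamma z"
    using R(2) I(2) by (intro complex_eqI) (simp_all flip: integral_Re[OF i] integral_Im[OF i])
qed

text \<open>
  The converse is what turns the absolute convergence assumed of a kernel product into the condition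
  under which its Gamma integral may be evaluated: near \<open>-\<infinity>\<close> the integrand has modulus about \<open>exp (Re z * v)\<close>.
\<close>

lemma gamma_integral_exp_only_if:
  assumes "integrable lborel (\<lambda>v. exp (z * of_real v - of_real (exp v)))"
  shows "Re z > 0"
proof (rule ccontr)
  assume n: "\<not> Re z > 0"
  have "integrable lborel (\<lambda>v. exp 1 * norm (exp (z * of_real v - of_real (exp v))))"
    by (intro integrable_mult_right integrable_norm assms)
  then have "integrable lborel (\<lambda>v::real. indicator {..0} v *\<^sub>R (1::real))"
  proof (rule Bochner_Integration.integrable_bound)
    have "1 \<le> exp 1 * exp (Re z * v - exp v)" if "v \<le> 0" for v
    proof -
      have "0 \<le> Re z * v" using n that by (intro mult_nonpos_nonpos) auto
      moreover have "exp v \<le> 1" using that by simp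
      ultimately have "1 \<le> exp (1 + (Re z * v - exp v))"
        by (subst one_le_exp_iff) linarith
      then show ?thesis by (simp only: exp_add)
    qed
    then show "AE v in lborel. norm (indicator {..0} v *\<^sub>R (1::real)) \<le> norm (exp 1 * norm (exp (z * of_real v - of_real (exp v))))"
      by (intro AE_I2) (auto simp: indicator_def norm_exp_eq_Re)
  qed simp
  then have "emeasure lborel {..0::real} < \<infinity>"
    by (simp add: integrable_indicator_iff)
  then obtain r where r: "emeasure lborel {..0::real} = ennreal r" "r \<ge> 0"
    by (cases "emeasure lborel {..0::real}") auto
  have "emeasure lborel {- (r + 1)..0} \<le> emeasure lborel {..0::real}"
    by (intro emeasure_mono) auto
  then show False using r by simp
qed

lemma nn_integral_gamma_exp:
  assumes c: "c > 0"
  shows "(\<integral>\<^sup>+v. ennreal (exp (c * v - exp v)) \<partial>lborel) = ennreal (Gamma c)"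
proof -
  have eq: "exp (complex_of_real c * of_real v - of_real (exp v)) = complex_of_real (exp (c * v - exp v))" for v
    by (simp flip: of_real_mult of_real_diff add: exp_of_real del: of_real_exp)
  have i: "integrable lborel (\<lambda>v. exp (c * v - exp v))"
   and e: "(LINT v|lborel. exp (c * v - exp v)) = Gamma c"
    using gamma_integral_exp[of "of_real c"] c unfolding eq complex_of_real_integrable_eq
    by (simp_all add: Gamma_complex_of_real)
  show ?thesis using nn_integral_eq_integral[OF i] e by simp
qed

lemma leb_simps [simp]: "space (leb n) = Rn n" "sets (leb n) = sets (PiM {1..n} (\<lambda>_. borel))"
  by (auto simp: leb_def Rn_def space_PiM intro!: sets_PiM_cong)

lemma measurable_leb_component [measurable]:
  "i \<in> {1..n} \<Longrightarrow> (\<lambda>y. y i) \<in> borel_measurable (leb n)"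
  unfolding leb_def using measurable_component_singleton[of i "{1..n}" "\<lambda>_. lborel :: real measure"] by simp

lemma borel_measurable_exp_comp:
  fixes f :: "'a \<Rightarrow> 'b::{real_normed_field, banach}"
  shows "f \<in> borel_measurable M \<Longrightarrow> (\<lambda>x. exp (f x)) \<in> borel_measurable M"
  by (rule borel_measurable_continuous_on) (intro continuous_intros)

lemmas leb_measurable_intros = borel_measurable_exp_comp borel_measurable_diff borel_measurable_add
  borel_measurable_times borel_measurable_of_real borel_measurable_uminus borel_measurable_sum
  measurable_leb_component borel_measurable_const

lemma Rn_upd [simp]: "x \<in> Rn n \<Longrightarrow> i \<in> {1..n} \<Longrightarrow> x(i := s) \<in> Rn n"
  by (auto simp: Rn_def PiE_def extensional_def)

lemma restrict_in_Rn [simp]: "restrict f {1..n} \<in> Rn n"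
  by (auto simp: Rn_def)

text \<open>
  Fubini gives integrability of almost every slice, and a product of copies of Lebesgue measure is not
  the zero measure, so some slice is integrable.
\<close>

lemma integrable_PiM_insert_slice:
  fixes f :: "('i \<Rightarrow> real) \<Rightarrow> 'b::{banach, second_countable_topology}"
  assumes I: "finite I" "i \<notin> I" and f: "integrable (PiM (insert i I) (\<lambda>_. lborel)) f"
  shows "\<exists>x\<in>space (PiM I (\<lambda>_. lborel)). integrable lborel (\<lambda>s. f (x(i := s)))"
proof -
  let ?M = "PiM I (\<lambda>_. lborel :: real measure)"
  have fm: "f \<in> borel_measurable (PiM (insert i I) (\<lambda>_. lborel))" using f by auto
  have slice: "(\<lambda>s. f (x(i := s))) \<in> borel_measurable lborel" if "x \<in> space ?M" for x
    using measurable_comp[OF measurable_component_update fm, OF that I(2)] unfolding comp_def .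
  have m: "(\<lambda>x. \<integral>\<^sup>+s. norm (f (x(i := s))) \<partial>lborel) \<in> borel_measurable ?M"
    using measurable_compose[OF measurable_add_dim fm]
    by (intro lborel.borel_measurable_nn_integral) (auto simp: case_prod_beta')
  have "(\<integral>\<^sup>+x. \<integral>\<^sup>+s. norm (f (x(i := s))) \<partial>lborel \<partial>?M) = (\<integral>\<^sup>+x. norm (f x) \<partial>PiM (insert i I) (\<lambda>_. lborel))"
    using fm by (subst lborel_prod.product_nn_integral_insert[OF I]) auto
  also have "\<dots> < \<infinity>" using f by (simp add: integrable_iff_bounded)
  finally have "AE x in ?M. (\<integral>\<^sup>+s. norm (f (x(i := s))) \<partial>lborel) \<noteq> \<infinity>"
    using m by (intro nn_integral_PInf_AE) auto
  moreover have "emeasure ?M (space ?M) \<noteq> 0"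
    using I(1) by (simp add: space_PiM lborel_prod.emeasure_PiM)
  then have "ae_filter ?M \<noteq> bot" by (simp add: ae_filter_eq_bot_iff)
  ultimately have "\<exists>x. x \<in> space ?M \<and> (\<integral>\<^sup>+s. norm (f (x(i := s))) \<partial>lborel) \<noteq> \<infinity>"
    by (intro eventually_happens'[of "ae_filter ?M"] eventually_conj AE_space) auto
  then obtain x where "x \<in> space ?M" "(\<integral>\<^sup>+s. norm (f (x(i := s))) \<partial>lborel) \<noteq> \<infinity>" by blast
  then show ?thesis
    using slice by (intro bexI[of _ x]) (auto simp: integrable_iff_bounded less_top)
qed

section \<open>Commutativity and the recursive relation\<close>

text \<open>
  In the product of two kernels from \<open>x\<close> through \<open>y\<close> to \<open>z\<close>, the variable \<open>y k\<close> occurs in a plane wave and in the potential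
  \<open>a * exp (- y k) + b * exp (y k)\<close>, where \<open>a\<close> and \<open>b\<close> are the following two weights. The first variable is
  not bound to any \<open>z\<close> on its left.
\<close>

definition fwd_weight :: "(nat \<Rightarrow> real) \<Rightarrow> (nat \<Rightarrow> real) \<Rightarrow> nat \<Rightarrow> real" where
  "fwd_weight x z k = exp (x k) + (if k = 1 then 0 else exp (z (k - 1)))"

definition bwd_weight :: "(nat \<Rightarrow> real) \<Rightarrow> (nat \<Rightarrow> real) \<Rightarrow> nat \<Rightarrow> real" where
  "bwd_weight x z k = exp (- z k) + exp (- x (k + 1))"

lemma fwd_weight_pos: "fwd_weight x z k > 0"
  by (auto simp: fwd_weight_def intro!: add_pos_nonneg)

lemma bwd_weight_pos: "bwd_weight x z k > 0"
  by (auto simp: bwd_weight_def intro!: add_pos_pos)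

text \<open>The reflection that fixes the potential of \<open>y k\<close> maps \<open>y k\<close> to the pivot minus \<open>y k\<close>.\<close>

definition pivot :: "(nat \<Rightarrow> real) \<Rightarrow> (nat \<Rightarrow> real) \<Rightarrow> nat \<Rightarrow> real" where
  "pivot x z k = ln (fwd_weight x z k) - ln (bwd_weight x z k)"

text \<open>
  The backward weight at \<open>k\<close> is the forward weight at \<open>k + 1\<close> divided by \<open>exp (z k + x (k + 1))\<close>, so the sum
  of the logarithms telescopes. This is the reason why reflecting all \<open>y k\<close> exchanges the spectral
  parameters carried by \<open>x\<close> and by \<open>z\<close>.
\<close>

lemma sum_pivot:
  "(\<Sum>k=1..l. pivot x z k) + ln (fwd_weight x z (l + 1)) = (\<Sum>i=1..l+1. x i) + (\<Sum>i=1..l. z i)"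
proof (induction l)
  case 0
  then show ?case by (simp add: fwd_weight_def)
next
  case (Suc l)
  have "bwd_weight x z (Suc l) = exp (- z (Suc l) - x (Suc l + 1)) * fwd_weight x z (Suc l + 1)"
    by (simp add: bwd_weight_def fwd_weight_def algebra_simps flip: exp_add)
  then have "ln (bwd_weight x z (Suc l)) = - z (Suc l) - x (Suc l + 1) + ln (fwd_weight x z (Suc l + 1))"
    using fwd_weight_pos[of x z "Suc l + 1"] by (simp add: ln_mult)
  then show ?case using Suc by (simp add: pivot_def)
qed

definition pair_potential :: "nat \<Rightarrow> (nat \<Rightarrow> real) \<Rightarrow> (nat \<Rightarrow> real) \<Rightarrow> (nat \<Rightarrow> real) \<Rightarrow> real" where
  "pair_potential l x z y = (\<Sum>k=1..l. fwd_weight x z k * exp (- y k) + bwd_weight x z k * exp (y k))"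

lemma pair_potential_reflect:
  "pair_potential l x z (\<lambda>i\<in>{1..l}. pivot x z i - y i) = pair_potential l x z y"
  unfolding pair_potential_def
proof (intro sum.cong refl)
  fix k assume k: "k \<in> {1..l}"
  show "fwd_weight x z k * exp (- (\<lambda>i\<in>{1..l}. pivot x z i - y i) k) +
         bwd_weight x z k * exp ((\<lambda>i\<in>{1..l}. pivot x z i - y i) k) =
         fwd_weight x z k * exp (- y k) + bwd_weight x z k * exp (y k)"
    using k fwd_weight_pos[of x z k] bwd_weight_pos[of x z k]
    by (simp add: pivot_def exp_diff exp_add exp_minus field_simps)
qed

lemma sum_interleaved_potential:
  "(\<Sum>k=1..l. exp (x k - y k) + exp (y k - x (k + 1))) + (\<Sum>i=1..l. exp (y i - z i))
     + (\<Sum>i=1..l. exp (z i - y (i + 1))) + exp (x (l + 1) - y (l + 1))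
   = pair_potential l x z y + fwd_weight x z (l + 1) * exp (- y (l + 1))"
proof (induction l)
  case 0
  then show ?case by (simp add: pair_potential_def fwd_weight_def exp_diff exp_minus field_simps)
next
  case (Suc l)
  have "exp (z (Suc l) - y (Suc l + 1)) + exp (x (Suc l + 1) - y (Suc l + 1)) = fwd_weight x z (Suc l + 1) * exp (- y (Suc l + 1))"
    by (simp add: fwd_weight_def exp_diff exp_minus field_simps)
  moreover have "exp (y (Suc l) - x (Suc l + 1)) + exp (y (Suc l) - z (Suc l)) = bwd_weight x z (Suc l) * exp (y (Suc l))"
    by (simp add: bwd_weight_def exp_diff exp_minus field_simps)
  ultimately show ?case using Suc by (simp add: pair_potential_def)
qed

lemma baxter_Q_Suc:
  "baxter_Q (l + 1) lam x y = exp (\<i> * lam * of_real ((\<Sum>i=1..l+1. x i) - (\<Sum>i=1..l+1. y i))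
     - of_real ((\<Sum>k=1..l. exp (x k - y k) + exp (y k - x (k + 1))) + exp (x (l + 1) - y (l + 1))))"
  by (simp add: baxter_Q_def sum_subtractf atLeastLessThanSuc_atLeastAtMost algebra_simps del: sum.cl_ivl_Suc)

text \<open>
  Replacing every \<open>y k\<close> by its pivot minus \<open>y k\<close> fixes the potential and replaces the sum of the \<open>y k\<close> by the sum of all
  \<open>x k\<close> and \<open>z k\<close> minus it; this turns the integrand for \<open>(lam, lam')\<close> into the integrand for
  \<open>(lam', lam)\<close>. The last coordinate has a different pivot, since its backward weight is \<open>exp (- z n)\<close> alone.
\<close>

theorem baxter_Q_commute:
  assumes x: "x \<in> Rn (l + 1)" and z: "z \<in> Rn (l + 1)"
  shows "kernel_comp (l + 1) (baxter_Q (l + 1) lam) (baxter_Q (l + 1) lam') x z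
       = kernel_comp (l + 1) (baxter_Q (l + 1) lam') (baxter_Q (l + 1) lam) x z"
proof -
  define n where "n = l + 1"
  define h where "h k = (if k = n then ln (fwd_weight x z n) + z n else pivot x z k)" for k
  let ?SX = "\<Sum>i=1..n. x i" and ?SZ = "\<Sum>i=1..n. z i"
  let ?V = "\<lambda>y. pair_potential l x z y + fwd_weight x z n * exp (- y n) + exp (y n - z n)"
  let ?F = "\<lambda>lam lam' y. exp (\<i> * lam * of_real (?SX - (\<Sum>i=1..n. y i)) + \<i> * lam' * of_real ((\<Sum>i=1..n. y i) - ?SZ) - of_real (?V y))"
  have F: "baxter_Q (l + 1) lam x y * baxter_Q (l + 1) lam' y z = ?F lam lam' y" for lam lam' y
  proof -
    have "?V y = ((\<Sum>k=1..l. exp (x k - y k) + exp (y k - x (k + 1))) + exp (x (l + 1) - y (l + 1)))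
       + ((\<Sum>k=1..l. exp (y k - z k) + exp (z k - y (k + 1))) + exp (y (l + 1) - z (l + 1)))"
      using sum_interleaved_potential[of x y l z] by (simp add: n_def sum.distrib)
    then show ?thesis
      unfolding baxter_Q_Suc n_def by (simp flip: exp_add del: sum.cl_ivl_Suc) (simp add: algebra_simps del: sum.cl_ivl_Suc)
  qed
  have sumh: "(\<Sum>i=1..n. h i) = ?SX + ?SZ"
    using sum_pivot[of x z l] by (simp add: n_def h_def)
  have refl: "?F lam lam' (\<lambda>i\<in>{1..n}. h i - y i) = ?F lam' lam y" for y
  proof -
    let ?y = "\<lambda>i\<in>{1..n}. h i - y i"
    have "pair_potential l x z ?y = pair_potential l x z (\<lambda>i\<in>{1..l}. pivot x z i - y i)"
      unfolding pair_potential_def by (intro sum.cong refl) (auto simp: h_def n_def)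
    then have 1: "pair_potential l x z ?y = pair_potential l x z y"
      using pair_potential_reflect by (rule trans)
    have 2: "fwd_weight x z n * exp (- ?y n) + exp (?y n - z n) = fwd_weight x z n * exp (- y n) + exp (y n - z n)"
      using fwd_weight_pos[of x z n] by (simp add: h_def n_def exp_diff exp_add exp_minus field_simps)
    have 3: "?V ?y = ?V y" using 1 2 by linarith
    have 4: "(\<Sum>i=1..n. ?y i) = ?SX + ?SZ - (\<Sum>i=1..n. y i)"
      using sumh by (simp add: sum_subtractf)
    show ?thesis unfolding 3 4 by (simp add: algebra_simps)
  qed
  have m: "?F lam lam' \<in> borel_measurable (PiM {1..n} (\<lambda>_. lborel))"
    unfolding leb_def[symmetric] pair_potential_def n_def
    by (intro leb_measurable_intros) auto
  have "kernel_comp (l + 1) (baxter_Q (l + 1) lam) (baxter_Q (l + 1) lam') x z = (LINT y|PiM {1..n} (\<lambda>_. lborel). ?F lam lam' y)"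
    unfolding kernel_comp_def F leb_def n_def ..
  also have "\<dots> = (LINT y|PiM {1..n} (\<lambda>_. lborel). ?F lam lam' (\<lambda>i\<in>{1..n}. h i - y i))"
    by (rule integral_PiM_lborel_reflection[OF _ m, symmetric]) simp
  also have "\<dots> = (LINT y|PiM {1..n} (\<lambda>_. lborel). ?F lam' lam y)" unfolding refl ..
  also have "\<dots> = kernel_comp (l + 1) (baxter_Q (l + 1) lam') (baxter_Q (l + 1) lam) x z"
    unfolding kernel_comp_def F leb_def n_def ..
  finally show ?thesis .
qed

lemma integrable_cmult_cancel:
  fixes c :: "'b::{real_normed_field, banach, second_countable_topology}"
  assumes "c \<noteq> 0" "integrable M (\<lambda>s. c * f s)"
  shows "integrable M f"
  using integrable_mult_right[OF assms(2), of "inverse c"] assms(1) by (simp add: mult.assoc[symmetric])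

lemma gamma_integral_exp_scaled:
  fixes w :: complex
  assumes a: "a > 0" and i: "integrable lborel (\<lambda>s. exp (- (w * of_real s) - of_real (a * exp (- s))))"
  shows "(LINT s|lborel. exp (- (w * of_real s) - of_real (a * exp (- s)))) = exp (- (w * of_real (ln a))) * Gamma w"
proof -
  let ?f = "\<lambda>s. exp (- (w * of_real s) - of_real (a * exp (- s)))"
  have eq: "?f (ln a + (-1) * u) = exp (- (w * of_real (ln a))) * exp (w * of_real u - of_real (exp u))" for u
  proof -
    have "a * exp (- (ln a + (-1) * u)) = exp u" using a by (simp add: exp_add exp_minus exp_diff)
    then show ?thesis by (simp add: algebra_simps flip: exp_add)
  qed
  have "integrable lborel (\<lambda>u. ?f (ln a + (-1) * u))"
    using i by (subst lborel_integrable_real_affine_iff) auto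
  then have "integrable lborel (\<lambda>u. exp (w * of_real u - of_real (exp u)))"
    unfolding eq by (rule integrable_cmult_cancel[rotated]) simp
  then have w: "Re w > 0" by (rule gamma_integral_exp_only_if)
  have "(LINT s|lborel. ?f s) = (LINT u|lborel. ?f (ln a + (-1) * u))"
    by (subst lborel_integral_real_affine[where c="-1" and t="ln a"]) auto
  also have "\<dots> = exp (- (w * of_real (ln a))) * Gamma w"
    unfolding eq by (simp add: gamma_integral_exp(2)[OF w])
  finally show ?thesis .
qed

text \<open>
  The first \<open>l\<close> variables have the same weights on both sides and are reflected as before. The last variable
  on the left has no backward weight; its integral is the Gamma factor times a power of the last forward weight, and
  that power is the end term of the telescoping sum.
\<close>

theorem baxter_Q_recursive_Q:
  assumes l: "l \<ge> 1"
    and conv: "kernel_comp_conv (l + 1) (l + 1) l (baxter_Q (l + 1) \<gamma>) (recursive_Q l lam)"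
    and x: "x \<in> Rn (l + 1)" and z: "z \<in> Rn l"
  shows "kernel_comp (l + 1) (baxter_Q (l + 1) \<gamma>) (recursive_Q l lam) x z
       = Gamma (\<i> * \<gamma> - \<i> * lam) * kernel_comp l (recursive_Q l lam) (baxter_Q l \<gamma>) x z"
proof -
  obtain l' where l': "l = l' + 1" using l by (metis Suc_eq_plus1 not0_implies_Suc not_one_le_zero)
  define w where "w = \<i> * \<gamma> - \<i> * lam"
  let ?SX = "\<Sum>i=1..l+1. x i" and ?SZ = "\<Sum>i=1..l. z i"
  let ?a = "fwd_weight x z (l + 1)"
  let ?h = "pivot x z"
  let ?\<phi> = "\<lambda>y. exp (- (w * of_real (\<Sum>i=1..l. y i)) - of_real (pair_potential l x z y))"
  let ?\<phi>' = "\<lambda>y. exp (w * of_real (\<Sum>i=1..l. y i) - of_real (pair_potential l x z y))"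
  let ?\<chi> = "\<lambda>s. exp (- (w * of_real s) - of_real (?a * exp (- s)))"
  let ?c = "exp (\<i> * \<gamma> * of_real ?SX - \<i> * lam * of_real ?SZ)"
  let ?G = "\<lambda>y. baxter_Q (l + 1) \<gamma> x y * recursive_Q l lam y z"
  have G: "?G (y(l + 1 := s)) = ?c * ?\<phi> y * ?\<chi> s" for y s
  proof -
    let ?y = "y(l + 1 := s)"
    have pp: "pair_potential l x z ?y = pair_potential l x z y"
      unfolding pair_potential_def by (intro sum.cong refl) auto
    have V: "(\<Sum>k=1..l. exp (x k - ?y k) + exp (?y k - x (k + 1))) + exp (x (l + 1) - ?y (l + 1))
       + (\<Sum>k=1..l. exp (?y k - z k) + exp (z k - ?y (k + 1)))
       = pair_potential l x z y + ?a * exp (- s)"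
      using sum_interleaved_potential[of x ?y l z] unfolding pp by (simp add: sum.distrib)
    have S: "(\<Sum>i=1..l+1. ?y i) = (\<Sum>i=1..l. y i) + s"
      by (simp add: sum.cong[where g="?y" and h=y])
    have "?G ?y = exp (\<i> * \<gamma> * of_real (?SX - ((\<Sum>i=1..l. y i) + s)) + \<i> * lam * of_real (((\<Sum>i=1..l. y i) + s) - ?SZ)
        - of_real (pair_potential l x z y + ?a * exp (- s)))"
      unfolding baxter_Q_Suc recursive_Q_def S V[symmetric] by (simp flip: exp_add del: sum.cl_ivl_Suc fun_upd_apply)
        (simp add: algebra_simps del: sum.cl_ivl_Suc fun_upd_apply)
    then show ?thesis by (simp add: w_def algebra_simps flip: exp_add del: sum.cl_ivl_Suc)
  qed
  have ins: "{1..l+1} = insert (l+1) {1..l}" by auto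
  have int: "integrable (PiM (insert (l+1) {1..l}) (\<lambda>_. lborel)) ?G"
    using conv x z unfolding kernel_comp_conv_def leb_def ins by auto
  \<comment> \<open>Convergence of the product kernel forces convergence of the Gamma integral.\<close>
  obtain y0 where y0: "integrable lborel (\<lambda>s. ?c * ?\<phi> y0 * ?\<chi> s)"
    using integrable_PiM_insert_slice[OF _ _ int] unfolding G by auto
  have "integrable lborel ?\<chi>"
    by (rule integrable_cmult_cancel[OF _ y0]) simp
  then have \<chi>: "(LINT s|lborel. ?\<chi> s) = exp (- (w * of_real (ln ?a))) * Gamma w"
    by (rule gamma_integral_exp_scaled[OF fwd_weight_pos])
  have refl: "?\<phi> (\<lambda>i\<in>{1..l}. ?h i - y i) = exp (- (w * of_real (\<Sum>i=1..l. ?h i))) * ?\<phi>' y" for y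
    unfolding pair_potential_reflect by (simp add: sum_subtractf algebra_simps flip: exp_add)
  have m: "?\<phi> \<in> borel_measurable (PiM {1..l} (\<lambda>_. lborel))"
    unfolding leb_def[symmetric] pair_potential_def by (intro leb_measurable_intros) auto
  have "(LINT y|leb l. ?\<phi> y) = (LINT y|leb l. ?\<phi> (\<lambda>i\<in>{1..l}. ?h i - y i))"
    unfolding leb_def by (rule integral_PiM_lborel_reflection[OF _ m, symmetric]) simp
  then have \<phi>: "(LINT y|leb l. ?\<phi> y) = exp (- (w * of_real (\<Sum>i=1..l. ?h i))) * (LINT y|leb l. ?\<phi>' y)"
    unfolding refl by simp
  have R: "recursive_Q l lam x y * baxter_Q l \<gamma> y z = exp (\<i> * lam * of_real ?SX - \<i> * \<gamma> * of_real ?SZ) * ?\<phi>' y" for y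
  proof -
    have "pair_potential l x z y = (\<Sum>k=1..l. exp (x k - y k) + exp (y k - x (k + 1)))
       + ((\<Sum>k=1..l'. exp (y k - z k) + exp (z k - y (k + 1))) + exp (y (l' + 1) - z (l' + 1)))"
    proof -
      have "bwd_weight x z (Suc l') * exp (y (Suc l')) = exp (y (Suc l') - z (Suc l')) + exp (y (Suc l') - x (Suc (Suc l')))"
        by (simp add: bwd_weight_def exp_diff exp_minus field_simps)
      moreover have "pair_potential (Suc l') x z y = pair_potential l' x z y
          + fwd_weight x z (Suc l') * exp (- y (Suc l')) + bwd_weight x z (Suc l') * exp (y (Suc l'))"
        by (simp add: pair_potential_def)
      ultimately show ?thesis
        using sum_interleaved_potential[of x y l' z] unfolding l' by (simp add: sum.distrib)
    qed
    then show ?thesis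
      unfolding l' baxter_Q_Suc recursive_Q_def by (simp flip: exp_add del: sum.cl_ivl_Suc)
         (simp add: w_def algebra_simps del: sum.cl_ivl_Suc)
  qed
  have "kernel_comp (l + 1) (baxter_Q (l + 1) \<gamma>) (recursive_Q l lam) x z
      = (LINT y|PiM (insert (l + 1) {1..l}) (\<lambda>_. lborel). ?G y)"
    unfolding kernel_comp_def leb_def ins ..
  also have "\<dots> = (LINT y|leb l. LINT s|lborel. ?G (y(l + 1 := s)))"
    unfolding leb_def by (rule lborel_prod.product_integral_insert[OF _ _ int]) auto
  also have "\<dots> = (LINT y|leb l. LINT s|lborel. ?c * ?\<phi> y * ?\<chi> s)" unfolding G ..
  also have "\<dots> = ?c * (LINT y|leb l. ?\<phi> y) * (LINT s|lborel. ?\<chi> s)"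
    by (simp del: sum.cl_ivl_Suc of_real_sum)
  also have "\<dots> = Gamma w * (exp (\<i> * \<gamma> * of_real ?SX - \<i> * lam * of_real ?SZ - w * of_real ((\<Sum>i=1..l. ?h i) + ln ?a)) * (LINT y|leb l. ?\<phi>' y))"
    unfolding \<phi> \<chi> by (simp add: exp_diff exp_add exp_minus field_simps del: sum.cl_ivl_Suc)
  also have "exp (\<i> * \<gamma> * of_real ?SX - \<i> * lam * of_real ?SZ - w * of_real ((\<Sum>i=1..l. ?h i) + ln ?a))
      = exp (\<i> * lam * of_real ?SX - \<i> * \<gamma> * of_real ?SZ)"
    unfolding sum_pivot w_def by (simp add: algebra_simps del: sum.cl_ivl_Suc)
  also have "\<dots> * (LINT y|leb l. ?\<phi>' y) = kernel_comp l (recursive_Q l lam) (baxter_Q l \<gamma>) x z"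
    unfolding kernel_comp_def R by simp
  finally show ?thesis by (simp add: w_def)
qed

section \<open>Classes of smooth functions\<close>

lemma partial_eqI:
  "((\<lambda>s. f (x(i := s))) has_vector_derivative D) (at (x i)) \<Longrightarrow> partial i f x = D"
  unfolding partial_def by (rule vector_derivative_at)

lemma partial_cong_Rn:
  assumes "\<And>x. x \<in> Rn n \<Longrightarrow> f x = g x" "i \<in> {1..n}" "x \<in> Rn n"
  shows "partial i f x = partial i g x"
  unfolding partial_def using assms by (intro arg_cong2[where f=vector_derivative] ext refl) auto

text \<open>
  Smooth functions are needed with several bounds on all their derivatives: none, exponential growth, and
  integrability against a kernel. The closure properties below are those used by the Toda operator, so
  one proof covers all three.
\<close>

locale growth_class =
  fixes n :: nat and \<G> :: "cfun \<Rightarrow> bool"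
  assumes G_cong: "\<lbrakk>\<G> f; \<And>x. x \<in> Rn n \<Longrightarrow> g x = f x\<rbrakk> \<Longrightarrow> \<G> g"
    and G_add: "\<lbrakk>\<G> f; \<G> g\<rbrakk> \<Longrightarrow> \<G> (\<lambda>x. f x + g x)"
    and G_cmult: "\<G> f \<Longrightarrow> \<G> (\<lambda>x. c * f x)"
    and G_exp_mult: "\<lbrakk>\<G> f; i \<in> {1..n}; j \<in> {1..n}\<rbrakk> \<Longrightarrow> \<G> (\<lambda>x. of_real (exp (x i - x j)) * f x)"
begin

definition controlled :: "cfun \<Rightarrow> bool" where
  "controlled f \<longleftrightarrow> smooth n f \<and> (\<forall>w\<in>lists {1..n}. \<G> (foldr partial w f))"

text \<open>
  The controlled functions are the largest class of continuous, partially differentiable functions with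
  the given bound that is closed under partial derivatives.
\<close>

lemma controlled_coinduct:
  assumes "P f"
    and "\<And>g. P g \<Longrightarrow> continuous_on (Rn n) g" and "\<And>g. P g \<Longrightarrow> \<G> g"
    and "\<And>g i x. \<lbrakk>P g; i \<in> {1..n}; x \<in> Rn n\<rbrakk> \<Longrightarrow> (\<lambda>s. g (x(i := s))) differentiable at (x i)"
    and "\<And>g i. \<lbrakk>P g; i \<in> {1..n}\<rbrakk> \<Longrightarrow> P (partial i g)"
  shows "controlled f"
proof -
  have "P (foldr partial w f)" if "w \<in> lists {1..n}" for w
    using that by (induction w) (use assms(1,5) in auto)
  then show ?thesis using assms(2-4) unfolding controlled_def smooth_def by blast
qed

lemma controlled_continuous: "controlled f \<Longrightarrow> continuous_on (Rn n) f"
  unfolding controlled_def smooth_def by (metis foldr_Nil id_apply lists.Nil)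

lemma controlled_growth: "controlled f \<Longrightarrow> \<G> f"
  unfolding controlled_def by (metis foldr_Nil id_apply lists.Nil)

lemma controlled_differentiable:
  assumes "controlled f" "i \<in> {1..n}" "x \<in> Rn n"
  shows "(\<lambda>s. f (x(i := s))) differentiable at (x i)"
  using assms unfolding controlled_def smooth_def by (metis foldr_Nil id_apply lists.Nil)

lemma controlled_has_partial:
  assumes "controlled f" "i \<in> {1..n}" "x \<in> Rn n"
  shows "((\<lambda>s. f (x(i := s))) has_vector_derivative partial i f x) (at (x i))"
  unfolding partial_def using controlled_differentiable[OF assms] by (simp add: vector_derivative_works)

lemma controlled_partial:
  assumes "controlled f" "i \<in> {1..n}"
  shows "controlled (partial i f)"
proof -
  have "foldr partial w (partial i f) = foldr partial (w @ [i]) f" for w by simp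
  moreover have "w @ [i] \<in> lists {1..n}" if "w \<in> lists {1..n}" for w
    using that assms(2) by auto
  ultimately show ?thesis using assms(1) unfolding controlled_def smooth_def by metis
qed

lemma controlled_cong:
  assumes "controlled f" "\<And>x. x \<in> Rn n \<Longrightarrow> g x = f x"
  shows "controlled g"
proof (rule controlled_coinduct[where P = "\<lambda>g. \<exists>f. controlled f \<and> (\<forall>x\<in>Rn n. g x = f x)"])
  show "\<exists>f. controlled f \<and> (\<forall>x\<in>Rn n. g x = f x)" using assms by auto
next
  fix g assume "\<exists>f. controlled f \<and> (\<forall>x\<in>Rn n. g x = f x)"
  then obtain f where f: "controlled f" "\<And>x. x \<in> Rn n \<Longrightarrow> g x = f x" by auto
  show "continuous_on (Rn n) g" using controlled_continuous[OF f(1)] f(2) by (simp cong: continuous_on_cong)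
  show "\<G> g" using G_cong[OF controlled_growth[OF f(1)] f(2)] .
  fix i assume i: "i \<in> {1..n}"
  show "(\<lambda>s. g (x(i := s))) differentiable at (x i)" if x: "x \<in> Rn n" for x
    using controlled_differentiable[OF f(1) i x] f(2) i x by simp
  show "\<exists>f. controlled f \<and> (\<forall>x\<in>Rn n. partial i g x = f x)"
    using controlled_partial[OF f(1) i] partial_cong_Rn[of n g f i] f(2) i
    by (intro exI[of _ "partial i f"]) auto
qed

lemma controlled_add:
  assumes "controlled f1" "controlled f2"
  shows "controlled (\<lambda>x. f1 x + f2 x)"
proof (rule controlled_coinduct[where P = "\<lambda>g. \<exists>f1 f2. controlled f1 \<and> controlled f2 \<and> (\<forall>x\<in>Rn n. g x = f1 x + f2 x)"])
  fix g assume "\<exists>f1 f2. controlled f1 \<and> controlled f2 \<and> (\<forall>x\<in>Rn n. g x = f1 x + f2 x)"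
  then obtain f1 f2 where f: "controlled f1" "controlled f2" "\<And>x. x \<in> Rn n \<Longrightarrow> g x = f1 x + f2 x" by auto
  have "continuous_on (Rn n) (\<lambda>x. f1 x + f2 x)"
    by (intro continuous_intros controlled_continuous f)
  then show "continuous_on (Rn n) g" using f(3) by (simp cong: continuous_on_cong)
  show "\<G> g" using G_cong[OF G_add[OF controlled_growth[OF f(1)] controlled_growth[OF f(2)]] f(3)] .
  fix i assume i: "i \<in> {1..n}"
  have der: "((\<lambda>s. g (x(i := s))) has_vector_derivative (partial i f1 x + partial i f2 x)) (at (x i))"
    if x: "x \<in> Rn n" for x
    using has_vector_derivative_add[OF controlled_has_partial[OF f(1) i x] controlled_has_partial[OF f(2) i x]]
      f(3) i x by simp
  show "(\<lambda>s. g (x(i := s))) differentiable at (x i)" if x: "x \<in> Rn n" for x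
    using der[OF x] by (rule differentiableI_vector)
  show "\<exists>f1 f2. controlled f1 \<and> controlled f2 \<and> (\<forall>x\<in>Rn n. partial i g x = f1 x + f2 x)"
    using controlled_partial[OF f(1) i] controlled_partial[OF f(2) i] partial_eqI[where f=g, OF der] by blast
qed (use assms in auto)

lemma controlled_cmult:
  assumes "controlled f"
  shows "controlled (\<lambda>x. c * f x)"
proof (rule controlled_coinduct[where P = "\<lambda>g. \<exists>f. controlled f \<and> (\<forall>x\<in>Rn n. g x = c * f x)"])
  fix g assume "\<exists>f. controlled f \<and> (\<forall>x\<in>Rn n. g x = c * f x)"
  then obtain f where f: "controlled f" "\<And>x. x \<in> Rn n \<Longrightarrow> g x = c * f x" by auto
  have "continuous_on (Rn n) (\<lambda>x. c * f x)"
    by (intro continuous_intros controlled_continuous f)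
  then show "continuous_on (Rn n) g" using f(2) by (simp cong: continuous_on_cong)
  show "\<G> g" using G_cong[OF G_cmult[OF controlled_growth[OF f(1)]] f(2)] .
  fix i assume i: "i \<in> {1..n}"
  have der: "((\<lambda>s. g (x(i := s))) has_vector_derivative (c * partial i f x)) (at (x i))"
    if x: "x \<in> Rn n" for x
    using has_vector_derivative_mult_right[OF controlled_has_partial[OF f(1) i x], of c] f(2) i x by simp
  show "(\<lambda>s. g (x(i := s))) differentiable at (x i)" if x: "x \<in> Rn n" for x
    using der[OF x] by (rule differentiableI_vector)
  show "\<exists>f. controlled f \<and> (\<forall>x\<in>Rn n. partial i g x = c * f x)"
    using controlled_partial[OF f(1) i] partial_eqI[where f=g, OF der] by blast
qed (use assms in auto)

lemma controlled_exp_mult: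
  assumes "controlled f" and j: "j \<in> {1..n}" "k \<in> {1..n}" "j \<noteq> k"
  shows "controlled (\<lambda>x. of_real (exp (x j - x k)) * f x)"
proof (rule controlled_coinduct[where P = "\<lambda>g. \<exists>f. controlled f \<and> (\<forall>x\<in>Rn n. g x = of_real (exp (x j - x k)) * f x)"])
  fix g assume "\<exists>f. controlled f \<and> (\<forall>x\<in>Rn n. g x = of_real (exp (x j - x k)) * f x)"
  then obtain f where f: "controlled f" "\<And>x. x \<in> Rn n \<Longrightarrow> g x = of_real (exp (x j - x k)) * f x" by auto
  have "continuous_on (Rn n) (\<lambda>x. of_real (exp (x j - x k)) * f x)"
    by (intro continuous_intros controlled_continuous f continuous_on_subset[OF continuous_on_product_coordinates]) auto
  then show "continuous_on (Rn n) g" using f(2) by (simp cong: continuous_on_cong)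
  show "\<G> g" using G_cong[OF G_exp_mult[OF controlled_growth[OF f(1)] j(1,2)] f(2)] .
  fix i assume i: "i \<in> {1..n}"
  define c where "c = (if i = j then 1 else if i = k then - 1 else (0::real))"
  have der: "((\<lambda>s. g (x(i := s))) has_vector_derivative (of_real (exp (x j - x k)) * (of_real c * f x + partial i f x))) (at (x i))"
    if x: "x \<in> Rn n" for x
  proof -
    have "((\<lambda>s. exp ((x(i := s)) j - (x(i := s)) k)) has_real_derivative (exp (x j - x k) * c)) (at (x i))"
      unfolding c_def using j(3)
      by (auto intro!: derivative_eq_intros)
    then have "((\<lambda>s. complex_of_real (exp ((x(i := s)) j - (x(i := s)) k))) has_vector_derivative (of_real (exp (x j - x k) * c))) (at (x i))"
      by (rule has_vector_derivative_of_real)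
    from has_vector_derivative_mult[OF this controlled_has_partial[OF f(1) i x]]
    show ?thesis using f(2) i x by (simp add: algebra_simps)
  qed
  show "(\<lambda>s. g (x(i := s))) differentiable at (x i)" if x: "x \<in> Rn n" for x
    using der[OF x] by (rule differentiableI_vector)
  show "\<exists>f. controlled f \<and> (\<forall>x\<in>Rn n. partial i g x = of_real (exp (x j - x k)) * f x)"
    using controlled_add[OF controlled_cmult[OF f(1), of "of_real c"] controlled_partial[OF f(1) i]]
     partial_eqI[where f=g, OF der] by blast
qed (use assms in auto)

end

interpretation smooth_class: growth_class n "\<lambda>_. True" for n
  by standard auto

lemma smooth_class_controlled: "smooth_class.controlled n f \<longleftrightarrow> smooth n f"
  by (simp add: smooth_class.controlled_def)

lemma (in growth_class) controlled_imp_smooth: "controlled f \<Longrightarrow> smooth n f"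
  by (simp add: controlled_def)

section \<open>The explicit generating operator of the Toda Hamiltonians\<close>

text \<open>
  The chain is open: the convention at \<open>0\<close> removes the interaction to the left of the first particle, so that the
  recursion for the generating operator needs no separate initial case.
\<close>

definition bond :: "nat \<Rightarrow> (nat \<Rightarrow> real) \<Rightarrow> complex" where
  "bond k x = (if k = 0 then 0 else of_real (exp (x k - x (k + 1))))"

text \<open>
  Expansion of the characteristic determinant of the Lax matrix, which is tridiagonal, along its last
  row. The last factor \<open>\<mu> + \<i> * \<partial>\<close> involves a variable that does not occur in the preceding operators, so no
  ordering question arises.
\<close>

fun toda_T :: "complex \<Rightarrow> nat \<Rightarrow> oper" where
  "toda_T \<mu> 0 f = f"
| "toda_T \<mu> (Suc k) f = (\<lambda>x. \<mu> * toda_T \<mu> k f x + \<i> * partial (Suc k) (toda_T \<mu> k f) x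
     - bond k x * toda_T \<mu> (k - 1) f x)"

lemma (in growth_class) controlled_toda_T:
  assumes "controlled f"
  shows "k \<le> n \<Longrightarrow> controlled (toda_T \<mu> k f)"
proof (induction k rule: less_induct)
  case (less k)
  show ?case
  proof (cases k)
    case 0
    then show ?thesis using assms by simp
  next
    case (Suc k')
    have 1: "controlled (toda_T \<mu> k' f)" and 2: "controlled (toda_T \<mu> (k' - 1) f)"
      using less Suc by auto
    have p: "controlled (partial (Suc k') (toda_T \<mu> k' f))"
      using 1 less(2) Suc by (intro controlled_partial) auto
    have b: "controlled (\<lambda>x. bond k' x * toda_T \<mu> (k' - 1) f x)"
    proof (cases "k' = 0")
      case True
      then show ?thesis using controlled_cmult[OF 2, of 0] by (simp add: bond_def)
    next
      case False
      then show ?thesis using controlled_exp_mult[OF 2, of k' "k' + 1"] less(2) Suc by (simp add: bond_def)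
    qed
    have "controlled (\<lambda>x. (\<mu> * toda_T \<mu> k' f x + \<i> * partial (Suc k') (toda_T \<mu> k' f) x)
        + (-1) * (bond k' x * toda_T \<mu> (k' - 1) f x))"
      by (intro controlled_add controlled_cmult 1 p b)
    then show ?thesis by (simp add: Suc)
  qed
qed

lemma toda_T_cong_Rn:
  assumes "\<And>x. x \<in> Rn n \<Longrightarrow> f x = g x"
  shows "k \<le> n \<Longrightarrow> x \<in> Rn n \<Longrightarrow> toda_T \<mu> k f x = toda_T \<mu> k g x"
proof (induction k arbitrary: x rule: less_induct)
  case (less k)
  show ?case
  proof (cases k)
    case 0
    then show ?thesis using assms less by simp
  next
    case (Suc k')
    have "partial (Suc k') (toda_T \<mu> k' f) x = partial (Suc k') (toda_T \<mu> k' g) x"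
      using less Suc by (intro partial_cong_Rn[where n=n]) auto
    then show ?thesis using less Suc by simp
  qed
qed

lemma borel_measurable_leb_continuous:
  assumes f: "continuous_on (Rn n) f"
  shows "f \<in> borel_measurable (leb n)"
proof -
  have "(\<lambda>y. y) \<in> measurable (leb n) (PiM UNIV (\<lambda>_::nat. borel :: real measure))"
  proof (rule measurable_PiM_single')
    fix i :: nat
    show "(\<lambda>y. y i) \<in> borel_measurable (leb n)"
    proof (cases "i \<in> {1..n}")
      case False
      have "(\<lambda>y. y i) \<in> borel_measurable (leb n) \<longleftrightarrow> (\<lambda>_. undefined :: real) \<in> borel_measurable (leb n)"
        by (rule measurable_cong) (use False in \<open>auto simp: Rn_def PiE_def extensional_def\<close>)
      then show ?thesis by simp
    qed auto
  qed auto
  then have "(\<lambda>y. y) \<in> measurable (leb n) borel"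
    by (subst (asm) measurable_cong_sets[OF refl sets_PiM_equal_borel])
  then have "(\<lambda>y. y) \<in> measurable (leb n) (restrict_space borel (Rn n))"
    by (intro measurable_restrict_space2) auto
  from measurable_compose[OF this borel_measurable_continuous_on_restrict[OF f]] show ?thesis .
qed

section \<open>Differentiation under the integral sign\<close>

text \<open>
  Dominated convergence for the difference quotients, whose distance from the derivative is at most twice the dominating
  function by the mean value inequality.
\<close>

lemma has_vector_derivative_integral_dominated:
  fixes f f' :: "real \<Rightarrow> 'a \<Rightarrow> complex"
  assumes der: "\<And>s y. \<bar>s - s0\<bar> < 1 \<Longrightarrow> y \<in> space M \<Longrightarrow> ((\<lambda>s. f s y) has_vector_derivative f' s y) (at s)"
    and bound: "\<And>s y. \<bar>s - s0\<bar> < 1 \<Longrightarrow> y \<in> space M \<Longrightarrow> norm (f' s y) \<le> g y"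
    and g: "integrable M g" and f: "\<And>s. integrable M (f s)"
    and f'm: "f' s0 \<in> borel_measurable M"
  shows "((\<lambda>s. LINT y|M. f s y) has_vector_derivative (LINT y|M. f' s0 y)) (at s0)"
proof -
  have f'i: "integrable M (f' s0)"
    by (rule Bochner_Integration.integrable_bound[OF g f'm]) (use bound[of s0] in \<open>auto intro!: AE_I2 order_trans[OF _ abs_ge_self]\<close>)
  let ?q = "\<lambda>s y. (f s y - f s0 y - (s - s0) *\<^sub>R f' s0 y) /\<^sub>R norm (s - s0)"
  have lip: "norm (f s y - f s0 y) \<le> g y * \<bar>s - s0\<bar>" if "\<bar>s - s0\<bar> < 1" "y \<in> space M" for s y
  proof -
    have "norm (f s y - f s0 y) \<le> g y * norm (s - s0)"
    proof (rule differentiable_bound[where S="{s0 - 1<..<s0 + 1}" and f'="\<lambda>s h. h *\<^sub>R f' s y"])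
      fix t assume t: "t \<in> {s0 - 1<..<s0 + 1}"
      then show "((\<lambda>s. f s y) has_derivative (\<lambda>h. h *\<^sub>R f' t y)) (at t within {s0 - 1<..<s0 + 1})"
        using der[of t y] that(2) by (auto simp: has_vector_derivative_def intro: has_derivative_at_withinI)
      show "onorm (\<lambda>h. h *\<^sub>R f' t y) \<le> g y"
        using bound[of t y] t that(2) by (intro onorm_le) (auto simp: mult.commute mult_left_mono)
    qed (use that in auto)
    then show ?thesis by simp
  qed
  have q0: "((\<lambda>s. ?q s y) \<longlongrightarrow> 0) (at s0)" if "y \<in> space M" for y
    using der[of s0 y] that by (simp add: has_vector_derivative_def has_derivative_at_within)
  have qb: "norm (?q s y) \<le> 2 * g y" if "\<bar>s - s0\<bar> < 1" "y \<in> space M" "s \<noteq> s0" for s y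
  proof -
    have "norm (f s y - f s0 y - (s - s0) *\<^sub>R f' s0 y) \<le> g y * \<bar>s - s0\<bar> + \<bar>s - s0\<bar> * norm (f' s0 y)"
      using lip[OF that(1,2)] norm_triangle_ineq4[of "f s y - f s0 y" "(s - s0) *\<^sub>R f' s0 y"] by simp
    also have "\<dots> \<le> g y * \<bar>s - s0\<bar> + \<bar>s - s0\<bar> * g y"
      using bound[of s0 y] that by (intro add_left_mono mult_left_mono) auto
    finally have "norm (f s y - f s0 y - (s - s0) *\<^sub>R f' s0 y) \<le> 2 * g y * \<bar>s - s0\<bar>" by simp
    then have "norm (f s y - f s0 y - (s - s0) *\<^sub>R f' s0 y) / \<bar>s - s0\<bar> \<le> 2 * g y"
      using that(3) by (subst pos_divide_le_eq) auto
    then show ?thesis by (simp add: divide_inverse_commute)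
  qed
  have qi: "(LINT y|M. ?q s y) = ((LINT y|M. f s y) - (LINT y|M. f s0 y) - (s - s0) *\<^sub>R (LINT y|M. f' s0 y)) /\<^sub>R norm (s - s0)" for s
    using f f'i by simp
  have "((\<lambda>s. LINT y|M. ?q s y) \<longlongrightarrow> 0) (at s0)"
    unfolding tendsto_at_iff_sequentially
  proof (intro allI impI)
    fix X assume X: "\<forall>i. X i \<in> UNIV - {s0}" "X \<longlonglongrightarrow> s0"
    from X(2) obtain k0 where k0: "\<And>k. k \<ge> k0 \<Longrightarrow> \<bar>X k - s0\<bar> < 1"
      unfolding lim_sequentially by (metis dist_real_def zero_less_one)
    have "(\<lambda>k. LINT y|M. ?q (X (k + k0)) y) \<longlonglongrightarrow> (LINT y|M. 0)"
    proof (rule integral_dominated_convergence[where w="\<lambda>y. 2 * g y"])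
      show "AE y in M. (\<lambda>k. ?q (X (k + k0)) y) \<longlonglongrightarrow> 0"
      proof (rule AE_I2)
        fix y assume "y \<in> space M"
        from q0[OF this] X have "((\<lambda>s. ?q s y) \<circ> X) \<longlonglongrightarrow> 0"
          unfolding tendsto_at_iff_sequentially by blast
        then show "(\<lambda>k. ?q (X (k + k0)) y) \<longlonglongrightarrow> 0"
          by (auto simp: o_def dest: LIMSEQ_ignore_initial_segment[where k=k0])
      qed
      show "AE y in M. norm (?q (X (k + k0)) y) \<le> 2 * g y" for k
        using qb[OF k0] X by (intro AE_I2) auto
      show "(\<lambda>y. ?q (X (k + k0)) y) \<in> borel_measurable M" for k
        using f f'i by measurable
    qed (use g in auto)
    then show "((\<lambda>s. LINT y|M. ?q s y) \<circ> X) \<longlonglongrightarrow> 0"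
      unfolding o_def Bochner_Integration.integral_zero by (rule LIMSEQ_offset)
  qed
  then show ?thesis
    unfolding qi has_vector_derivative_def has_derivative_at_within by (auto intro: bounded_linear_scaleR_left)
qed

section \<open>Exponential polynomials and the kernels\<close>

definition sumabs :: "nat \<Rightarrow> (nat \<Rightarrow> real) \<Rightarrow> real" where
  "sumabs n x = (\<Sum>i=1..n. \<bar>x i\<bar>)"

lemma sumabs_nonneg [simp]: "sumabs n x \<ge> 0"
  by (simp add: sumabs_def sum_nonneg)

lemma abs_le_sumabs: "i \<in> {1..n} \<Longrightarrow> \<bar>x i\<bar> \<le> sumabs n x"
  unfolding sumabs_def by (rule member_le_sum) auto

lemma abs_sum_le_sumabs: "\<bar>\<Sum>i=1..n. x i\<bar> \<le> sumabs n x"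
  unfolding sumabs_def by (rule sum_abs)

lemma sumabs_mono: "m \<le> n \<Longrightarrow> sumabs m x \<le> sumabs n x"
  unfolding sumabs_def by (intro sum_mono2) auto

lemma sumabs_upd_le: "i \<in> {1..n} \<Longrightarrow> sumabs n (x(i := s)) \<le> sumabs n x + \<bar>s\<bar>"
proof -
  assume i: "i \<in> {1..n}"
  have "sumabs n (x(i := s)) = (\<Sum>j\<in>{1..n} - {i}. \<bar>x j\<bar>) + \<bar>s\<bar>"
    unfolding sumabs_def using i by (subst sum.remove[of _ i]) (auto intro!: sum.cong)
  also have "(\<Sum>j\<in>{1..n} - {i}. \<bar>x j\<bar>) \<le> sumabs n x"
    unfolding sumabs_def by (intro sum_mono2) auto
  finally show ?thesis by simp
qed

text \<open>
  Every derivative of a kernel is the kernel times a function of this class, and these functions grow at most exponentially. The first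
  \<open>N\<close> of the variables \<open>x\<close> and the first \<open>n\<close> of the variables \<open>y\<close> may occur.
\<close>

inductive exp_poly :: "nat \<Rightarrow> nat \<Rightarrow> kernel \<Rightarrow> bool" for N n where
  const: "exp_poly N n (\<lambda>x y. c)"
| expx: "i \<in> {1..N} \<Longrightarrow> exp_poly N n (\<lambda>x y. of_real (exp (a * x i)))"
| expy: "i \<in> {1..n} \<Longrightarrow> exp_poly N n (\<lambda>x y. of_real (exp (a * y i)))"
| add: "exp_poly N n P \<Longrightarrow> exp_poly N n Q \<Longrightarrow> exp_poly N n (\<lambda>x y. P x y + Q x y)"
| mult: "exp_poly N n P \<Longrightarrow> exp_poly N n Q \<Longrightarrow> exp_poly N n (\<lambda>x y. P x y * Q x y)"

lemma exp_poly_diff: "exp_poly N n P \<Longrightarrow> exp_poly N n Q \<Longrightarrow> exp_poly N n (\<lambda>x y. P x y - Q x y)"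
  using exp_poly.add[OF _ exp_poly.mult[OF exp_poly.const[where c="-1"]], of N n P Q] by simp

lemma exp_poly_bound:
  "exp_poly N n P \<Longrightarrow> \<exists>C c. C \<ge> 0 \<and> c \<ge> 0 \<and> (\<forall>x y. norm (P x y) \<le> C * exp (c * (sumabs N x + sumabs n y)))"
proof (induction rule: exp_poly.induct)
  case (const c)
  show ?case by (intro exI[of _ "norm c"] exI[of _ 0]) auto
next
  case (expx i a)
  have "a * x i \<le> \<bar>a\<bar> * (sumabs N x + sumabs n y)" for x y
  proof -
    have "a * x i \<le> \<bar>a\<bar> * \<bar>x i\<bar>" by (metis abs_ge_self abs_mult)
    also have "\<dots> \<le> \<bar>a\<bar> * (sumabs N x + sumabs n y)"
      using abs_le_sumabs[OF expx, of x] sumabs_nonneg[of n y] by (intro mult_left_mono) (linarith, simp)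
    finally show ?thesis .
  qed
  then show ?case by (intro exI[of _ 1] exI[of _ "\<bar>a\<bar>"]) auto
next
  case (expy i a)
  have "a * y i \<le> \<bar>a\<bar> * (sumabs N x + sumabs n y)" for x y
  proof -
    have "a * y i \<le> \<bar>a\<bar> * \<bar>y i\<bar>" by (metis abs_ge_self abs_mult)
    also have "\<dots> \<le> \<bar>a\<bar> * (sumabs N x + sumabs n y)"
      using abs_le_sumabs[OF expy, of y] sumabs_nonneg[of N x] by (intro mult_left_mono) (linarith, simp)
    finally show ?thesis .
  qed
  then show ?case by (intro exI[of _ 1] exI[of _ "\<bar>a\<bar>"]) auto
next
  case (add P Q)
  then obtain C c C' c' where b: "C \<ge> 0" "c \<ge> 0" "\<And>x y. norm (P x y) \<le> C * exp (c * (sumabs N x + sumabs n y))"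
    "C' \<ge> 0" "c' \<ge> 0" "\<And>x y. norm (Q x y) \<le> C' * exp (c' * (sumabs N x + sumabs n y))" by blast
  have "norm (P x y + Q x y) \<le> (C + C') * exp ((c + c') * (sumabs N x + sumabs n y))" for x y
  proof -
    have "norm (P x y + Q x y) \<le> C * exp (c * (sumabs N x + sumabs n y)) + C' * exp (c' * (sumabs N x + sumabs n y))"
      using norm_triangle_ineq[of "P x y" "Q x y"] b(3)[of x y] b(6)[of x y] by linarith
    also have "\<dots> \<le> C * exp ((c + c') * (sumabs N x + sumabs n y)) + C' * exp ((c + c') * (sumabs N x + sumabs n y))"
      using b by (intro add_mono mult_left_mono) (auto intro!: mult_right_mono)
    finally show ?thesis by (simp add: algebra_simps)
  qed
  then show ?case using b by (intro exI[of _ "C + C'"] exI[of _ "c + c'"]) auto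
next
  case (mult P Q)
  then obtain C c C' c' where b: "C \<ge> 0" "c \<ge> 0" "\<And>x y. norm (P x y) \<le> C * exp (c * (sumabs N x + sumabs n y))"
    "C' \<ge> 0" "c' \<ge> 0" "\<And>x y. norm (Q x y) \<le> C' * exp (c' * (sumabs N x + sumabs n y))" by blast
  have "norm (P x y * Q x y) \<le> (C * C') * exp ((c + c') * (sumabs N x + sumabs n y))" for x y
    using mult_mono[OF b(3)[of x y] b(6)[of x y]] b by (simp add: norm_mult algebra_simps exp_add)
  then show ?case using b by (intro exI[of _ "C * C'"] exI[of _ "c + c'"]) auto
qed

lemma exp_poly_deriv:
  assumes "exp_poly N n P"
  shows "\<exists>P'. exp_poly N n P' \<and> (\<forall>x y. ((\<lambda>s. P (x(i := s)) y) has_vector_derivative P' x y) (at (x i)))"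
  using assms
proof (induction rule: exp_poly.induct)
  case (const c)
  show ?case by (intro exI[of _ "\<lambda>_ _. 0"]) (auto intro: exp_poly.const)
next
  case (expx j a)
  have "exp_poly N n (\<lambda>x y. of_real (if j = i then a else 0) * of_real (exp (a * x j)))"
    by (intro exp_poly.mult exp_poly.const exp_poly.expx expx)
  moreover have "((\<lambda>s. complex_of_real (exp (a * (x(i := s)) j))) has_vector_derivative
      of_real (if j = i then a else 0) * of_real (exp (a * x j))) (at (x i))" for x :: "nat \<Rightarrow> real"
  proof -
    have "((\<lambda>s. exp (a * (x(i := s)) j)) has_real_derivative (if j = i then a else 0) * exp (a * x j)) (at (x i))"
      by (auto intro!: derivative_eq_intros)
    from has_vector_derivative_of_real[OF this] show ?thesis by (simp only: of_real_mult)
  qed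
  ultimately show ?case by blast
next
  case (expy j a)
  show ?case by (intro exI[of _ "\<lambda>_ _. 0"]) (auto intro: exp_poly.const)
next
  case (add P Q)
  then obtain P' Q' where h: "exp_poly N n P'" "exp_poly N n Q'"
    "\<And>x y. ((\<lambda>s. P (x(i := s)) y) has_vector_derivative P' x y) (at (x i))"
    "\<And>x y. ((\<lambda>s. Q (x(i := s)) y) has_vector_derivative Q' x y) (at (x i))" by blast
  show ?case by (rule exI[of _ "\<lambda>x y. P' x y + Q' x y"]) (intro conjI allI exp_poly.add has_vector_derivative_add h)
next
  case (mult P Q)
  then obtain P' Q' where h: "exp_poly N n P'" "exp_poly N n Q'"
    "\<And>x y. ((\<lambda>s. P (x(i := s)) y) has_vector_derivative P' x y) (at (x i))"
    "\<And>x y. ((\<lambda>s. Q (x(i := s)) y) has_vector_derivative Q' x y) (at (x i))" by blast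
  have "((\<lambda>s. P (x(i := s)) y * Q (x(i := s)) y) has_vector_derivative P x y * Q' x y + P' x y * Q x y) (at (x i))" for x y
    using has_vector_derivative_mult[OF h(3)[of x y] h(4)[of x y]] by simp
  then show ?case by (intro exI[of _ "\<lambda>x y. P x y * Q' x y + P' x y * Q x y"] conjI allI exp_poly.add exp_poly.mult h mult)
qed

lemma exp_poly_continuous: "exp_poly N n P \<Longrightarrow> continuous_on S (\<lambda>x. P x y)"
  by (induction rule: exp_poly.induct)
    (auto intro!: continuous_intros continuous_on_subset[OF continuous_on_product_coordinates])

lemma exp_poly_measurable:
  assumes "\<And>i. i \<in> {1..n} \<Longrightarrow> (\<lambda>y. y i) \<in> borel_measurable N'"
  shows "exp_poly N n P \<Longrightarrow> P x \<in> borel_measurable N'"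
proof (induction rule: exp_poly.induct)
  case (expy i a)
  then show ?case using assms
    by (auto intro!: borel_measurable_of_real borel_measurable_exp_comp borel_measurable_times)
qed (auto intro!: borel_measurable_add borel_measurable_times)

text \<open>
  Both kernels in one family: \<open>n = m\<close> is the recursive operator and \<open>n = m + 1\<close> the Baxter operator. The point \<open>x\<close> has
  \<open>m + 1\<close> coordinates and \<open>y\<close> has \<open>n\<close>.
\<close>

definition toda_kernel :: "nat \<Rightarrow> nat \<Rightarrow> complex \<Rightarrow> kernel" where
  "toda_kernel n m lam x y = exp (\<i> * lam * of_real ((\<Sum>i=1..m+1. x i) - (\<Sum>i=1..n. y i))
     - of_real ((\<Sum>k=1..n. exp (x k - y k)) + (\<Sum>k=1..m. exp (y k - x (k + 1)))))"

lemma baxter_Q_toda_kernel: "baxter_Q (l + 1) lam = toda_kernel (l + 1) l lam"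
  by (intro ext, unfold baxter_Q_Suc toda_kernel_def) (simp add: sum.distrib algebra_simps)

text \<open>
  The two kinds of bonds between \<open>x\<close> and \<open>y\<close>, set to \<open>0\<close> where the kernel has no such bond. The zeros
  at the ends distinguish the Baxter kernel from the recursive one in the identities for continuants.
\<close>

definition fwd_factor :: "nat \<Rightarrow> (nat \<Rightarrow> real) \<Rightarrow> (nat \<Rightarrow> real) \<Rightarrow> nat \<Rightarrow> complex" where
  "fwd_factor n x y k = (if k \<in> {1..n} then of_real (exp (x k - y k)) else 0)"

definition bwd_factor :: "nat \<Rightarrow> (nat \<Rightarrow> real) \<Rightarrow> (nat \<Rightarrow> real) \<Rightarrow> nat \<Rightarrow> complex" where
  "bwd_factor m x y k = (if k \<in> {1..m} then of_real (exp (y k - x (k + 1))) else 0)"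

lemma exp_poly_fwd_factor: "n \<le> N \<Longrightarrow> exp_poly N n (\<lambda>x y. fwd_factor n x y k)"
proof (cases "k \<in> {1..n}")
  case True
  assume "n \<le> N"
  then have "exp_poly N n (\<lambda>x y. of_real (exp (1 * x k)) * of_real (exp ((-1) * y k)))"
    using True by (intro exp_poly.intros) auto
  then show ?thesis using True by (simp add: fwd_factor_def exp_diff exp_minus divide_inverse)
qed (auto simp: fwd_factor_def intro: exp_poly.const)

lemma exp_poly_bwd_factor: "m < N \<Longrightarrow> m \<le> n \<Longrightarrow> exp_poly N n (\<lambda>x y. bwd_factor m x y k)"
proof (cases "k \<in> {1..m}")
  case True
  assume "m < N" "m \<le> n"
  then have "exp_poly N n (\<lambda>x y. of_real (exp (1 * y k)) * of_real (exp ((-1) * x (k + 1))))"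
    using True by (intro exp_poly.intros) auto
  then show ?thesis using True by (simp add: bwd_factor_def exp_diff exp_minus divide_inverse)
qed (auto simp: bwd_factor_def intro: exp_poly.const)

lemma fwd_bwd_bond_x: "k \<le> m \<Longrightarrow> k \<le> n \<Longrightarrow> fwd_factor n x y k * bwd_factor m x y k = bond k x"
  by (auto simp: fwd_factor_def bwd_factor_def bond_def simp flip: of_real_mult exp_add)

lemma fwd_bwd_bond_y: "k \<le> m \<Longrightarrow> k < n \<Longrightarrow> bwd_factor m x y k * fwd_factor n x y (Suc k) = bond k y"
  by (auto simp: fwd_factor_def bwd_factor_def bond_def simp flip: of_real_mult exp_add)

lemma toda_kernel_deriv_x:
  assumes i: "i \<in> {1..m+1}"
  shows "((\<lambda>s. toda_kernel n m lam (x(i := s)) y) has_vector_derivative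
     toda_kernel n m lam x y * (\<i> * lam - fwd_factor n x y i + bwd_factor m x y (i - 1))) (at (x i))"
proof -
  have 1: "((\<lambda>s. (\<Sum>j=1..m+1. (x(i := s)) j) - (\<Sum>j=1..n. y j)) has_real_derivative 1) (at (x i))"
  proof -
    have "((\<lambda>s. (\<Sum>j=1..m+1. (x(i := s)) j) - (\<Sum>j=1..n. y j)) has_real_derivative (\<Sum>j=1..m+1. if j = i then 1 else 0) - 0) (at (x i))"
      by (intro DERIV_diff DERIV_sum DERIV_const) auto
    then show ?thesis using i by (simp only: sum.delta finite_atLeastAtMost if_True diff_0_right diff_0)
  qed
  have 2: "((\<lambda>s. \<Sum>k=1..n. exp ((x(i := s)) k - y k)) has_real_derivative (if i \<in> {1..n} then exp (x i - y i) else 0)) (at (x i))"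
  proof -
    have "((\<lambda>s. \<Sum>k=1..n. exp ((x(i := s)) k - y k)) has_real_derivative (\<Sum>k=1..n. if k = i then exp (x i - y i) else 0)) (at (x i))"
      by (intro DERIV_sum) (auto intro!: derivative_eq_intros)
    then show ?thesis by (simp add: sum.delta)
  qed
  have 3: "((\<lambda>s. \<Sum>k=1..m. exp (y k - (x(i := s)) (k + 1))) has_real_derivative
      (if i - 1 \<in> {1..m} then - exp (y (i - 1) - x (i - 1 + 1)) else 0)) (at (x i))"
  proof -
    have "((\<lambda>s. \<Sum>k=1..m. exp (y k - (x(i := s)) (k + 1))) has_real_derivative
        (\<Sum>k=1..m. if k = i - 1 then - exp (y (i - 1) - x (i - 1 + 1)) else 0)) (at (x i))"
    proof (rule DERIV_sum)
      fix k assume "k \<in> {1..m}"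
      show "((\<lambda>s. exp (y k - (x(i := s)) (k + 1))) has_real_derivative
        (if k = i - 1 then - exp (y (i - 1) - x (i - 1 + 1)) else 0)) (at (x i))"
      proof (cases "k + 1 = i")
        case True
        then show ?thesis by (auto intro!: derivative_eq_intros)
      next
        case False
        then have "k \<noteq> i - 1" using i by auto
        then show ?thesis using False by simp
      qed
    qed
    then show ?thesis by (simp add: sum.delta)
  qed
  let ?E = "\<lambda>s. \<i> * lam * of_real ((\<Sum>j=1..m+1. (x(i := s)) j) - (\<Sum>j=1..n. y j))
     - of_real ((\<Sum>k=1..n. exp ((x(i := s)) k - y k)) + (\<Sum>k=1..m. exp (y k - (x(i := s)) (k + 1))))"
  have "(?E has_vector_derivative (\<i> * lam * of_real 1 - of_real ((if i \<in> {1..n} then exp (x i - y i) else 0)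
     + (if i - 1 \<in> {1..m} then - exp (y (i - 1) - x (i - 1 + 1)) else 0)))) (at (x i))"
    by (intro has_vector_derivative_diff has_vector_derivative_mult_right has_vector_derivative_of_real 1 DERIV_add 2 3)
  moreover have "\<i> * lam * of_real 1 - of_real ((if i \<in> {1..n} then exp (x i - y i) else 0)
     + (if i - 1 \<in> {1..m} then - exp (y (i - 1) - x (i - 1 + 1)) else 0))
     = \<i> * lam - fwd_factor n x y i + bwd_factor m x y (i - 1)"
    unfolding fwd_factor_def bwd_factor_def by simp
  ultimately have "(?E has_vector_derivative (\<i> * lam - fwd_factor n x y i + bwd_factor m x y (i - 1))) (at (x i))"
    by (simp only:)
  from field_vector_diff_chain_at[OF this DERIV_exp]
  show ?thesis by (simp add: o_def toda_kernel_def mult.commute del: sum.cl_ivl_Suc fun_upd_apply)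
qed

lemma toda_kernel_deriv_y:
  assumes i: "i \<in> {1..n}"
  shows "((\<lambda>s. toda_kernel n m lam x (y(i := s))) has_vector_derivative
     toda_kernel n m lam x y * (- \<i> * lam + fwd_factor n x y i - bwd_factor m x y i)) (at (y i))"
proof -
  have 1: "((\<lambda>s. (\<Sum>j=1..m+1. x j) - (\<Sum>j=1..n. (y(i := s)) j)) has_real_derivative - 1) (at (y i))"
  proof -
    have "((\<lambda>s. (\<Sum>j=1..m+1. x j) - (\<Sum>j=1..n. (y(i := s)) j)) has_real_derivative 0 - (\<Sum>j=1..n. if j = i then 1 else 0)) (at (y i))"
      by (intro DERIV_diff DERIV_sum DERIV_const) auto
    then show ?thesis using i by (simp only: sum.delta finite_atLeastAtMost if_True diff_0_right diff_0)
  qed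
  have 2: "((\<lambda>s. \<Sum>k=1..n. exp (x k - (y(i := s)) k)) has_real_derivative (if i \<in> {1..n} then - exp (x i - y i) else 0)) (at (y i))"
  proof -
    have "((\<lambda>s. \<Sum>k=1..n. exp (x k - (y(i := s)) k)) has_real_derivative (\<Sum>k=1..n. if k = i then - exp (x i - y i) else 0)) (at (y i))"
      by (intro DERIV_sum) (auto intro!: derivative_eq_intros)
    then show ?thesis by (simp add: sum.delta)
  qed
  have 3: "((\<lambda>s. \<Sum>k=1..m. exp ((y(i := s)) k - x (k + 1))) has_real_derivative
      (if i \<in> {1..m} then exp (y i - x (i + 1)) else 0)) (at (y i))"
  proof -
    have "((\<lambda>s. \<Sum>k=1..m. exp ((y(i := s)) k - x (k + 1))) has_real_derivative
        (\<Sum>k=1..m. if k = i then exp (y i - x (i + 1)) else 0)) (at (y i))"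
      by (intro DERIV_sum) (auto intro!: derivative_eq_intros)
    then show ?thesis by (simp add: sum.delta)
  qed
  let ?E = "\<lambda>s. \<i> * lam * of_real ((\<Sum>j=1..m+1. x j) - (\<Sum>j=1..n. (y(i := s)) j))
     - of_real ((\<Sum>k=1..n. exp (x k - (y(i := s)) k)) + (\<Sum>k=1..m. exp ((y(i := s)) k - x (k + 1))))"
  have "(?E has_vector_derivative (\<i> * lam * of_real (-1) - of_real ((if i \<in> {1..n} then - exp (x i - y i) else 0)
     + (if i \<in> {1..m} then exp (y i - x (i + 1)) else 0)))) (at (y i))"
    by (intro has_vector_derivative_diff has_vector_derivative_mult_right has_vector_derivative_of_real 1 DERIV_add 2 3)
  moreover have "\<i> * lam * of_real (-1) - of_real ((if i \<in> {1..n} then - exp (x i - y i) else 0)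
     + (if i \<in> {1..m} then exp (y i - x (i + 1)) else 0))
     = - \<i> * lam + fwd_factor n x y i - bwd_factor m x y i"
    unfolding fwd_factor_def bwd_factor_def by simp
  ultimately have "(?E has_vector_derivative (- \<i> * lam + fwd_factor n x y i - bwd_factor m x y i)) (at (y i))"
    by (simp only:)
  from field_vector_diff_chain_at[OF this DERIV_exp]
  show ?thesis by (simp add: o_def toda_kernel_def mult.commute del: sum.cl_ivl_Suc fun_upd_apply)
qed

lemma continuous_on_toda_kernel_x: "continuous_on S (\<lambda>x. toda_kernel n m lam x y)"
  unfolding toda_kernel_def
  by (intro continuous_intros continuous_on_subset[OF continuous_on_product_coordinates]) auto

lemma borel_measurable_of_real_comp:
  "f \<in> borel_measurable M \<Longrightarrow> (\<lambda>x. complex_of_real (f x)) \<in> borel_measurable M"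
  by simp

lemma measurable_toda_kernel:
  assumes "\<And>i. i \<in> {1..n} \<Longrightarrow> (\<lambda>y. y i) \<in> borel_measurable N" "m \<le> n"
  shows "toda_kernel n m lam x \<in> borel_measurable N"
proof -
  have c: "(\<lambda>y. y i) \<in> borel_measurable N" if "i \<in> {1..m} \<or> i \<in> {1..n}" for i
    using assms that by auto
  show ?thesis
    unfolding toda_kernel_def
    by (intro borel_measurable_exp_comp borel_measurable_diff borel_measurable_add borel_measurable_times
      borel_measurable_of_real_comp borel_measurable_sum borel_measurable_const c) auto
qed

section \<open>Continuants\<close>

text \<open>
  With \<open>\<delta> = \<mu> - lam\<close>, the Toda operator in \<open>x\<close> multiplies the kernel by \<open>tau\<close>, and its formal adjoint in \<open>y\<close>
  multiplies the kernel by \<open>tau_adj\<close>; \<open>A\<close> and \<open>B\<close> stand for the forward and backward factors.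
\<close>

fun tau :: "complex \<Rightarrow> (nat \<Rightarrow> complex) \<Rightarrow> (nat \<Rightarrow> complex) \<Rightarrow> nat \<Rightarrow> complex" where
  "tau \<delta> A B 0 = 1"
| "tau \<delta> A B (Suc k) = (\<delta> - \<i> * A (Suc k) + \<i> * B k) * tau \<delta> A B k - A k * B k * tau \<delta> A B (k - 1)"

fun tau_adj :: "complex \<Rightarrow> (nat \<Rightarrow> complex) \<Rightarrow> (nat \<Rightarrow> complex) \<Rightarrow> nat \<Rightarrow> complex" where
  "tau_adj \<delta> A B 0 = 1"
| "tau_adj \<delta> A B (Suc k) = (\<delta> - \<i> * A (Suc k) + \<i> * B (Suc k)) * tau_adj \<delta> A B k - B k * A (Suc k) * tau_adj \<delta> A B (k - 1)"

text \<open>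
  These two identities contain the intertwining relations. If \<open>B\<close> vanishes at the last index, as for the Baxter
  kernel, the second says that \<open>tau\<close> and \<open>tau_adj\<close> agree. If \<open>A\<close> vanishes there, as for the recursive
  kernel, the first splits off the factor \<open>\<delta>\<close>. Each step of the induction uses both.
\<close>

lemma tau_tau_adj:
  assumes B0: "B 0 = 0"
  shows "tau \<delta> A B (Suc k) = \<delta> * tau_adj \<delta> A B k - \<i> * A (Suc k) * tau \<delta> A B k \<and>
    tau_adj \<delta> A B (Suc k) = tau \<delta> A B (Suc k) + \<i> * B (Suc k) * tau_adj \<delta> A B k"
proof (induction k)
  case 0
  then show ?case using B0 by (simp add: algebra_simps)
next
  case (Suc k)
  let ?t = "tau \<delta> A B" and ?s = "tau_adj \<delta> A B"
  have 1: "?t (Suc k) = \<delta> * ?s k - \<i> * A (Suc k) * ?t k" and 2: "?s (Suc k) = ?t (Suc k) + \<i> * B (Suc k) * ?s k"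
    using Suc by auto
  have t: "?t (Suc (Suc k)) = (\<delta> - \<i> * A (Suc (Suc k)) + \<i> * B (Suc k)) * ?t (Suc k) - A (Suc k) * B (Suc k) * ?t k"
   and s: "?s (Suc (Suc k)) = (\<delta> - \<i> * A (Suc (Suc k)) + \<i> * B (Suc (Suc k))) * ?s (Suc k) - B (Suc k) * A (Suc (Suc k)) * ?s k"
    by (simp_all only: tau.simps tau_adj.simps diff_Suc_1)
  have i2: "\<i> * (\<i> * z) = - z" for z by (simp add: mult.assoc[symmetric])
  have a: "?t (Suc (Suc k)) = \<delta> * ?s (Suc k) - \<i> * A (Suc (Suc k)) * ?t (Suc k)"
    unfolding t 2 unfolding 1 by (simp add: algebra_simps i2)
  moreover have "?s (Suc (Suc k)) = ?t (Suc (Suc k)) + \<i> * B (Suc (Suc k)) * ?s (Suc k)"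
    unfolding s a unfolding 2 by (simp add: algebra_simps i2)
  ultimately show ?case by blast
qed

lemma tau_cong:
  assumes "\<And>j. j \<le> k \<Longrightarrow> A j = A' j" "\<And>j. j < k \<Longrightarrow> B j = B' j"
  shows "tau \<delta> A B k = tau \<delta> A' B' k"
  using assms
proof (induction k rule: less_induct)
  case (less k)
  show ?case
  proof (cases k)
    case (Suc j)
    have "tau \<delta> A B j = tau \<delta> A' B' j" "tau \<delta> A B (j - 1) = tau \<delta> A' B' (j - 1)"
      using less Suc by auto
    then show ?thesis using less(2,3) Suc by simp
  qed simp
qed

text \<open>
  At \<open>\<mu> = lam\<close> the continuant degenerates to a product, the shift factor between \<open>lam\<close> and \<open>lam - \<i>\<close>.
\<close>

lemma tau_zero: "B 0 = 0 \<Longrightarrow> tau 0 A B k = (- \<i>) ^ k * (\<Prod>j=1..k. A j)"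
proof (induction k)
  case (Suc k)
  then show ?case using tau_tau_adj[of B 0 A k] by (simp add: algebra_simps del: tau.simps)
qed simp

lemma exp_poly_tau:
  assumes "m < N" "m \<le> n" "n \<le> N"
  shows "exp_poly N n (\<lambda>x y. tau \<delta> (fwd_factor n x y) (bwd_factor m x y) k)"
proof (induction k rule: less_induct)
  case (less k)
  show ?case
  proof (cases k)
    case (Suc j)
    have "exp_poly N n (\<lambda>x y. (\<delta> - \<i> * fwd_factor n x y (Suc j) + \<i> * bwd_factor m x y j) * tau \<delta> (fwd_factor n x y) (bwd_factor m x y) j
         - fwd_factor n x y j * bwd_factor m x y j * tau \<delta> (fwd_factor n x y) (bwd_factor m x y) (j - 1))"
      using assms Suc by (intro exp_poly_diff exp_poly.add exp_poly.mult exp_poly.const exp_poly_fwd_factor exp_poly_bwd_factor less) auto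
    then show ?thesis by (simp add: Suc)
  qed (auto intro: exp_poly.const)
qed

section \<open>Kernel integrals are smooth\<close>

definition exp_growth :: "nat \<Rightarrow> cfun \<Rightarrow> bool" where
  "exp_growth n f \<longleftrightarrow> (\<exists>C d. \<forall>x\<in>Rn n. norm (f x) \<le> C * exp (d * sumabs n x))"

lemma exp_growthE:
  assumes "exp_growth n f"
  obtains C d where "C \<ge> 0" "d \<ge> 0" "\<And>x. x \<in> Rn n \<Longrightarrow> norm (f x) \<le> C * exp (d * sumabs n x)"
proof -
  from assms obtain C d where b: "\<And>x. x \<in> Rn n \<Longrightarrow> norm (f x) \<le> C * exp (d * sumabs n x)"
    unfolding exp_growth_def by blast
  show ?thesis
  proof (rule that[of "\<bar>C\<bar>" "\<bar>d\<bar>"])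
    fix x assume "x \<in> Rn n"
    from b[OF this] have "norm (f x) \<le> C * exp (d * sumabs n x)" .
    also have "\<dots> \<le> \<bar>C\<bar> * exp (\<bar>d\<bar> * sumabs n x)"
      by (intro mult_mono) (auto intro!: mult_right_mono)
    finally show "norm (f x) \<le> \<bar>C\<bar> * exp (\<bar>d\<bar> * sumabs n x)" .
  qed auto
qed

interpretation tame: growth_class n "exp_growth n" for n
proof
  fix f g :: cfun and c and i j
  show "exp_growth n g" if "exp_growth n f" "\<And>x. x \<in> Rn n \<Longrightarrow> g x = f x"
    using that by (simp add: exp_growth_def)
  assume f: "exp_growth n f"
  then obtain C d where b: "C \<ge> 0" "d \<ge> 0" "\<And>x. x \<in> Rn n \<Longrightarrow> norm (f x) \<le> C * exp (d * sumabs n x)"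
    by (rule exp_growthE) blast
  show "exp_growth n (\<lambda>x. c * f x)"
    unfolding exp_growth_def
  proof (rule exI[of _ "norm c * C"], rule exI[of _ d], rule ballI)
    fix x assume "x \<in> Rn n"
    then show "norm (c * f x) \<le> norm c * C * exp (d * sumabs n x)"
      using b(3)[of x] by (simp add: norm_mult mult.assoc mult_left_mono)
  qed
  show "exp_growth n (\<lambda>x. f x + g x)" if "exp_growth n g"
  proof -
    from that obtain C' d' where b': "C' \<ge> 0" "d' \<ge> 0" "\<And>x. x \<in> Rn n \<Longrightarrow> norm (g x) \<le> C' * exp (d' * sumabs n x)"
      by (rule exp_growthE) blast
    show ?thesis unfolding exp_growth_def
    proof (rule exI[of _ "C + C'"], rule exI[of _ "d + d'"], rule ballI)
      fix x assume x: "x \<in> Rn n"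
      have "norm (f x + g x) \<le> C * exp (d * sumabs n x) + C' * exp (d' * sumabs n x)"
        using b(3)[OF x] b'(3)[OF x] norm_triangle_ineq[of "f x" "g x"] by linarith
      also have "\<dots> \<le> C * exp ((d + d') * sumabs n x) + C' * exp ((d + d') * sumabs n x)"
        using b b' by (intro add_mono mult_left_mono) (auto intro!: mult_right_mono)
      finally show "norm (f x + g x) \<le> (C + C') * exp ((d + d') * sumabs n x)" by (simp add: algebra_simps)
    qed
  qed
  show "exp_growth n (\<lambda>x. of_real (exp (x i - x j)) * f x)" if ij: "i \<in> {1..n}" "j \<in> {1..n}"
    unfolding exp_growth_def
  proof (rule exI[of _ C], rule exI[of _ "d + 2"], rule ballI)
    fix x assume x: "x \<in> Rn n"
    have "exp (x i - x j) \<le> exp (2 * sumabs n x)"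
      using abs_le_sumabs[OF ij(1), of x] abs_le_sumabs[OF ij(2), of x] by simp
    then have "exp (x i - x j) * norm (f x) \<le> exp (2 * sumabs n x) * (C * exp (d * sumabs n x))"
      using b(3)[OF x] by (intro mult_mono) auto
    then show "norm (of_real (exp (x i - x j)) * f x) \<le> C * exp ((d + 2) * sumabs n x)"
      by (simp add: norm_mult algebra_simps exp_add)
  qed
qed

text \<open>
  Integrals of a kernel against a function, smooth in \<open>x\<close>. The bound has a growth of arbitrary order in \<open>y\<close> on
  the left, so it absorbs all exponential polynomials. The measure is arbitrary in order to include the point measure, for
  which the integral is the kernel itself.
\<close>

locale kernel_integral =
  fixes N :: "(nat \<Rightarrow> real) measure" and \<phi> :: cfun and n m :: nat and lam :: complex
  assumes mn: "m \<le> n" "n \<le> m + 1"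
    and meas_comp: "\<And>i. i \<in> {1..n} \<Longrightarrow> (\<lambda>y. y i) \<in> borel_measurable N"
    and meas_\<phi>: "\<phi> \<in> borel_measurable N"
    and int_weight: "integrable N (\<lambda>y. exp (- sumabs n y))"
    and domination: "\<And>c. \<exists>C d. \<forall>x\<in>Rn (m + 1). \<forall>y\<in>space N.
        norm (toda_kernel n m lam x y * \<phi> y) * exp (c * sumabs n y) \<le> C * exp (d * sumabs (m + 1) x) * exp (- sumabs n y)"
begin

definition G :: "kernel \<Rightarrow> cfun" where
  "G P x = (LINT y|N. P x y * toda_kernel n m lam x y * \<phi> y)"

lemma integrand_bound:
  assumes "exp_poly (m + 1) n P"
  obtains C d where "C \<ge> 0" "d \<ge> 0" "\<And>x y. x \<in> Rn (m + 1) \<Longrightarrow> y \<in> space N \<Longrightarrow>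
     norm (P x y * toda_kernel n m lam x y * \<phi> y) \<le> C * exp (d * sumabs (m + 1) x) * exp (- sumabs n y)"
proof -
  obtain C c where P: "C \<ge> 0" "c \<ge> 0" "\<And>x y. norm (P x y) \<le> C * exp (c * (sumabs (m + 1) x + sumabs n y))"
    using exp_poly_bound[OF assms] by blast
  obtain C' d where D: "\<And>x y. x \<in> Rn (m + 1) \<Longrightarrow> y \<in> space N \<Longrightarrow>
      norm (toda_kernel n m lam x y * \<phi> y) * exp (c * sumabs n y) \<le> C' * exp (d * sumabs (m + 1) x) * exp (- sumabs n y)"
    using domination[of c] by blast
  show ?thesis
  proof (rule that[of "C * \<bar>C'\<bar>" "c + \<bar>d\<bar>"])
    fix x y assume xy: "x \<in> Rn (m + 1)" "y \<in> space N"
    have "norm (P x y * toda_kernel n m lam x y * \<phi> y) \<le> C * exp (c * (sumabs (m + 1) x + sumabs n y)) * norm (toda_kernel n m lam x y * \<phi> y)"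
      using mult_right_mono[OF P(3)[of x y], of "norm (toda_kernel n m lam x y * \<phi> y)"] by (simp add: norm_mult mult.assoc)
    also have "\<dots> = C * exp (c * sumabs (m + 1) x) * (norm (toda_kernel n m lam x y * \<phi> y) * exp (c * sumabs n y))"
      by (simp add: algebra_simps exp_add)
    also have "\<dots> \<le> C * exp (c * sumabs (m + 1) x) * (C' * exp (d * sumabs (m + 1) x) * exp (- sumabs n y))"
      using P D[OF xy] by (intro mult_left_mono) auto
    also have "\<dots> \<le> C * exp (c * sumabs (m + 1) x) * (\<bar>C'\<bar> * exp (\<bar>d\<bar> * sumabs (m + 1) x) * exp (- sumabs n y))"
      using P by (intro mult_left_mono mult_right_mono mult_mono) (auto intro!: mult_right_mono)
    finally show "norm (P x y * toda_kernel n m lam x y * \<phi> y) \<le> C * \<bar>C'\<bar> * exp ((c + \<bar>d\<bar>) * sumabs (m + 1) x) * exp (- sumabs n y)"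
      by (simp add: algebra_simps exp_add)
  qed (use P in auto)
qed

lemma integrand_measurable:
  assumes "exp_poly (m + 1) n P"
  shows "(\<lambda>y. P x y * toda_kernel n m lam x y * \<phi> y) \<in> borel_measurable N"
  by (intro borel_measurable_times meas_\<phi> measurable_toda_kernel exp_poly_measurable[OF _ assms] meas_comp mn) auto

lemma integrand_integrable:
  assumes P: "exp_poly (m + 1) n P" and x: "x \<in> Rn (m + 1)"
  shows "integrable N (\<lambda>y. P x y * toda_kernel n m lam x y * \<phi> y)"
proof -
  obtain C d where b: "C \<ge> 0" "d \<ge> 0" "\<And>x y. x \<in> Rn (m + 1) \<Longrightarrow> y \<in> space N \<Longrightarrow>
     norm (P x y * toda_kernel n m lam x y * \<phi> y) \<le> C * exp (d * sumabs (m + 1) x) * exp (- sumabs n y)"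
    by (rule integrand_bound[OF P]) blast
  have "integrable N (\<lambda>y. C * exp (d * sumabs (m + 1) x) * exp (- sumabs n y))"
    by (intro integrable_mult_right int_weight)
  then show ?thesis
    by (rule Bochner_Integration.integrable_bound[OF _ integrand_measurable[OF P]])
      (use b x in \<open>auto intro!: AE_I2 order_trans[OF _ abs_ge_self]\<close>)
qed

lemma G_exp_growth:
  assumes P: "exp_poly (m + 1) n P"
  shows "exp_growth (m + 1) (G P)"
proof -
  obtain C d where b: "C \<ge> 0" "d \<ge> 0" "\<And>x y. x \<in> Rn (m + 1) \<Longrightarrow> y \<in> space N \<Longrightarrow>
     norm (P x y * toda_kernel n m lam x y * \<phi> y) \<le> C * exp (d * sumabs (m + 1) x) * exp (- sumabs n y)"
    by (rule integrand_bound[OF P]) blast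
  have "norm (G P x) \<le> C * (LINT y|N. exp (- sumabs n y)) * exp (d * sumabs (m + 1) x)" if x: "x \<in> Rn (m + 1)" for x
  proof -
    have "norm (G P x) \<le> (LINT y|N. C * exp (d * sumabs (m + 1) x) * exp (- sumabs n y))"
      unfolding G_def
      by (intro order_trans[OF integral_norm_bound integral_mono] integrable_norm integrand_integrable[OF P x]
        integrable_mult_right int_weight b x)
    then show ?thesis by (simp add: mult.commute mult.left_commute)
  qed
  then show ?thesis unfolding exp_growth_def by blast
qed

lemma G_continuous:
  assumes P: "exp_poly (m + 1) n P"
  shows "continuous_on (Rn (m + 1)) (G P)"
proof (rule continuous_on_sequentiallyI)
  obtain C d where b: "C \<ge> 0" "d \<ge> 0" "\<And>x y. x \<in> Rn (m + 1) \<Longrightarrow> y \<in> space N \<Longrightarrow>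
     norm (P x y * toda_kernel n m lam x y * \<phi> y) \<le> C * exp (d * sumabs (m + 1) x) * exp (- sumabs n y)"
    by (rule integrand_bound[OF P]) blast
  fix u :: "nat \<Rightarrow> nat \<Rightarrow> real" and a
  assume u: "\<forall>k. u k \<in> Rn (m + 1)" "a \<in> Rn (m + 1)" "u \<longlonglongrightarrow> a"
  have "continuous_on UNIV (sumabs (m + 1))"
    unfolding sumabs_def by (intro continuous_intros continuous_on_product_coordinates)
  then have "(\<lambda>k. sumabs (m + 1) (u k)) \<longlonglongrightarrow> sumabs (m + 1) a"
    using u(3) by (metis UNIV_I continuous_on_tendsto_compose eventually_sequentiallyI)
  then have "Bseq (\<lambda>k. sumabs (m + 1) (u k))" by (intro convergent_imp_Bseq convergentI)
  then obtain R where R: "\<And>k. sumabs (m + 1) (u k) \<le> R"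
    unfolding Bseq_def by (metis abs_le_D1 real_norm_def)
  show "(\<lambda>k. G P (u k)) \<longlonglongrightarrow> G P a"
    unfolding G_def
  proof (rule integral_dominated_convergence[where w="\<lambda>y. C * exp (d * R) * exp (- sumabs n y)"])
    show "(\<lambda>y. P a y * toda_kernel n m lam a y * \<phi> y) \<in> borel_measurable N"
      and "\<And>k. (\<lambda>y. P (u k) y * toda_kernel n m lam (u k) y * \<phi> y) \<in> borel_measurable N"
      by (rule integrand_measurable[OF P])+
    show "integrable N (\<lambda>y. C * exp (d * R) * exp (- sumabs n y))"
      by (intro integrable_mult_right int_weight)
    show "AE y in N. (\<lambda>k. P (u k) y * toda_kernel n m lam (u k) y * \<phi> y) \<longlonglongrightarrow> P a y * toda_kernel n m lam a y * \<phi> y"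
    proof (rule AE_I2)
      fix y
      have "continuous_on UNIV (\<lambda>x. P x y * toda_kernel n m lam x y * \<phi> y)"
        by (intro continuous_intros exp_poly_continuous[OF P] continuous_on_toda_kernel_x)
      then show "(\<lambda>k. P (u k) y * toda_kernel n m lam (u k) y * \<phi> y) \<longlonglongrightarrow> P a y * toda_kernel n m lam a y * \<phi> y"
        using u(3) by (rule continuous_on_tendsto_compose) auto
    qed
    show "AE y in N. norm (P (u k) y * toda_kernel n m lam (u k) y * \<phi> y) \<le> C * exp (d * R) * exp (- sumabs n y)" for k
    proof (rule AE_I2)
      fix y assume y: "y \<in> space N"
      have "norm (P (u k) y * toda_kernel n m lam (u k) y * \<phi> y) \<le> C * exp (d * sumabs (m + 1) (u k)) * exp (- sumabs n y)"
        using u(1) y by (intro b) auto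
      also have "\<dots> \<le> C * exp (d * R) * exp (- sumabs n y)"
        using b(1,2) R[of k] by (intro mult_right_mono mult_left_mono) (auto intro!: mult_left_mono)
      finally show "norm (P (u k) y * toda_kernel n m lam (u k) y * \<phi> y) \<le> C * exp (d * R) * exp (- sumabs n y)" .
    qed
  qed
qed

lemma G_deriv:
  assumes P: "exp_poly (m + 1) n P" and P': "exp_poly (m + 1) n P'"
    and der: "\<And>x y. ((\<lambda>s. P (x(i := s)) y) has_vector_derivative P' x y) (at (x i))"
    and i: "i \<in> {1..m+1}" and x: "x \<in> Rn (m + 1)"
  shows "((\<lambda>s. G P (x(i := s))) has_vector_derivative
     G (\<lambda>x y. P' x y + P x y * (\<i> * lam - fwd_factor n x y i + bwd_factor m x y (i - 1))) x) (at (x i))"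
proof -
  let ?D = "\<lambda>x y. P' x y + P x y * (\<i> * lam - fwd_factor n x y i + bwd_factor m x y (i - 1))"
  have D: "exp_poly (m + 1) n ?D"
    using mn by (intro exp_poly.add exp_poly.mult exp_poly_diff P P' exp_poly.const exp_poly_fwd_factor exp_poly_bwd_factor) auto
  obtain C d where b: "C \<ge> 0" "d \<ge> 0" "\<And>x y. x \<in> Rn (m + 1) \<Longrightarrow> y \<in> space N \<Longrightarrow>
     norm (?D x y * toda_kernel n m lam x y * \<phi> y) \<le> C * exp (d * sumabs (m + 1) x) * exp (- sumabs n y)"
    by (rule integrand_bound[OF D]) blast
  let ?R = "sumabs (m + 1) x + \<bar>x i\<bar> + 1"
  have pt: "((\<lambda>s. P (x(i := s)) y * toda_kernel n m lam (x(i := s)) y * \<phi> y) has_vector_derivative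
      ?D (x(i := s)) y * toda_kernel n m lam (x(i := s)) y * \<phi> y) (at s)" for s y
  proof -
    have 1: "((\<lambda>s. P (x(i := s)) y) has_vector_derivative P' (x(i := s)) y) (at s)"
      using der[of "x(i := s)" y] by simp
    have 2: "((\<lambda>s. toda_kernel n m lam (x(i := s)) y) has_vector_derivative
     toda_kernel n m lam (x(i := s)) y * (\<i> * lam - fwd_factor n (x(i := s)) y i + bwd_factor m (x(i := s)) y (i - 1))) (at s)"
      using toda_kernel_deriv_x[OF i, of n lam "x(i := s)" y] by simp
    show ?thesis
      using has_vector_derivative_mult_left[OF has_vector_derivative_mult[OF 1 2], of "\<phi> y"]
      by (simp add: algebra_simps)
  qed
  have "((\<lambda>s. LINT y|N. P (x(i := s)) y * toda_kernel n m lam (x(i := s)) y * \<phi> y) has_vector_derivative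
     (LINT y|N. ?D (x(i := x i)) y * toda_kernel n m lam (x(i := x i)) y * \<phi> y)) (at (x i))"
  proof (rule has_vector_derivative_integral_dominated[where g="\<lambda>y. C * exp (d * ?R) * exp (- sumabs n y)"
      and f'="\<lambda>s y. ?D (x(i := s)) y * toda_kernel n m lam (x(i := s)) y * \<phi> y"])
    fix s y assume s: "\<bar>s - x i\<bar> < 1" and y: "y \<in> space N"
    show "((\<lambda>s. P (x(i := s)) y * toda_kernel n m lam (x(i := s)) y * \<phi> y) has_vector_derivative
      ?D (x(i := s)) y * toda_kernel n m lam (x(i := s)) y * \<phi> y) (at s)" by (rule pt)
    have "norm (?D (x(i := s)) y * toda_kernel n m lam (x(i := s)) y * \<phi> y) \<le> C * exp (d * sumabs (m + 1) (x(i := s))) * exp (- sumabs n y)"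
      using b(3)[of "x(i := s)" y] x y i by auto
    also have "\<dots> \<le> C * exp (d * ?R) * exp (- sumabs n y)"
      using b(1,2) sumabs_upd_le[OF i, of x s] s by (intro mult_right_mono mult_left_mono) (auto intro!: mult_left_mono)
    finally show "norm (?D (x(i := s)) y * toda_kernel n m lam (x(i := s)) y * \<phi> y) \<le> C * exp (d * ?R) * exp (- sumabs n y)" .
  next
    show "integrable N (\<lambda>y. C * exp (d * ?R) * exp (- sumabs n y))"
      by (intro integrable_mult_right int_weight)
    show "integrable N (\<lambda>y. P (x(i := s)) y * toda_kernel n m lam (x(i := s)) y * \<phi> y)" for s
      using x i by (intro integrand_integrable P Rn_upd) auto
    show "(\<lambda>y. ?D (x(i := x i)) y * toda_kernel n m lam (x(i := x i)) y * \<phi> y) \<in> borel_measurable N"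
      by (rule integrand_measurable[OF D])
  qed
  then show ?thesis unfolding G_def by simp
qed

lemma G_tame:
  assumes "exp_poly (m + 1) n P"
  shows "tame.controlled (m + 1) (G P)"
proof (rule tame.controlled_coinduct[where P = "\<lambda>g. \<exists>P. exp_poly (m + 1) n P \<and> (\<forall>x\<in>Rn (m + 1). g x = G P x)"])
  fix g assume "\<exists>P. exp_poly (m + 1) n P \<and> (\<forall>x\<in>Rn (m + 1). g x = G P x)"
  then obtain P where P: "exp_poly (m + 1) n P" "\<And>x. x \<in> Rn (m + 1) \<Longrightarrow> g x = G P x" by auto
  show "continuous_on (Rn (m + 1)) g" using G_continuous[OF P(1)] P(2) by (simp cong: continuous_on_cong)
  show "exp_growth (m + 1) g" using tame.G_cong[OF G_exp_growth[OF P(1)] P(2)] .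
  fix i assume i: "i \<in> {1..m + 1}"
  obtain P' where P': "exp_poly (m + 1) n P'" "\<And>x y. ((\<lambda>s. P (x(i := s)) y) has_vector_derivative P' x y) (at (x i))"
    using exp_poly_deriv[OF P(1)] by blast
  let ?D = "\<lambda>x y. P' x y + P x y * (\<i> * lam - fwd_factor n x y i + bwd_factor m x y (i - 1))"
  have D: "exp_poly (m + 1) n ?D"
    using mn by (intro exp_poly.add exp_poly.mult exp_poly_diff P P' exp_poly.const exp_poly_fwd_factor exp_poly_bwd_factor) auto
  have der: "((\<lambda>s. g (x(i := s))) has_vector_derivative G ?D x) (at (x i))" if x: "x \<in> Rn (m + 1)" for x
    using G_deriv[OF P(1) P'(1) P'(2) i x] P(2)[OF Rn_upd[OF x i]] by simp
  show "(\<lambda>s. g (x(i := s))) differentiable at (x i)" if x: "x \<in> Rn (m + 1)" for x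
    using der[OF x] by (rule differentiableI_vector)
  show "\<exists>P. exp_poly (m + 1) n P \<and> (\<forall>x\<in>Rn (m + 1). partial i g x = G P x)"
    using D partial_eqI[where f=g, OF der] by blast
qed (use assms in auto)

text \<open>
  The continuant of index \<open>j\<close> does not contain the variable \<open>x (j + 1)\<close>, so differentiating in that variable acts on the kernel only and
  produces exactly the recursion for \<open>tau\<close>.
\<close>

lemma toda_T_G:
  "k \<le> m + 1 \<Longrightarrow> x \<in> Rn (m + 1) \<Longrightarrow>
   toda_T \<mu> k (G (\<lambda>_ _. 1)) x = G (\<lambda>x y. tau (\<mu> - lam) (fwd_factor n x y) (bwd_factor m x y) k) x"
proof (induction k arbitrary: x rule: less_induct)
  case (less k)
  show ?case
  proof (cases k)
    case 0
    then show ?thesis by simp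
  next
    case (Suc j)
    let ?t = "\<lambda>j x y. tau (\<mu> - lam) (fwd_factor n x y) (bwd_factor m x y) j"
    have i: "Suc j \<in> {1..m+1}" using less Suc by auto
    have t: "exp_poly (m + 1) n (?t j)" for j using mn by (intro exp_poly_tau) auto
    let ?D = "\<lambda>x y. 0 + ?t j x y * (\<i> * lam - fwd_factor n x y (Suc j) + bwd_factor m x y (Suc j - 1))"
    have D: "exp_poly (m + 1) n ?D"
      using mn by (intro exp_poly.add exp_poly.mult exp_poly_diff t exp_poly.const exp_poly_fwd_factor exp_poly_bwd_factor) auto
    have const: "?t j (x(Suc j := s)) y = ?t j x y" for x s y
      by (rule tau_cong) (auto simp: fwd_factor_def bwd_factor_def)
    have "((\<lambda>s. G (?t j) (x(Suc j := s))) has_vector_derivative G ?D x) (at (x (Suc j)))"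
      by (rule G_deriv[OF t exp_poly.const _ i less(3)]) (unfold const, rule has_vector_derivative_const)
    then have p: "partial (Suc j) (toda_T \<mu> j (G (\<lambda>_ _. 1))) x = G ?D x"
      using less Suc by (intro partial_eqI) simp
    have I: "integrable N (\<lambda>y. ?t j x y * toda_kernel n m lam x y * \<phi> y)" "integrable N (\<lambda>y. ?D x y * toda_kernel n m lam x y * \<phi> y)"
       "integrable N (\<lambda>y. ?t (j - 1) x y * toda_kernel n m lam x y * \<phi> y)"
      by (rule integrand_integrable[OF _ less(3)]; fact t D)+
    have T: "toda_T \<mu> j (G (\<lambda>_ _. 1)) x = G (?t j) x" "toda_T \<mu> (j - 1) (G (\<lambda>_ _. 1)) x = G (?t (j - 1)) x"
      using less Suc by auto
    have "toda_T \<mu> k (G (\<lambda>_ _. 1)) x = \<mu> * G (?t j) x + \<i> * G ?D x - bond j x * G (?t (j - 1)) x"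
      by (simp only: Suc toda_T.simps T p)
    also have "\<dots> = (LINT y|N. \<mu> * (?t j x y * toda_kernel n m lam x y * \<phi> y) + \<i> * (?D x y * toda_kernel n m lam x y * \<phi> y)
        - bond j x * (?t (j - 1) x y * toda_kernel n m lam x y * \<phi> y))"
      unfolding G_def using I by (simp del: tau.simps)
    also have "\<dots> = G (?t (Suc j)) x"
      unfolding G_def
    proof (rule Bochner_Integration.integral_cong[OF refl])
      fix y
      have "bond j x = fwd_factor n x y j * bwd_factor m x y j"
        using less Suc mn by (subst fwd_bwd_bond_x) auto
      then show "\<mu> * (?t j x y * toda_kernel n m lam x y * \<phi> y) + \<i> * (?D x y * toda_kernel n m lam x y * \<phi> y)
        - bond j x * (?t (j - 1) x y * toda_kernel n m lam x y * \<phi> y) = ?t (Suc j) x y * toda_kernel n m lam x y * \<phi> y"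
        by (simp add: algebra_simps)
    qed
    finally show ?thesis by (simp only: Suc)
  qed
qed

end

section \<open>Integration by parts\<close>

lemma integral_derivative_eq_0:
  fixes g g' :: "real \<Rightarrow> complex"
  assumes der: "\<And>s. (g has_vector_derivative g' s) (at s)" and bound: "\<And>s. norm (g s) \<le> C * exp (- \<bar>s\<bar>)"
  shows "(LINT s|lborel. g' s) = 0"
proof (cases "integrable lborel g'")
  case False
  then show ?thesis by (rule not_integrable_integral_eq)
next
  case True
  have eq: "(LINT s|lborel. indicator {- real k..real k} s *\<^sub>R g' s) = g (real k) - g (- real k)" for k
  proof -
    have "set_integrable lborel {- real k..real k} g'"
      unfolding set_integrable_def using True by (intro integrable_mult_indicator) auto
    then have "(LINT s:{- real k..real k}|lborel. g' s) = integral {- real k..real k} g'"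
      by (rule set_borel_integral_eq_integral)
    also have "\<dots> = g (real k) - g (- real k)"
      by (intro integral_unique fundamental_theorem_of_calculus) (auto intro: der has_vector_derivative_at_within)
    finally show ?thesis unfolding set_lebesgue_integral_def .
  qed
  have 1: "(\<lambda>k. LINT s|lborel. indicator {- real k..real k} s *\<^sub>R g' s) \<longlonglongrightarrow> (LINT s|lborel. g' s)"
  proof (rule integral_dominated_convergence[where w="\<lambda>s. norm (g' s)"])
    show "AE s in lborel. (\<lambda>k. indicator {- real k..real k} s *\<^sub>R g' s) \<longlonglongrightarrow> g' s"
    proof (rule AE_I2)
      fix s :: real
      obtain k0 where k0: "\<bar>s\<bar> \<le> real k0" using real_arch_simple by blast
      have "\<forall>\<^sub>F k in sequentially. indicator {- real k..real k} s *\<^sub>R g' s = g' s"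
        using eventually_ge_at_top[of k0] by eventually_elim (use k0 in \<open>auto simp: indicator_def\<close>)
      then show "(\<lambda>k. indicator {- real k..real k} s *\<^sub>R g' s) \<longlonglongrightarrow> g' s" by (rule tendsto_eventually)
    qed
  qed (use True in \<open>auto simp: indicator_def\<close>)
  have e: "(\<lambda>k. C * exp (- real k)) \<longlonglongrightarrow> 0"
    using tendsto_mult_right_zero[OF filterlim_compose[OF exp_at_bot filterlim_compose[OF filterlim_uminus_at_bot_at_top filterlim_real_sequentially]], of C]
    by simp
  have "(\<lambda>k. g (real k)) \<longlonglongrightarrow> 0"
    by (rule Lim_null_comparison[OF always_eventually e]) (use bound[of "real _"] in auto)
  moreover have "(\<lambda>k. g (- real k)) \<longlonglongrightarrow> 0"
    by (rule Lim_null_comparison[OF always_eventually e]) (use bound[of "- real _"] in auto)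
  ultimately have "(\<lambda>k. g (real k) - g (- real k)) \<longlonglongrightarrow> 0 - 0" by (intro tendsto_diff)
  with 1 show ?thesis unfolding eq using LIMSEQ_unique by fastforce
qed

text \<open>Fubini in the coordinate of differentiation; the boundary terms vanish by the bound.\<close>

lemma integral_partial_eq_0:
  fixes F F' :: cfun
  assumes i: "i \<in> {1..n}"
    and der: "\<And>y. y \<in> Rn n \<Longrightarrow> ((\<lambda>s. F (y(i := s))) has_vector_derivative F' y) (at (y i))"
    and int: "integrable (leb n) F'"
    and bound: "\<And>y. y \<in> Rn n \<Longrightarrow> norm (F y) \<le> C * exp (- sumabs n y)"
  shows "(LINT y|leb n. F' y) = 0"
proof -
  let ?I = "{1..n} - {i}"
  have ins: "{1..n} = insert i ?I" using i by auto
  have C: "C \<ge> 0"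
  proof -
    have "0 \<le> C * exp (- sumabs n (\<lambda>i\<in>{1..n}. 0))" using bound[of "\<lambda>i\<in>{1..n}. 0"] norm_ge_zero order_trans by (metis restrict_in_Rn)
    then show ?thesis by (simp add: zero_le_mult_iff)
  qed
  have "(LINT y|leb n. F' y) = (LINT y|PiM (insert i ?I) (\<lambda>_. lborel). F' y)"
    unfolding leb_def ins[symmetric] ..
  also have "\<dots> = (LINT y|PiM ?I (\<lambda>_. lborel). LINT s|lborel. F' (y(i := s)))"
    by (rule lborel_prod.product_integral_insert) (use int ins in \<open>auto simp: leb_def\<close>)
  also have "\<dots> = (LINT y|PiM ?I (\<lambda>_. lborel :: real measure). 0)"
  proof (rule Bochner_Integration.integral_cong[OF refl])
    fix y :: "nat \<Rightarrow> real" assume "y \<in> space (PiM ?I (\<lambda>_. lborel))"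
    then have y: "y(i := s) \<in> Rn n" for s
      using i by (auto simp: space_PiM Rn_def PiE_def extensional_def)
    show "(LINT s|lborel. F' (y(i := s))) = 0"
    proof (rule integral_derivative_eq_0)
      show "((\<lambda>s. F (y(i := s))) has_vector_derivative F' (y(i := s))) (at s)" for s
        using der[OF y[of s]] by simp
      show "norm (F (y(i := s))) \<le> C * exp (- \<bar>s\<bar>)" for s
      proof -
        have "norm (F (y(i := s))) \<le> C * exp (- sumabs n (y(i := s)))" by (rule bound[OF y])
        also have "\<dots> \<le> C * exp (- \<bar>s\<bar>)"
          using abs_le_sumabs[OF i, of "y(i := s)"] C by (intro mult_left_mono) auto
        finally show ?thesis .
      qed
    qed
  qed
  finally show ?thesis by simp
qed

lemma integrable_exp_minus_sumabs: "integrable (leb n) (\<lambda>y. exp (- sumabs n y))"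
proof -
  have "(\<lambda>y. exp (- sumabs n y)) = (\<lambda>y. \<Prod>i\<in>{1..n}. exp (- \<bar>y i\<bar>))"
    by (simp add: sumabs_def exp_sum sum_negf[symmetric])
  then show ?thesis
    unfolding leb_def using lborel_prod.product_integrable_prod[of "{1..n}" "\<lambda>_ s. exp (- \<bar>s\<bar>)"] integrable_exp_minus_abs
    by simp
qed

section \<open>Functions that a kernel can be integrated against\<close>

lemma norm_toda_kernel_le:
  assumes "m \<le> n"
  shows "norm (toda_kernel n m lam x y) \<le> exp (norm lam * (sumabs (m + 1) x + sumabs n y)
     - ((\<Sum>k=1..n. exp (x k - y k)) + (\<Sum>k=1..m. exp (y k - x (k + 1)))))"
proof -
  let ?s = "(\<Sum>i=1..m+1. x i) - (\<Sum>i=1..n. y i)"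
  have "Re (\<i> * lam * of_real ?s) \<le> norm (\<i> * lam * of_real ?s)" by (rule complex_Re_le_cmod)
  also have "\<dots> = norm lam * \<bar>?s\<bar>" by (simp only: norm_mult norm_of_real norm_ii mult_1)
  also have "\<dots> \<le> norm lam * (sumabs (m + 1) x + sumabs n y)"
    using abs_sum_le_sumabs[where n="m+1" and x=x] abs_sum_le_sumabs[where n=n and x=y] by (intro mult_left_mono) auto
  finally show ?thesis unfolding toda_kernel_def norm_exp_eq_Re by (simp only: minus_complex.sel Re_complex_of_real exp_le_cancel_iff diff_right_mono)
qed

text \<open>The condition on the function in the locale \<open>kernel_integral\<close>, for Lebesgue measure.\<close>

definition dominated :: "nat \<Rightarrow> nat \<Rightarrow> complex \<Rightarrow> cfun \<Rightarrow> bool" where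
  "dominated n m lam \<phi> \<longleftrightarrow> (\<forall>c. \<exists>C d. \<forall>x\<in>Rn (m + 1). \<forall>y\<in>Rn n.
     norm (toda_kernel n m lam x y * \<phi> y) * exp (c * sumabs n y) \<le> C * exp (d * sumabs (m + 1) x) * exp (- sumabs n y))"

interpretation paired: growth_class n "dominated n m lam" for n m lam
proof
  fix f g :: cfun and a and i j
  show "dominated n m lam g" if "dominated n m lam f" "\<And>x. x \<in> Rn n \<Longrightarrow> g x = f x"
    using that by (simp add: dominated_def)
  assume f: "dominated n m lam f"
  show "dominated n m lam (\<lambda>y. a * f y)"
    unfolding dominated_def
  proof
    fix c
    obtain C d where b: "\<And>x y. x \<in> Rn (m + 1) \<Longrightarrow> y \<in> Rn n \<Longrightarrow> norm (toda_kernel n m lam x y * f y) * exp (c * sumabs n y) \<le> C * exp (d * sumabs (m + 1) x) * exp (- sumabs n y)"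
      using f unfolding dominated_def by metis
    have "norm (toda_kernel n m lam x y * (a * f y)) * exp (c * sumabs n y) \<le> (norm a * C) * exp (d * sumabs (m + 1) x) * exp (- sumabs n y)"
      if "x \<in> Rn (m + 1)" "y \<in> Rn n" for x y
      using mult_left_mono[OF b[OF that], of "norm a"] by (simp add: norm_mult mult.assoc mult.left_commute)
    then show "\<exists>C d. \<forall>x\<in>Rn (m + 1). \<forall>y\<in>Rn n. norm (toda_kernel n m lam x y * (a * f y)) * exp (c * sumabs n y) \<le> C * exp (d * sumabs (m + 1) x) * exp (- sumabs n y)"
      by blast
  qed
  show "dominated n m lam (\<lambda>y. of_real (exp (y i - y j)) * f y)" if ij: "i \<in> {1..n}" "j \<in> {1..n}"
    unfolding dominated_def
  proof
    fix c
    obtain C d where b: "\<And>x y. x \<in> Rn (m + 1) \<Longrightarrow> y \<in> Rn n \<Longrightarrow> norm (toda_kernel n m lam x y * f y) * exp ((c + 2) * sumabs n y) \<le> C * exp (d * sumabs (m + 1) x) * exp (- sumabs n y)"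
      using f unfolding dominated_def by metis
    have "norm (toda_kernel n m lam x y * (of_real (exp (y i - y j)) * f y)) * exp (c * sumabs n y) \<le> C * exp (d * sumabs (m + 1) x) * exp (- sumabs n y)"
      if xy: "x \<in> Rn (m + 1)" "y \<in> Rn n" for x y
    proof -
      have "exp (y i - y j) * exp (c * sumabs n y) \<le> exp ((c + 2) * sumabs n y)"
        using abs_le_sumabs[OF ij(1), of y] abs_le_sumabs[OF ij(2), of y] by (simp add: algebra_simps flip: exp_add)
      then have "norm (toda_kernel n m lam x y * f y) * (exp (y i - y j) * exp (c * sumabs n y)) \<le> norm (toda_kernel n m lam x y * f y) * exp ((c + 2) * sumabs n y)"
        by (rule mult_left_mono) simp
      with b[OF xy] show ?thesis by (simp add: norm_mult mult.assoc mult.left_commute)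
    qed
    then show "\<exists>C d. \<forall>x\<in>Rn (m + 1). \<forall>y\<in>Rn n. norm (toda_kernel n m lam x y * (of_real (exp (y i - y j)) * f y)) * exp (c * sumabs n y) \<le> C * exp (d * sumabs (m + 1) x) * exp (- sumabs n y)"
      by blast
  qed
  show "dominated n m lam (\<lambda>y. f y + g y)" if g: "dominated n m lam g"
    unfolding dominated_def
  proof
    fix c
    obtain C d where b: "\<And>x y. x \<in> Rn (m + 1) \<Longrightarrow> y \<in> Rn n \<Longrightarrow> norm (toda_kernel n m lam x y * f y) * exp (c * sumabs n y) \<le> C * exp (d * sumabs (m + 1) x) * exp (- sumabs n y)"
      using f unfolding dominated_def by metis
    obtain C' d' where b': "\<And>x y. x \<in> Rn (m + 1) \<Longrightarrow> y \<in> Rn n \<Longrightarrow> norm (toda_kernel n m lam x y * g y) * exp (c * sumabs n y) \<le> C' * exp (d' * sumabs (m + 1) x) * exp (- sumabs n y)"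
      using g unfolding dominated_def by metis
    have "norm (toda_kernel n m lam x y * (f y + g y)) * exp (c * sumabs n y) \<le> (\<bar>C\<bar> + \<bar>C'\<bar>) * exp ((\<bar>d\<bar> + \<bar>d'\<bar>) * sumabs (m + 1) x) * exp (- sumabs n y)"
      if xy: "x \<in> Rn (m + 1)" "y \<in> Rn n" for x y
    proof -
      have "norm (toda_kernel n m lam x y * (f y + g y)) * exp (c * sumabs n y) \<le>
         (norm (toda_kernel n m lam x y * f y) + norm (toda_kernel n m lam x y * g y)) * exp (c * sumabs n y)"
        unfolding distrib_left by (intro mult_right_mono norm_triangle_ineq) auto
      also have "\<dots> \<le> C * exp (d * sumabs (m + 1) x) * exp (- sumabs n y) + C' * exp (d' * sumabs (m + 1) x) * exp (- sumabs n y)"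
        using b[OF xy] b'[OF xy] by (simp add: distrib_right)
      also have "\<dots> \<le> \<bar>C\<bar> * exp ((\<bar>d\<bar> + \<bar>d'\<bar>) * sumabs (m + 1) x) * exp (- sumabs n y) + \<bar>C'\<bar> * exp ((\<bar>d\<bar> + \<bar>d'\<bar>) * sumabs (m + 1) x) * exp (- sumabs n y)"
        by (intro add_mono mult_right_mono mult_mono) (auto intro!: mult_right_mono)
      finally show ?thesis by (simp add: distrib_right)
    qed
    then show "\<exists>C d. \<forall>x\<in>Rn (m + 1). \<forall>y\<in>Rn n. norm (toda_kernel n m lam x y * (f y + g y)) * exp (c * sumabs n y) \<le> C * exp (d * sumabs (m + 1) x) * exp (- sumabs n y)"
      by blast
  qed
qed

lemma kernel_integral_leb:
  assumes "m \<le> n" "n \<le> m + 1" "dominated n m lam \<phi>" "continuous_on (Rn n) \<phi>"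
  shows "kernel_integral (leb n) \<phi> n m lam"
  using assms borel_measurable_leb_continuous integrable_exp_minus_sumabs measurable_leb_component
  unfolding kernel_integral_def dominated_def by auto

lemma kernel_integral_controlled:
  assumes "m \<le> n" "n \<le> m + 1" "paired.controlled n m lam \<phi>"
  shows "kernel_integral (leb n) \<phi> n m lam"
  using assms paired.controlled_growth paired.controlled_continuous by (intro kernel_integral_leb) auto

lemma power_le_fact_exp: "0 \<le> u \<Longrightarrow> u ^ N \<le> fact N * exp (u::real)"
proof -
  assume u: "0 \<le> u"
  have "u ^ N /\<^sub>R fact N \<le> (\<Sum>k. u ^ k /\<^sub>R fact k)"
    using sum_le_suminf[OF summable_exp_generic[of u], of "{N}"] u by simp
  also have "\<dots> = exp u" by (simp add: exp_def)
  finally show ?thesis by (simp add: field_simps)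
qed

text \<open>
  In the recursive kernel every \<open>y k\<close> is bound on both sides, to \<open>x k\<close> and to \<open>x (k + 1)\<close>. From \<open>u ^ N \<le> fact N * exp u\<close>,
  applied to the two bonds, the kernel beats any exponential in \<open>y\<close>, at the price of an exponential in \<open>x\<close>.
\<close>

lemma exp_abs_le_double_exp:
  fixes a b y :: real
  shows "exp (real N * \<bar>y\<bar>) \<le> fact N * exp (real N * (\<bar>a\<bar> + \<bar>b\<bar>)) * exp (exp (a - y) + exp (y - b))"
proof (cases "y \<ge> 0")
  case True
  have "exp (real N * \<bar>y\<bar>) = exp (y - b) ^ N * exp (real N * b)"
    using True by (simp add: algebra_simps flip: exp_of_nat_mult exp_add)
  also have "\<dots> \<le> (fact N * exp (exp (y - b))) * exp (real N * (\<bar>a\<bar> + \<bar>b\<bar>))"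
    by (intro mult_mono power_le_fact_exp) (auto intro!: mult_left_mono)
  also have "\<dots> \<le> (fact N * exp (exp (a - y) + exp (y - b))) * exp (real N * (\<bar>a\<bar> + \<bar>b\<bar>))"
    by (intro mult_right_mono mult_left_mono) auto
  finally show ?thesis by (simp add: mult.assoc mult.left_commute mult.commute)
next
  case False
  have "exp (real N * \<bar>y\<bar>) = exp (a - y) ^ N * exp (- (real N * a))"
    using False by (simp add: algebra_simps flip: exp_of_nat_mult exp_add)
  also have "- (real N * a) = real N * (- a)" by simp
  also have "real N * (- a) \<le> real N * (\<bar>a\<bar> + \<bar>b\<bar>)" by (intro mult_left_mono) auto
  then have "exp (a - y) ^ N * exp (real N * (- a)) \<le> (fact N * exp (exp (a - y))) * exp (real N * (\<bar>a\<bar> + \<bar>b\<bar>))"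
    by (intro mult_mono power_le_fact_exp) (auto simp del: mult_minus_right)
  also have "\<dots> \<le> (fact N * exp (exp (a - y) + exp (y - b))) * exp (real N * (\<bar>a\<bar> + \<bar>b\<bar>))"
    by (intro mult_right_mono mult_left_mono) auto
  finally show ?thesis by (simp add: mult.assoc mult.left_commute mult.commute)
qed

lemma recursive_kernel_decay:
  "exp (real N * sumabs n y) \<le> fact N ^ n * exp (2 * real N * sumabs (n + 1) x)
     * exp ((\<Sum>k=1..n. exp (x k - y k)) + (\<Sum>k=1..n. exp (y k - x (k + 1))))"
proof -
  have "exp (real N * sumabs n y) = (\<Prod>k=1..n. exp (real N * \<bar>y k\<bar>))"
    by (simp add: sumabs_def sum_distrib_left exp_sum)
  also have "\<dots> \<le> (\<Prod>k=1..n. fact N * exp (real N * (\<bar>x k\<bar> + \<bar>x (k + 1)\<bar>)) * exp (exp (x k - y k) + exp (y k - x (k + 1))))"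
    by (intro prod_mono) (auto intro!: exp_abs_le_double_exp)
  also have "\<dots> = fact N ^ n * exp (real N * (\<Sum>k=1..n. \<bar>x k\<bar> + \<bar>x (k + 1)\<bar>)) * exp ((\<Sum>k=1..n. exp (x k - y k)) + (\<Sum>k=1..n. exp (y k - x (k + 1))))"
    by (simp add: prod.distrib sum_distrib_left exp_sum sum.distrib[symmetric])
  also have "\<dots> \<le> fact N ^ n * exp (2 * real N * sumabs (n + 1) x) * exp ((\<Sum>k=1..n. exp (x k - y k)) + (\<Sum>k=1..n. exp (y k - x (k + 1))))"
  proof -
    have "(\<Sum>k=1..n. \<bar>x (k + 1)\<bar>) = (\<Sum>k=Suc 1..Suc n. \<bar>x k\<bar>)"
      by (subst sum.shift_bounds_cl_Suc_ivl) simp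
    also have "\<dots> \<le> sumabs (n + 1) x" unfolding sumabs_def by (intro sum_mono2) auto
    finally have "(\<Sum>k=1..n. \<bar>x k\<bar> + \<bar>x (k + 1)\<bar>) \<le> 2 * sumabs (n + 1) x"
      using sumabs_mono[of n "n + 1" x] unfolding sum.distrib sumabs_def[of n] by linarith
    then have "real N * (\<Sum>k=1..n. \<bar>x k\<bar> + \<bar>x (k + 1)\<bar>) \<le> real N * (2 * sumabs (n + 1) x)" by (rule mult_left_mono) simp
    then show ?thesis by (intro mult_right_mono mult_left_mono) auto
  qed
  finally show ?thesis .
qed

lemma dominated_exp_growth:
  assumes "exp_growth n f"
  shows "dominated n n lam f"
  unfolding dominated_def
proof
  fix c :: real
  obtain C e where f: "C \<ge> 0" "e \<ge> 0" "\<And>y. y \<in> Rn n \<Longrightarrow> norm (f y) \<le> C * exp (e * sumabs n y)"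
    using assms by (rule exp_growthE) blast
  \<comment> \<open>The summand \<open>1\<close> leaves the weight \<open>exp (- sumabs n y)\<close>.\<close>
  obtain N :: nat where N: "norm lam + e + c + 1 \<le> real N" using real_arch_simple by blast
  have "norm (toda_kernel n n lam x y * f y) * exp (c * sumabs n y)
      \<le> (C * fact N ^ n) * exp ((norm lam + 2 * real N) * sumabs (n + 1) x) * exp (- sumabs n y)"
    if xy: "x \<in> Rn (n + 1)" "y \<in> Rn n" for x y
  proof -
    let ?V = "(\<Sum>k=1..n. exp (x k - y k)) + (\<Sum>k=1..n. exp (y k - x (k + 1)))"
    have "norm (toda_kernel n n lam x y * f y) * exp (c * sumabs n y)
       \<le> exp (norm lam * (sumabs (n + 1) x + sumabs n y) - ?V) * (C * exp (e * sumabs n y)) * exp (c * sumabs n y)"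
      unfolding norm_mult by (intro mult_right_mono mult_mono norm_toda_kernel_le f xy) auto
    also have "\<dots> = C * (exp (norm lam * sumabs (n + 1) x) * exp (- sumabs n y) * exp (- ?V)) * exp ((norm lam + e + c + 1) * sumabs n y)"
      by (simp add: algebra_simps flip: exp_add)
    also have "\<dots> \<le> C * (exp (norm lam * sumabs (n + 1) x) * exp (- sumabs n y) * exp (- ?V)) * exp (real N * sumabs n y)"
      using f(1) N by (intro mult_left_mono) (auto intro!: mult_right_mono)
    also have "\<dots> \<le> C * (exp (norm lam * sumabs (n + 1) x) * exp (- sumabs n y) * exp (- ?V)) * (fact N ^ n * exp (2 * real N * sumabs (n + 1) x) * exp ?V)"
      using f(1) by (intro mult_left_mono recursive_kernel_decay) auto
    also have "\<dots> = (C * fact N ^ n) * exp ((norm lam + 2 * real N) * sumabs (n + 1) x) * exp (- sumabs n y)"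
      by (simp add: algebra_simps flip: exp_add)
    finally show ?thesis .
  qed
  then show "\<exists>C d. \<forall>x\<in>Rn (n + 1). \<forall>y\<in>Rn n. norm (toda_kernel n n lam x y * f y) * exp (c * sumabs n y) \<le> C * exp (d * sumabs (n + 1) x) * exp (- sumabs n y)"
    by blast
qed

lemma tame_imp_paired: "tame.controlled n f \<Longrightarrow> paired.controlled n n lam f"
  unfolding tame.controlled_def paired.controlled_def using dominated_exp_growth by blast

text \<open>
  The Baxter kernel does not bind its last variable from above, so a function that it acts on has to
  supply the decay; bounded support is enough.
\<close>

lemma dominated_bounded_support:
  assumes B: "\<And>y. y \<in> Rn n \<Longrightarrow> norm (f y) \<le> B" and R: "\<And>y. y \<in> Rn n \<Longrightarrow> f y \<noteq> 0 \<Longrightarrow> sumabs n y \<le> R"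
    and mn: "m \<le> n"
  shows "dominated n m lam f"
  unfolding dominated_def
proof
  fix c :: real
  have "norm (toda_kernel n m lam x y * f y) * exp (c * sumabs n y)
      \<le> (B * exp ((norm lam + \<bar>c\<bar> + 1) * R)) * exp (norm lam * sumabs (m + 1) x) * exp (- sumabs n y)"
    if xy: "x \<in> Rn (m + 1)" "y \<in> Rn n" for x y
  proof (cases "f y = 0")
    case True
    then show ?thesis using order_trans[OF norm_ge_zero B[OF xy(2)]] by simp
  next
    case False
    have B0: "B \<ge> 0" using B[OF xy(2)] norm_ge_zero order_trans by blast
    have "(\<Sum>k=1..n. exp (x k - y k)) + (\<Sum>k=1..m. exp (y k - x (k + 1))) \<ge> 0"
      by (intro add_nonneg_nonneg sum_nonneg) auto
    then have "norm (toda_kernel n m lam x y) \<le> exp (norm lam * (sumabs (m + 1) x + sumabs n y))"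
      using norm_toda_kernel_le[OF mn, of lam x y] by (rule_tac order_trans) auto
    then have "norm (toda_kernel n m lam x y * f y) * exp (c * sumabs n y) \<le> exp (norm lam * (sumabs (m + 1) x + sumabs n y)) * B * exp (\<bar>c\<bar> * sumabs n y)"
      unfolding norm_mult using B[OF xy(2)] B0 by (intro mult_mono) (auto intro!: mult_right_mono)
    also have "\<dots> = B * exp ((norm lam + \<bar>c\<bar> + 1) * sumabs n y) * exp (norm lam * sumabs (m + 1) x) * exp (- sumabs n y)"
      by (simp add: algebra_simps flip: exp_add)
    also have "\<dots> \<le> (B * exp ((norm lam + \<bar>c\<bar> + 1) * R)) * exp (norm lam * sumabs (m + 1) x) * exp (- sumabs n y)"
      using R[OF xy(2) False] B0 by (intro mult_right_mono mult_left_mono) (auto intro!: mult_left_mono)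
    finally show ?thesis .
  qed
  then show "\<exists>C d. \<forall>x\<in>Rn (m + 1). \<forall>y\<in>Rn n. norm (toda_kernel n m lam x y * f y) * exp (c * sumabs n y) \<le> C * exp (d * sumabs (m + 1) x) * exp (- sumabs n y)"
    by blast
qed

section \<open>The adjoint of the Toda operator\<close>

lemma exp_poly_tau_adj:
  assumes "m < N" "m \<le> n" "n \<le> N"
  shows "exp_poly N n (\<lambda>x y. tau_adj \<delta> (fwd_factor n x y) (bwd_factor m x y) k)"
proof (induction k rule: less_induct)
  case (less k)
  show ?case
  proof (cases k)
    case (Suc j)
    have "exp_poly N n (\<lambda>x y. (\<delta> - \<i> * fwd_factor n x y (Suc j) + \<i> * bwd_factor m x y (Suc j)) * tau_adj \<delta> (fwd_factor n x y) (bwd_factor m x y) j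
         - bwd_factor m x y j * fwd_factor n x y (Suc j) * tau_adj \<delta> (fwd_factor n x y) (bwd_factor m x y) (j - 1))"
      using assms Suc by (intro exp_poly_diff exp_poly.add exp_poly.mult exp_poly.const exp_poly_fwd_factor exp_poly_bwd_factor less) auto
    then show ?thesis by (simp add: Suc)
  qed (auto intro: exp_poly.const)
qed

lemma factor_upd_y:
  "j \<noteq> k \<Longrightarrow> fwd_factor n x (y(j := s)) k = fwd_factor n x y k"
  "j \<noteq> k \<Longrightarrow> bwd_factor m x (y(j := s)) k = bwd_factor m x y k"
  by (simp_all add: fwd_factor_def bwd_factor_def)

text \<open>
  The derivative in \<open>y i\<close> of \<open>H * toda_kernel * g\<close> integrates to zero, and \<open>\<i>\<close> times it is the difference of the two integrands.
\<close>

lemma integral_by_parts_step: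
  assumes mn: "m \<le> n" "n \<le> m + 1" and g: "paired.controlled n m lam g" and x: "x \<in> Rn (m + 1)"
    and H: "exp_poly (m + 1) n H" and i: "i \<in> {1..n}" and const: "\<And>y s. H x (y(i := s)) = H x y"
  shows "(LINT y|leb n. (\<mu> - lam - \<i> * fwd_factor n x y i + \<i> * bwd_factor m x y i) * H x y * toda_kernel n m lam x y * g y)
       = (LINT y|leb n. H x y * toda_kernel n m lam x y * (\<mu> * g y + \<i> * partial i g y))"
proof -
  let ?K = "toda_kernel n m lam x"
  interpret g: kernel_integral "leb n" g n m lam using kernel_integral_controlled[OF mn g] .
  interpret dg: kernel_integral "leb n" "partial i g" n m lam
    using kernel_integral_controlled[OF mn paired.controlled_partial[OF g i]] .
  let ?F = "\<lambda>y. H x y * ?K y * g y"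
  let ?D = "\<lambda>x y. (- \<i> * lam + fwd_factor n x y i - bwd_factor m x y i) * H x y"
  \<comment> \<open>The derivative of \<open>?F\<close> in \<open>y i\<close>, since \<open>H\<close> is constant in that direction.\<close>
  let ?F' = "\<lambda>y. ?D x y * ?K y * g y + H x y * ?K y * partial i g y"
  have D: "exp_poly (m + 1) n ?D"
    using mn by (intro exp_poly_diff exp_poly.add exp_poly.mult exp_poly.const exp_poly_fwd_factor exp_poly_bwd_factor H) auto
  have E: "exp_poly (m + 1) n (\<lambda>x y. (\<mu> - lam - \<i> * fwd_factor n x y i + \<i> * bwd_factor m x y i) * H x y)"
    using mn by (intro exp_poly_diff exp_poly.add exp_poly.mult exp_poly.const exp_poly_fwd_factor exp_poly_bwd_factor H) auto
  have iD: "integrable (leb n) (\<lambda>y. ?D x y * ?K y * g y)" by (rule g.integrand_integrable[OF D x])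
  have iE: "integrable (leb n) (\<lambda>y. (\<mu> - lam - \<i> * fwd_factor n x y i + \<i> * bwd_factor m x y i) * H x y * ?K y * g y)"
    by (rule g.integrand_integrable[OF E x])
  have iH: "integrable (leb n) (\<lambda>y. H x y * ?K y * partial i g y)" by (rule dg.integrand_integrable[OF H x])
  have iF': "integrable (leb n) ?F'" using iD iH by (rule Bochner_Integration.integrable_add)
  obtain C d where b: "C \<ge> 0" "d \<ge> 0" "\<And>x y. x \<in> Rn (m + 1) \<Longrightarrow> y \<in> space (leb n) \<Longrightarrow>
     norm (H x y * toda_kernel n m lam x y * g y) \<le> C * exp (d * sumabs (m + 1) x) * exp (- sumabs n y)"
    by (rule g.integrand_bound[OF H]) blast
  have "(LINT y|leb n. ?F' y) = 0"
  proof (rule integral_partial_eq_0[OF i _ iF'])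
    fix y assume y: "y \<in> Rn n"
    have K: "((\<lambda>s. H x y * ?K (y(i := s))) has_vector_derivative H x y * (?K y * (- \<i> * lam + fwd_factor n x y i - bwd_factor m x y i))) (at (y i))"
      by (intro has_vector_derivative_mult_right toda_kernel_deriv_y i)
    show "((\<lambda>s. ?F (y(i := s))) has_vector_derivative ?F' y) (at (y i))"
      using has_vector_derivative_mult[OF K paired.controlled_has_partial[OF g i y]] unfolding const
      by (simp add: algebra_simps)
    show "norm (?F y) \<le> C * exp (d * sumabs (m + 1) x) * exp (- sumabs n y)"
      using b(3)[OF x] y by simp
  qed
  then have "(LINT y|leb n. (\<mu> - lam - \<i> * fwd_factor n x y i + \<i> * bwd_factor m x y i) * H x y * ?K y * g y)
     = (LINT y|leb n. (\<mu> - lam - \<i> * fwd_factor n x y i + \<i> * bwd_factor m x y i) * H x y * ?K y * g y) + \<i> * (LINT y|leb n. ?F' y)"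
    by simp
  also have "\<dots> = (LINT y|leb n. (\<mu> - lam - \<i> * fwd_factor n x y i + \<i> * bwd_factor m x y i) * H x y * ?K y * g y + \<i> * ?F' y)"
    using Bochner_Integration.integral_add[OF iE integrable_mult_right[OF iF', of \<i>]]
    by (simp only: integral_mult_right_zero)
  also have "\<dots> = (LINT y|leb n. H x y * ?K y * (\<mu> * g y + \<i> * partial i g y))"
    by (intro Bochner_Integration.integral_cong refl) (simp add: algebra_simps mult.assoc[of \<i> \<i>, symmetric])
  finally show ?thesis .
qed

text \<open>
  The weight \<open>H\<close> makes the induction work: it collects the factors from the variables beyond \<open>k\<close>, which commute with the operator of
  index \<open>k\<close>. Each step removes the last factor of the operator by one integration by parts.
\<close>

theorem toda_T_adjoint:
  assumes mn: "m \<le> n" "n \<le> m + 1" and f: "paired.controlled n m lam f" and x: "x \<in> Rn (m + 1)"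
  shows "k \<le> n \<Longrightarrow> exp_poly (m + 1) n H \<Longrightarrow> (\<And>j y s. j \<in> {1..k} \<Longrightarrow> H x (y(j := s)) = H x y) \<Longrightarrow>
     (LINT y|leb n. tau_adj (\<mu> - lam) (fwd_factor n x y) (bwd_factor m x y) k * H x y * toda_kernel n m lam x y * f y)
       = (LINT y|leb n. H x y * toda_kernel n m lam x y * toda_T \<mu> k f y)"
proof (induction k arbitrary: H rule: less_induct)
  case (less k)
  let ?K = "toda_kernel n m lam x"
  let ?A = "\<lambda>y. fwd_factor n x y" and ?B = "\<lambda>y. bwd_factor m x y"
  let ?t = "\<lambda>k x y. tau_adj (\<mu> - lam) (fwd_factor n x y) (bwd_factor m x y) k"
  show ?case
  proof (cases k)
    case 0
    then show ?thesis by simp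
  next
    case (Suc j)
    have i: "Suc j \<in> {1..n}" using less(2) Suc by auto
    have Tj: "paired.controlled n m lam (toda_T \<mu> j f)" and Tj': "paired.controlled n m lam (toda_T \<mu> (j - 1) f)"
      using less(2) Suc by (auto intro!: paired.controlled_toda_T f)
    interpret f: kernel_integral "leb n" f n m lam using kernel_integral_controlled[OF mn f] .
    interpret Tj: kernel_integral "leb n" "toda_T \<mu> j f" n m lam using kernel_integral_controlled[OF mn Tj] .
    interpret Tj': kernel_integral "leb n" "toda_T \<mu> (j - 1) f" n m lam using kernel_integral_controlled[OF mn Tj'] .
    interpret dTj: kernel_integral "leb n" "partial (Suc j) (toda_T \<mu> j f)" n m lam
      using kernel_integral_controlled[OF mn paired.controlled_partial[OF Tj i]] .
    let ?H1 = "\<lambda>x y. (\<mu> - lam - \<i> * fwd_factor n x y (Suc j) + \<i> * bwd_factor m x y (Suc j)) * H x y"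
    let ?H2 = "\<lambda>x y. bwd_factor m x y j * fwd_factor n x y (Suc j) * H x y"
    have ep: "exp_poly (m + 1) n ?H1" "exp_poly (m + 1) n ?H2" and t: "exp_poly (m + 1) n (?t k)" for k
      using mn less(3) by (auto intro!: exp_poly_diff exp_poly.add exp_poly.mult exp_poly.const exp_poly_fwd_factor exp_poly_bwd_factor exp_poly_tau_adj)
    have IH1: "(LINT y|leb n. ?t j x y * ?H1 x y * ?K y * f y) = (LINT y|leb n. ?H1 x y * ?K y * toda_T \<mu> j f y)"
      using less(2) Suc by (intro less.IH ep) (auto simp: less(4) factor_upd_y simp del: fun_upd_apply)
    have IH2: "(LINT y|leb n. ?t (j - 1) x y * ?H2 x y * ?K y * f y) = (LINT y|leb n. ?H2 x y * ?K y * toda_T \<mu> (j - 1) f y)"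
      using less(2) Suc by (intro less.IH ep) (auto simp: less(4) factor_upd_y simp del: fun_upd_apply)
    have step: "(LINT y|leb n. ?H1 x y * ?K y * toda_T \<mu> j f y)
        = (LINT y|leb n. H x y * ?K y * (\<mu> * toda_T \<mu> j f y + \<i> * partial (Suc j) (toda_T \<mu> j f) y))"
      by (rule integral_by_parts_step[OF mn Tj x less(3) i]) (use less(4) Suc in auto)
    have i1: "integrable (leb n) (\<lambda>y. ?t j x y * ?H1 x y * ?K y * f y)" and i2: "integrable (leb n) (\<lambda>y. ?t (j - 1) x y * ?H2 x y * ?K y * f y)"
      by (rule f.integrand_integrable[OF exp_poly.mult[OF t] x], fact ep)+
    have i3: "integrable (leb n) (\<lambda>y. H x y * ?K y * (\<mu> * toda_T \<mu> j f y + \<i> * partial (Suc j) (toda_T \<mu> j f) y))"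
    proof -
      have "integrable (leb n) (\<lambda>y. \<mu> * (H x y * ?K y * toda_T \<mu> j f y) + \<i> * (H x y * ?K y * partial (Suc j) (toda_T \<mu> j f) y))"
        by (intro Bochner_Integration.integrable_add integrable_mult_right Tj.integrand_integrable dTj.integrand_integrable less(3) x)
      then show ?thesis by (simp add: algebra_simps)
    qed
    have i4: "integrable (leb n) (\<lambda>y. ?H2 x y * ?K y * toda_T \<mu> (j - 1) f y)"
      by (rule Tj'.integrand_integrable[OF ep(2) x])
    have "(LINT y|leb n. ?t k x y * H x y * ?K y * f y) = (LINT y|leb n. ?t j x y * ?H1 x y * ?K y * f y - ?t (j - 1) x y * ?H2 x y * ?K y * f y)"
      by (intro Bochner_Integration.integral_cong refl) (simp only: Suc tau_adj.simps algebra_simps)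
    also have "\<dots> = (LINT y|leb n. H x y * ?K y * (\<mu> * toda_T \<mu> j f y + \<i> * partial (Suc j) (toda_T \<mu> j f) y)) - (LINT y|leb n. ?H2 x y * ?K y * toda_T \<mu> (j - 1) f y)"
      using Bochner_Integration.integral_diff[OF i1 i2] IH1 IH2 step by simp
    also have "\<dots> = (LINT y|leb n. H x y * ?K y * (\<mu> * toda_T \<mu> j f y + \<i> * partial (Suc j) (toda_T \<mu> j f) y) - ?H2 x y * ?K y * toda_T \<mu> (j - 1) f y)"
      by (rule Bochner_Integration.integral_diff[OF i3 i4, symmetric])
    also have "\<dots> = (LINT y|leb n. H x y * ?K y * toda_T \<mu> k f y)"
    proof (intro Bochner_Integration.integral_cong refl)
      fix y
      have "bond j y = bwd_factor m x y j * fwd_factor n x y (Suc j)"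
        using less(2) Suc mn by (subst fwd_bwd_bond_y) auto
      then show "H x y * ?K y * (\<mu> * toda_T \<mu> j f y + \<i> * partial (Suc j) (toda_T \<mu> j f) y) - ?H2 x y * ?K y * toda_T \<mu> (j - 1) f y = H x y * ?K y * toda_T \<mu> k f y"
        unfolding Suc toda_T.simps by (simp only: diff_Suc_1) (simp only: algebra_simps)
    qed
    finally show ?thesis .
  qed
qed

text \<open>The forward factor of index \<open>n + 1\<close> is absent from the recursive kernel.\<close>

corollary toda_T_recursive_integral:
  assumes f: "paired.controlled n n lam f" and x: "x \<in> Rn (n + 1)"
  shows "toda_T \<mu> (n + 1) (\<lambda>x. LINT y|leb n. toda_kernel n n lam x y * f y) x
       = (\<mu> - lam) * (LINT y|leb n. toda_kernel n n lam x y * toda_T \<mu> n f y)"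
proof -
  interpret kernel_integral "leb n" f n n lam using f by (intro kernel_integral_controlled) auto
  have G1: "(\<lambda>x. LINT y|leb n. toda_kernel n n lam x y * f y) = G (\<lambda>_ _. 1)" by (intro ext) (simp only: G_def mult_1)
  have "toda_T \<mu> (n + 1) (G (\<lambda>_ _. 1)) x = (LINT y|leb n. tau (\<mu> - lam) (fwd_factor n x y) (bwd_factor n x y) (n + 1) * toda_kernel n n lam x y * f y)"
    by (simp only: toda_T_G[OF order_refl x] G_def)
  also have "\<dots> = (LINT y|leb n. (\<mu> - lam) * (tau_adj (\<mu> - lam) (fwd_factor n x y) (bwd_factor n x y) n * 1 * toda_kernel n n lam x y * f y))"
  proof (intro Bochner_Integration.integral_cong refl)
    fix y
    have "tau (\<mu> - lam) (fwd_factor n x y) (bwd_factor n x y) (n + 1) = (\<mu> - lam) * tau_adj (\<mu> - lam) (fwd_factor n x y) (bwd_factor n x y) n"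
    proof -
      have B: "bwd_factor n x y 0 = 0" and A: "fwd_factor n x y (Suc n) = 0"
        by (simp_all add: bwd_factor_def fwd_factor_def)
      show ?thesis
        unfolding Suc_eq_plus1[symmetric] tau_tau_adj[where B="bwd_factor n x y", OF B, THEN conjunct1] A by simp
    qed
    then show "tau (\<mu> - lam) (fwd_factor n x y) (bwd_factor n x y) (n + 1) * toda_kernel n n lam x y * f y
       = (\<mu> - lam) * (tau_adj (\<mu> - lam) (fwd_factor n x y) (bwd_factor n x y) n * 1 * toda_kernel n n lam x y * f y)" by (simp only: mult_1_right mult.assoc)
  qed
  also have "\<dots> = (\<mu> - lam) * (LINT y|leb n. 1 * toda_kernel n n lam x y * toda_T \<mu> n f y)"
    using toda_T_adjoint[OF _ _ f x, where k=n and H="\<lambda>_ _. 1" and \<mu>=\<mu>] by (simp add: exp_poly.const)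
  finally show ?thesis unfolding G1 by simp
qed

text \<open>The backward factor of index \<open>l + 1\<close> is absent from the Baxter kernel.\<close>

corollary toda_T_baxter_integral:
  assumes f: "paired.controlled (l + 1) l lam f" and x: "x \<in> Rn (l + 1)"
  shows "toda_T \<mu> (l + 1) (\<lambda>x. LINT y|leb (l + 1). toda_kernel (l + 1) l lam x y * f y) x
       = (LINT y|leb (l + 1). toda_kernel (l + 1) l lam x y * toda_T \<mu> (l + 1) f y)"
    and "tame.controlled (l + 1) (\<lambda>x. LINT y|leb (l + 1). toda_kernel (l + 1) l lam x y * f y)"
proof -
  interpret kernel_integral "leb (l + 1)" f "l + 1" l lam using f by (intro kernel_integral_controlled) auto
  have G1: "(\<lambda>x. LINT y|leb (l + 1). toda_kernel (l + 1) l lam x y * f y) = G (\<lambda>_ _. 1)" by (intro ext) (simp only: G_def mult_1)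
  show "tame.controlled (l + 1) (\<lambda>x. LINT y|leb (l + 1). toda_kernel (l + 1) l lam x y * f y)"
    unfolding G1 by (intro G_tame exp_poly.const)
  have "toda_T \<mu> (l + 1) (G (\<lambda>_ _. 1)) x = (LINT y|leb (l + 1). tau (\<mu> - lam) (fwd_factor (l + 1) x y) (bwd_factor l x y) (l + 1) * toda_kernel (l + 1) l lam x y * f y)"
    by (simp only: toda_T_G[OF order_refl x] G_def)
  also have "\<dots> = (LINT y|leb (l + 1). tau_adj (\<mu> - lam) (fwd_factor (l + 1) x y) (bwd_factor l x y) (l + 1) * 1 * toda_kernel (l + 1) l lam x y * f y)"
  proof (intro Bochner_Integration.integral_cong refl)
    fix y
    have "tau_adj (\<mu> - lam) (fwd_factor (l + 1) x y) (bwd_factor l x y) (l + 1) = tau (\<mu> - lam) (fwd_factor (l + 1) x y) (bwd_factor l x y) (l + 1)"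
    proof -
      have B: "bwd_factor l x y 0 = 0" and B': "bwd_factor l x y (Suc l) = 0"
        by (simp_all add: bwd_factor_def)
      show ?thesis
        unfolding Suc_eq_plus1[symmetric] tau_tau_adj[where B="bwd_factor l x y", OF B, THEN conjunct2] B' by simp
    qed
    then show "tau (\<mu> - lam) (fwd_factor (l + 1) x y) (bwd_factor l x y) (l + 1) * toda_kernel (l + 1) l lam x y * f y
       = tau_adj (\<mu> - lam) (fwd_factor (l + 1) x y) (bwd_factor l x y) (l + 1) * 1 * toda_kernel (l + 1) l lam x y * f y" by (simp only: mult_1_right)
  qed
  also have "\<dots> = (LINT y|leb (l + 1). 1 * toda_kernel (l + 1) l lam x y * toda_T \<mu> (l + 1) f y)"
    by (intro toda_T_adjoint f x exp_poly.const) auto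
  finally show "toda_T \<mu> (l + 1) (\<lambda>x. LINT y|leb (l + 1). toda_kernel (l + 1) l lam x y * f y) x
       = (LINT y|leb (l + 1). toda_kernel (l + 1) l lam x y * toda_T \<mu> (l + 1) f y)" unfolding G1 by simp
qed

theorem toda_T_baxter_kernel:
  assumes x: "x \<in> Rn (l + 1)"
  shows "toda_T lam (l + 1) (\<lambda>z. toda_kernel (l + 1) l lam z y) x
       = (- \<i>) ^ (l + 1) * toda_kernel (l + 1) l (lam - \<i>) x y"
    and "tame.controlled (l + 1) (\<lambda>z. toda_kernel (l + 1) l lam z y)"
proof -
  \<comment> \<open>Integration against the point measure at \<open>y\<close> returns the kernel.\<close>
  interpret kernel_integral "count_space {y}" "\<lambda>_. 1" "l + 1" l lam
  proof
    fix c :: real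
    have "norm (toda_kernel (l + 1) l lam x y' * 1) * exp (c * sumabs (l + 1) y')
       \<le> exp ((norm lam + c + 1) * sumabs (l + 1) y) * exp (norm lam * sumabs (l + 1) x) * exp (- sumabs (l + 1) y')"
      if "y' \<in> {y}" for x y'
    proof -
      have "(\<Sum>k=1..l+1. exp (x k - y k)) + (\<Sum>k=1..l. exp (y k - x (k + 1))) \<ge> 0"
        by (intro add_nonneg_nonneg sum_nonneg) auto
      then have "norm (toda_kernel (l + 1) l lam x y) \<le> exp (norm lam * (sumabs (l + 1) x + sumabs (l + 1) y))"
        using norm_toda_kernel_le[of l "l + 1" lam x y] by (rule_tac order_trans) auto
      then have "norm (toda_kernel (l + 1) l lam x y) * exp (c * sumabs (l + 1) y) \<le> exp (norm lam * (sumabs (l + 1) x + sumabs (l + 1) y)) * exp (c * sumabs (l + 1) y)"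
        by (rule mult_right_mono) simp
      then show ?thesis using that by (simp add: algebra_simps flip: exp_add)
    qed
    then show "\<exists>C d. \<forall>x\<in>Rn (l + 1). \<forall>y'\<in>space (count_space {y}). norm (toda_kernel (l + 1) l lam x y' * 1) * exp (c * sumabs (l + 1) y')
       \<le> C * exp (d * sumabs (l + 1) x) * exp (- sumabs (l + 1) y')" by (metis space_count_space)
  qed (auto intro!: integrable_count_space)
  have GP: "G P x = P x y * toda_kernel (l + 1) l lam x y" for P x
    unfolding G_def by (subst lebesgue_integral_count_space_finite) auto
  have G1: "(\<lambda>z. toda_kernel (l + 1) l lam z y) = G (\<lambda>_ _. 1)" by (intro ext) (simp only: GP mult_1)
  show "tame.controlled (l + 1) (\<lambda>z. toda_kernel (l + 1) l lam z y)"
    unfolding G1 by (intro G_tame exp_poly.const)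
  have "toda_T lam (l + 1) (\<lambda>z. toda_kernel (l + 1) l lam z y) x
     = tau 0 (fwd_factor (l + 1) x y) (bwd_factor l x y) (l + 1) * toda_kernel (l + 1) l lam x y"
    unfolding G1 by (simp only: toda_T_G[OF order_refl x] GP diff_self)
  also have "\<dots> = (- \<i>) ^ (l + 1) * (exp (of_real ((\<Sum>i=1..l+1. x i) - (\<Sum>i=1..l+1. y i))) * toda_kernel (l + 1) l lam x y)"
  proof -
    have "(\<Prod>j=1..l+1. fwd_factor (l + 1) x y j) = (\<Prod>j=1..l+1. of_real (exp (x j - y j)))"
      by (intro prod.cong) (auto simp: fwd_factor_def)
    also have "\<dots> = exp (of_real ((\<Sum>i=1..l+1. x i) - (\<Sum>i=1..l+1. y i)))"
      unfolding sum_subtractf[symmetric] of_real_prod[symmetric] exp_sum[OF finite_atLeastAtMost, symmetric] by (simp only: exp_of_real)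
    finally show ?thesis by (subst tau_zero) (auto simp: bwd_factor_def)
  qed
  also have "exp (of_real ((\<Sum>i=1..l+1. x i) - (\<Sum>i=1..l+1. y i))) * toda_kernel (l + 1) l lam x y = toda_kernel (l + 1) l (lam - \<i>) x y"
  proof -
    have "S + (\<i> * lam * S - V) = \<i> * (lam - \<i>) * S - V" for S V by (simp add: algebra_simps)
    then show ?thesis unfolding toda_kernel_def exp_add[symmetric] by (simp only:)
  qed
  finally show "toda_T lam (l + 1) (\<lambda>z. toda_kernel (l + 1) l lam z y) x = (- \<i>) ^ (l + 1) * toda_kernel (l + 1) l (lam - \<i>) x y" .
qed

section \<open>Whittaker functions by recursion\<close>

text \<open>
  The Givental integral with its rows integrated one after the other. Starting from \<open>0\<close> rows makes the
  recursion uniform: the kernel for \<open>n = 0\<close> is a plane wave in one variable.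
\<close>

fun psi :: "nat \<Rightarrow> (nat \<Rightarrow> complex) \<Rightarrow> cfun" where
  "psi 0 lam = (\<lambda>x. 1)"
| "psi (Suc n) lam = (\<lambda>x. LINT y|leb n. toda_kernel n n (lam (Suc n)) x y * psi n lam y)"

lemma psi_tame: "tame.controlled n (psi n lam)"
proof (induction n)
  case 0
  show ?case
    unfolding tame.controlled_def smooth_def by (auto simp: exp_growth_def intro!: exI[of _ 1])
next
  case (Suc n)
  interpret kernel_integral "leb n" "psi n lam" n n "lam (Suc n)"
    using tame_imp_paired[OF Suc] by (intro kernel_integral_controlled) auto
  have "psi (Suc n) lam = G (\<lambda>_ _. 1)" by (intro ext) (simp only: psi.simps G_def mult_1)
  then show ?case using G_tame[OF exp_poly.const] by (simp add: tame.controlled_def)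
qed

lemma toda_T_psi:
  "x \<in> Rn n \<Longrightarrow> toda_T \<mu> n (psi n lam) x = (\<Prod>j=1..n. \<mu> - lam j) * psi n lam x"
proof (induction n arbitrary: x)
  case (Suc n)
  have "toda_T \<mu> (n + 1) (psi (Suc n) lam) x
      = (\<mu> - lam (Suc n)) * (LINT y|leb n. toda_kernel n n (lam (Suc n)) x y * toda_T \<mu> n (psi n lam) y)"
    unfolding psi.simps using Suc.prems tame_imp_paired[OF psi_tame]
    by (intro toda_T_recursive_integral) auto
  also have "(LINT y|leb n. toda_kernel n n (lam (Suc n)) x y * toda_T \<mu> n (psi n lam) y)
      = (LINT y|leb n. (\<Prod>j=1..n. \<mu> - lam j) * (toda_kernel n n (lam (Suc n)) x y * psi n lam y))"
    by (intro Bochner_Integration.integral_cong refl) (simp add: Suc.IH)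
  finally show ?case by (simp del: toda_T.simps)
qed simp

section \<open>Real spectral parameters\<close>

definition givental_real :: "nat \<Rightarrow> (nat \<Rightarrow> real) \<Rightarrow> (nat \<times> nat \<Rightarrow> real) \<Rightarrow> real" where
  "givental_real n a X =
     exp ((\<Sum>k=1..n. a k * ((\<Sum>i=1..k. X (k, i)) - (\<Sum>i=1..k-1. X (k - 1, i))))
          - (\<Sum>k=1..<n. \<Sum>i=1..k. exp (X (k + 1, i) - X (k, i)) + exp (X (k, i) - X (k + 1, i + 1))))"

definition toda_kernel_real :: "nat \<Rightarrow> real \<Rightarrow> (nat \<Rightarrow> real) \<Rightarrow> (nat \<Rightarrow> real) \<Rightarrow> real" where
  "toda_kernel_real n a x y = exp (a * ((\<Sum>i=1..n+1. x i) - (\<Sum>i=1..n. y i))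
     - ((\<Sum>k=1..n. exp (x k - y k)) + (\<Sum>k=1..n. exp (y k - x (k + 1)))))"

definition bottom_row :: "nat \<Rightarrow> (nat \<Rightarrow> real) \<Rightarrow> (nat \<times> nat \<Rightarrow> real) \<Rightarrow> (nat \<times> nat \<Rightarrow> real)" where
  "bottom_row n x T = (\<lambda>(k, i). if k = n then x i else T (k, i))"

lemma givental_integrand_real:
  "givental_integrand n (\<lambda>k. - \<i> * of_real (a k)) X = of_real (givental_real n a X)"
proof -
  have "\<i> * (\<Sum>k=1..n. (- \<i> * of_real (a k)) * of_real ((\<Sum>i=1..k. X (k, i)) - (\<Sum>i=1..k-1. X (k - 1, i))))
     = of_real (\<Sum>k=1..n. a k * ((\<Sum>i=1..k. X (k, i)) - (\<Sum>i=1..k-1. X (k - 1, i))))"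
    unfolding sum_distrib_left of_real_sum by (intro sum.cong refl) (simp add: mult.assoc[symmetric])
  then show ?thesis
    unfolding givental_integrand_def givental_real_def by (simp only: exp_of_real[symmetric] of_real_diff)
qed

lemma toda_kernel_real_eq: "toda_kernel n n (- \<i> * of_real a) x y = of_real (toda_kernel_real n a x y)"
proof -
  have "\<i> * (- \<i> * of_real a) * of_real S - of_real V = complex_of_real (a * S - V)" for S V
    by (simp add: mult.assoc[symmetric])
  then show ?thesis
    unfolding toda_kernel_def toda_kernel_real_def by (simp only: exp_of_real)
qed

lemma givental_real_cong:
  "(\<And>k i. 1 \<le> i \<Longrightarrow> i \<le> k \<Longrightarrow> k \<le> n \<Longrightarrow> X (k, i) = Y (k, i)) \<Longrightarrow> givental_real n a X = givental_real n a Y"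
  unfolding givental_real_def by (intro arg_cong[where f=exp] arg_cong2[where f="(-)"] arg_cong2[where f="(+)"] arg_cong2[where f="(*)"] sum.cong refl) auto

lemma givental_real_Suc:
  "givental_real (Suc n) a X = toda_kernel_real n (a (Suc n)) (\<lambda>i. X (Suc n, i)) (\<lambda>i. X (n, i)) * givental_real n a X"
proof (cases n)
  case 0
  then show ?thesis by (simp add: givental_real_def toda_kernel_real_def)
next
  case (Suc m)
  have "(\<Sum>k=1..<Suc n. \<Sum>i=1..k. exp (X (k + 1, i) - X (k, i)) + exp (X (k, i) - X (k + 1, i + 1)))
    = (\<Sum>k=1..<n. \<Sum>i=1..k. exp (X (k + 1, i) - X (k, i)) + exp (X (k, i) - X (k + 1, i + 1)))
     + ((\<Sum>i=1..n. exp (X (Suc n, i) - X (n, i))) + (\<Sum>i=1..n. exp (X (n, i) - X (Suc n, i + 1))))"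
    using Suc by (subst sum.atLeastLessThan_Suc) (auto simp: sum.distrib)
  then show ?thesis
    unfolding givental_real_def toda_kernel_real_def exp_add[symmetric]
    by (intro arg_cong[where f=exp]) simp
qed

lemma triangle_finite: "finite (triangle n)"
  by (rule finite_subset[of _ "{..n} \<times> {..n}"]) (auto simp: triangle_def)

text \<open>
  For imaginary spectral parameters the Givental integrand is positive. As an extended nonnegative integral, the Whittaker function can
  be rearranged by Tonelli before its finiteness is known. Here \<open>a\<close> is \<open>\<i>\<close> times the spectral parameter.
\<close>

definition wp :: "nat \<Rightarrow> (nat \<Rightarrow> real) \<Rightarrow> (nat \<Rightarrow> real) \<Rightarrow> ennreal" where
  "wp n a x = (\<integral>\<^sup>+T. ennreal (givental_real n a (bottom_row n x T)) \<partial>PiM (triangle (n - 1)) (\<lambda>_. lborel))"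

lemma wp_0: "wp 0 a x = 1"
proof -
  have "triangle 0 = {}" by (auto simp: triangle_def)
  then show ?thesis by (simp add: wp_def givental_real_def space_PiM_empty)
qed

lemma givental_real_measurable:
  "(\<lambda>T. givental_real (Suc n) a (bottom_row (Suc n) x T)) \<in> borel_measurable (PiM (triangle n) (\<lambda>_. lborel))"
proof -
  have c: "(\<lambda>T. bottom_row (Suc n) x T (k, i)) \<in> borel_measurable (PiM (triangle n) (\<lambda>_. lborel))"
    if "1 \<le> i \<and> i \<le> k \<and> k \<le> Suc n" for k i
  proof (cases "k = Suc n")
    case False
    then have "(k, i) \<in> triangle n" using that by (auto simp: triangle_def)
    from measurable_component_singleton[OF this, of "\<lambda>_. lborel :: real measure"] show ?thesis
      using False by (simp add: bottom_row_def)
  qed (simp add: bottom_row_def)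
  show ?thesis
    unfolding givental_real_def
    by (intro borel_measurable_exp_comp borel_measurable_diff borel_measurable_add borel_measurable_times
      borel_measurable_sum borel_measurable_const c) auto
qed

text \<open>The last row of the triangle is split off and becomes the point \<open>y\<close>.\<close>

lemma wp_Suc:
  assumes m: "wp n a \<in> borel_measurable (leb n)"
  shows "wp (Suc n) a x = (\<integral>\<^sup>+y. ennreal (toda_kernel_real n (a (Suc n)) x y) * wp n a y \<partial>leb n)"
proof -
  let ?row = "(\<lambda>i. (n, i)) ` {1..n}"
  let ?J = "triangle (n - 1)"
  let ?M = "\<lambda>I. PiM I (\<lambda>_::nat \<times> nat. lborel :: real measure)"
  let ?y = "\<lambda>r::nat \<times> nat \<Rightarrow> real. \<lambda>i\<in>{1..n}. 1 * r (n, i) + 0"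
  let ?f = "\<lambda>T. ennreal (givental_real (Suc n) a (bottom_row (Suc n) x T))"
  have tri: "triangle n = ?row \<union> ?J" by (auto simp: triangle_def image_iff)
  have disj: "?row \<inter> ?J = {}" by (auto simp: triangle_def)
  have "wp (Suc n) a x = (\<integral>\<^sup>+T. ?f T \<partial>?M (?row \<union> ?J))"
    by (simp add: wp_def tri)
  also have "\<dots> = (\<integral>\<^sup>+r. \<integral>\<^sup>+T. ?f (merge ?row ?J (r, T)) \<partial>?M ?J \<partial>?M ?row)"
    using givental_real_measurable[of n a x] unfolding tri
    by (intro lborel_prod.product_nn_integral_fold disj triangle_finite) auto
  also have "\<dots> = (\<integral>\<^sup>+r. ennreal (toda_kernel_real n (a (Suc n)) x (?y r)) * wp n a (?y r) \<partial>?M ?row)"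
  proof (rule nn_integral_cong)
    fix r
    have "?f (merge ?row ?J (r, T)) = ennreal (toda_kernel_real n (a (Suc n)) x (?y r)) * ennreal (givental_real n a (bottom_row n (?y r) T))" for T
    proof -
      let ?X = "bottom_row (Suc n) x (merge ?row ?J (r, T))"
      have 1: "givental_real n a ?X = givental_real n a (bottom_row n (?y r) T)"
        by (rule givental_real_cong) (auto simp: bottom_row_def merge_def triangle_def)
      have 2: "toda_kernel_real n (a (Suc n)) (\<lambda>i. ?X (Suc n, i)) (\<lambda>i. ?X (n, i)) = toda_kernel_real n (a (Suc n)) x (?y r)"
        unfolding toda_kernel_real_def
        by (intro arg_cong[where f=exp] arg_cong2[where f="(-)"] arg_cong2[where f="(+)"] arg_cong2[where f="(*)"] sum.cong refl)
          (auto simp: bottom_row_def merge_def)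
      show ?thesis unfolding givental_real_Suc 1 2 by (rule ennreal_mult) (auto simp: toda_kernel_real_def givental_real_def)
    qed
    moreover have "(\<lambda>T. ennreal (givental_real n a (bottom_row n (?y r) T))) \<in> borel_measurable (?M ?J)"
    proof (cases n)
      case 0
      then show ?thesis by (simp add: givental_real_def)
    next
      case (Suc m)
      then show ?thesis using givental_real_measurable[of m a "?y r"] by simp
    qed
    ultimately show "(\<integral>\<^sup>+T. ?f (merge ?row ?J (r, T)) \<partial>?M ?J) = ennreal (toda_kernel_real n (a (Suc n)) x (?y r)) * wp n a (?y r)"
      unfolding wp_def by (simp only: nn_integral_cmult)
  qed
  also have "\<dots> = (\<integral>\<^sup>+y. ennreal (toda_kernel_real n (a (Suc n)) x y) * wp n a y \<partial>PiM {1..n} (\<lambda>_. lborel))"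
  proof (rule nn_integral_PiM_lborel_coordinatewise)
    show "bij_betw (\<lambda>i. (n, i)) {1..n} ?row" by (auto simp: bij_betw_def inj_on_def)
    have "toda_kernel_real n (a (Suc n)) x \<in> borel_measurable (leb n)"
      unfolding toda_kernel_real_def
      by (intro leb_measurable_intros) auto
    then show "(\<lambda>y. ennreal (toda_kernel_real n (a (Suc n)) x y) * wp n a y) \<in> borel_measurable (PiM {1..n} (\<lambda>_. lborel))"
      using m unfolding leb_def by (intro borel_measurable_times_ennreal) auto
  qed auto
  finally show ?thesis by (simp add: leb_def)
qed

lemma psi_real:
  fixes a :: "nat \<Rightarrow> real"
  defines "lam \<equiv> \<lambda>k. - \<i> * of_real (a k)"
  shows "x \<in> Rn n \<Longrightarrow> psi n lam x = of_real (Re (psi n lam x)) \<and> Re (psi n lam x) \<ge> 0 \<and> wp n a x = ennreal (Re (psi n lam x))"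
proof (induction n arbitrary: x)
  case 0
  then show ?case by (simp add: wp_0)
next
  case (Suc n)
  let ?r = "\<lambda>y. Re (psi n lam y)"
  let ?k = "toda_kernel_real n (a (Suc n)) x"
  have cont: "continuous_on (Rn n) ?r"
    using tame.controlled_continuous[OF psi_tame[of n lam]] by (intro continuous_intros)
  have rm: "?r \<in> borel_measurable (leb n)"
    using borel_measurable_leb_continuous[OF tame.controlled_continuous[OF psi_tame[of n lam]]] by simp
  have wm: "wp n a \<in> borel_measurable (leb n)"
    by (rule measurable_cong[THEN iffD2, of _ _ "\<lambda>y. ennreal (?r y)"]) (use rm Suc.IH in auto)
  interpret kernel_integral "leb n" "psi n lam" n n "lam (Suc n)"
    using tame_imp_paired[OF psi_tame] by (intro kernel_integral_controlled) auto
  have eq: "toda_kernel n n (lam (Suc n)) x y * psi n lam y = of_real (?k y * ?r y)" if "y \<in> Rn n" for y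
  proof -
    have "psi n lam y = of_real (?r y)" using Suc.IH[OF that] by blast
    then show ?thesis unfolding lam_def toda_kernel_real_eq of_real_mult by (simp only: lam_def)
  qed
  have "integrable (leb n) (\<lambda>y. toda_kernel n n (lam (Suc n)) x y * psi n lam y)"
    using integrand_integrable[OF exp_poly.const[where c=1]] Suc.prems by simp
  then have "integrable (leb n) (\<lambda>y. complex_of_real (?k y * ?r y))"
    by (subst (asm) Bochner_Integration.integrable_cong[OF refl eq]) auto
  then have i: "integrable (leb n) (\<lambda>y. ?k y * ?r y)" by (simp only: complex_of_real_integrable_eq)
  have nn: "?k y * ?r y \<ge> 0" if "y \<in> Rn n" for y
    using Suc.IH[OF that] by (simp add: toda_kernel_real_def)
  have psi: "psi (Suc n) lam x = of_real (LINT y|leb n. ?k y * ?r y)"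
    unfolding psi.simps using Bochner_Integration.integral_cong[OF refl eq, of "leb n"] integral_complex_of_real
    by (simp del: of_real_mult)
  have "wp (Suc n) a x = (\<integral>\<^sup>+y. ennreal (?k y) * wp n a y \<partial>leb n)" by (rule wp_Suc[OF wm])
  also have "\<dots> = (\<integral>\<^sup>+y. ennreal (?k y * ?r y) \<partial>leb n)"
    using Suc.IH by (intro nn_integral_cong) (auto simp: ennreal_mult toda_kernel_real_def)
  also have "\<dots> = ennreal (LINT y|leb n. ?k y * ?r y)"
    using nn by (intro nn_integral_eq_integral i AE_I2) auto
  finally have w: "wp (Suc n) a x = ennreal (LINT y|leb n. ?k y * ?r y)" .
  have "(LINT y|leb n. ?k y * ?r y) \<ge> 0" using nn by (intro Bochner_Integration.integral_nonneg) auto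
  then show ?case unfolding psi w by simp
qed

theorem whittaker_eq_psi:
  fixes a :: "nat \<Rightarrow> real"
  defines "lam \<equiv> \<lambda>k. - \<i> * of_real (a k)"
  assumes x: "x \<in> Rn (Suc n)"
  shows "whittaker (Suc n) lam x = psi (Suc n) lam x"
proof -
  let ?M = "PiM (triangle n) (\<lambda>_::nat \<times> nat. lborel :: real measure)"
  let ?g = "\<lambda>T. givental_real (Suc n) a (bottom_row (Suc n) x T)"
  have "whittaker (Suc n) lam x = (LINT T|?M. of_real (?g T))"
    unfolding whittaker_def lam_def givental_integrand_real bottom_row_def by simp
  also have "\<dots> = of_real (LINT T|?M. ?g T)" by (rule integral_complex_of_real)
  also have "(LINT T|?M. ?g T) = enn2real (\<integral>\<^sup>+T. ennreal (?g T) \<partial>?M)"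
    by (intro integral_eq_nn_integral givental_real_measurable AE_I2) (auto simp: givental_real_def)
  also have "(\<integral>\<^sup>+T. ennreal (?g T) \<partial>?M) = wp (Suc n) a x" by (simp add: wp_def)
  also have "complex_of_real (enn2real (wp (Suc n) a x)) = psi (Suc n) lam x"
    using psi_real[OF x, of a] unfolding lam_def by (metis enn2real_ennreal)
  finally show ?thesis .
qed

section \<open>Whittaker functions as Laplace transforms\<close>

text \<open>The density of independent variables whose exponentials are Gamma distributed with parameters \<open>c i\<close>.\<close>

definition prod_gamma_density :: "nat \<Rightarrow> (nat \<Rightarrow> real) \<Rightarrow> (nat \<Rightarrow> real) \<Rightarrow> real" where
  "prod_gamma_density n c v = (\<Prod>i=1..n. exp (c i * v i - exp (v i)) / Gamma (c i))"

lemma prod_gamma_density_moment: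
  assumes c: "\<And>i. i \<in> {1..n} \<Longrightarrow> c i > 0" and cs: "\<And>i. i \<in> {1..n} \<Longrightarrow> c i + s i > 0"
  shows "(\<integral>\<^sup>+v. ennreal (prod_gamma_density n c v * exp (\<Sum>i=1..n. s i * v i)) \<partial>leb n)
       = ennreal (\<Prod>i=1..n. Gamma (c i + s i) / Gamma (c i))"
proof -
  have "(\<integral>\<^sup>+v. ennreal (prod_gamma_density n c v * exp (\<Sum>i=1..n. s i * v i)) \<partial>leb n)
     = (\<integral>\<^sup>+v. (\<Prod>i\<in>{1..n}. ennreal (exp ((c i + s i) * v i - exp (v i)) / Gamma (c i))) \<partial>leb n)"
  proof (intro nn_integral_cong)
    fix v :: "nat \<Rightarrow> real"
    have "prod_gamma_density n c v * exp (\<Sum>i=1..n. s i * v i) = (\<Prod>i\<in>{1..n}. exp ((c i + s i) * v i - exp (v i)) / Gamma (c i))"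
      unfolding prod_gamma_density_def exp_sum[OF finite_atLeastAtMost] prod.distrib[symmetric]
      by (intro prod.cong refl) (simp add: algebra_simps exp_add exp_diff)
    then show "ennreal (prod_gamma_density n c v * exp (\<Sum>i=1..n. s i * v i)) = (\<Prod>i\<in>{1..n}. ennreal (exp ((c i + s i) * v i - exp (v i)) / Gamma (c i)))"
      using c by (subst prod_ennreal) (auto intro!: divide_nonneg_pos)
  qed
  also have "\<dots> = (\<Prod>i\<in>{1..n}. \<integral>\<^sup>+v. ennreal (exp ((c i + s i) * v - exp v) / Gamma (c i)) \<partial>lborel)"
    unfolding leb_def by (intro lborel_prod.product_nn_integral_prod) auto
  also have "\<dots> = (\<Prod>i\<in>{1..n}. ennreal (Gamma (c i + s i) / Gamma (c i)))"
  proof (intro prod.cong refl)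
    fix i assume i: "i \<in> {1..n}"
    have "(\<integral>\<^sup>+v. ennreal (exp ((c i + s i) * v - exp v) / Gamma (c i)) \<partial>lborel)
       = (\<integral>\<^sup>+v. ennreal (inverse (Gamma (c i))) * ennreal (exp ((c i + s i) * v - exp v)) \<partial>lborel)"
      using c[OF i] by (intro nn_integral_cong) (simp add: ennreal_mult[symmetric] divide_inverse mult.commute)
    also have "\<dots> = ennreal (inverse (Gamma (c i))) * ennreal (Gamma (c i + s i))"
      by (subst nn_integral_cmult) (use nn_integral_gamma_exp[OF cs[OF i]] in auto)
    finally show "(\<integral>\<^sup>+v. ennreal (exp ((c i + s i) * v - exp v) / Gamma (c i)) \<partial>lborel) = ennreal (Gamma (c i + s i) / Gamma (c i))"
      using c[OF i] cs[OF i] by (simp add: ennreal_mult[symmetric] divide_inverse mult.commute)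
  qed
  also have "\<dots> = ennreal (\<Prod>i=1..n. Gamma (c i + s i) / Gamma (c i))"
    using c cs by (intro prod_ennreal divide_nonneg_pos) (auto intro: less_imp_le)
  finally show ?thesis .
qed

lemma Gamma_ratio_succ:
  fixes c :: real
  assumes "c > 0"
  shows "Gamma (c + 1) / Gamma c = c"
proof -
  have "Gamma c \<noteq> 0" using Gamma_real_pos[OF assms] by linarith
  moreover have "c \<notin> \<int>\<^sub>\<le>\<^sub>0" using assms by (auto elim!: nonpos_Ints_cases)
  ultimately show ?thesis by (simp add: Gamma_plus1)
qed

lemma Gamma_ratio_pred:
  fixes c :: real
  assumes "c > 1"
  shows "Gamma (c + -1) / Gamma c = inverse (c - 1)"
proof -
  have "Gamma c / Gamma (c - 1) = c - 1" using Gamma_ratio_succ[of "c - 1"] assms by simp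
  then have "inverse (Gamma c / Gamma (c - 1)) = inverse (c - 1)" by simp
  then show ?thesis by (simp add: inverse_divide)
qed

lemma prod_gamma_density_total:
  assumes "\<And>i. i \<in> {1..n} \<Longrightarrow> c i > 0"
  shows "(\<integral>\<^sup>+v. ennreal (prod_gamma_density n c v) \<partial>leb n) = 1"
proof -
  have "(\<Prod>i=1..n. Gamma (c i + 0) / Gamma (c i)) = (\<Prod>i=1..n. 1)"
  proof (intro prod.cong refl)
    fix i assume "i \<in> {1..n}"
    then show "Gamma (c i + 0) / Gamma (c i) = 1" using assms Gamma_real_pos[of "c i"] by fastforce
  qed
  then show ?thesis using prod_gamma_density_moment[of n c "\<lambda>_. 0"] assms by simp
qed

lemma prod_gamma_density_inv_moment:
  assumes c: "\<And>i. i \<in> {1..n} \<Longrightarrow> c i \<ge> 2" and k: "k \<in> {1..n}"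
  shows "(\<integral>\<^sup>+v. ennreal (prod_gamma_density n c v * exp (- v k)) \<partial>leb n) \<le> 1"
proof -
  let ?s = "\<lambda>i. if i = k then -1 else 0 :: real"
  have pos: "c i > 0" "c i + ?s i > 0" if "i \<in> {1..n}" for i using c[OF that] by auto
  have "(\<Prod>i=1..n. Gamma (c i + ?s i) / Gamma (c i)) = (\<Prod>i=1..n. if i = k then inverse (c k - 1) else 1)"
  proof (intro prod.cong refl)
    fix i assume i: "i \<in> {1..n}"
    then show "Gamma (c i + ?s i) / Gamma (c i) = (if i = k then inverse (c k - 1) else 1)"
      using c[OF i] Gamma_ratio_pred[of "c i"] Gamma_real_pos[of "c i"] by auto
  qed
  also have "\<dots> = inverse (c k - 1)" using k by (simp add: prod.delta)
  finally have e: "(\<Prod>i=1..n. Gamma (c i + ?s i) / Gamma (c i)) = inverse (c k - 1)" .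
  have "(\<Sum>i=1..n. ?s i * v i) = - v k" for v :: "nat \<Rightarrow> real"
  proof -
    have "(\<Sum>i=1..n. ?s i * v i) = (\<Sum>i=1..n. if i = k then - v i else 0)" by (intro sum.cong) auto
    then show ?thesis using k by (simp add: sum.delta)
  qed
  then have "(\<integral>\<^sup>+v. ennreal (prod_gamma_density n c v * exp (- v k)) \<partial>leb n) = ennreal (inverse (c k - 1))"
    using prod_gamma_density_moment[of n c ?s, OF pos] unfolding e by simp
  then show ?thesis using c[OF k] by (simp add: ennreal_le_1 inverse_le_1_iff)
qed

lemma prod_gamma_density_ratio_moment:
  assumes c: "\<And>i. i \<in> {1..n} \<Longrightarrow> c i \<ge> 2" and k: "k \<in> {2..n}" and gap: "c (k - 1) + 1 \<le> c k"
  shows "(\<integral>\<^sup>+v. ennreal (prod_gamma_density n c v * exp (v (k - 1) - v k)) \<partial>leb n) \<le> 1"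
proof -
  let ?s = "\<lambda>i. if i = k then -1 else if i = k - 1 then 1 else 0 :: real"
  have pos: "c i > 0" "c i + ?s i > 0" if "i \<in> {1..n}" for i using c[OF that] by auto
  have k1: "k - 1 \<in> {1..n}" "k \<in> {1..n}" "k - 1 \<noteq> k" using k by auto
  have "(\<Prod>i=1..n. Gamma (c i + ?s i) / Gamma (c i)) = (\<Prod>i=1..n. (if i = k then inverse (c k - 1) else 1) * (if i = k - 1 then c (k - 1) else 1))"
  proof (intro prod.cong refl)
    fix i assume i: "i \<in> {1..n}"
    then show "Gamma (c i + ?s i) / Gamma (c i) = (if i = k then inverse (c k - 1) else 1) * (if i = k - 1 then c (k - 1) else 1)"
      using c[OF i] Gamma_ratio_pred[of "c i"] Gamma_ratio_succ[of "c i"] Gamma_real_pos[of "c i"] k1(3) by auto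
  qed
  also have "\<dots> = inverse (c k - 1) * c (k - 1)" using k1 by (simp add: prod.distrib prod.delta)
  finally have e: "(\<Prod>i=1..n. Gamma (c i + ?s i) / Gamma (c i)) = inverse (c k - 1) * c (k - 1)" .
  have "(\<Sum>i=1..n. ?s i * v i) = v (k - 1) - v k" for v :: "nat \<Rightarrow> real"
  proof -
    have "(\<Sum>i=1..n. ?s i * v i) = (\<Sum>i=1..n. (if i = k then - v i else 0) + (if i = k - 1 then v i else 0))"
      using k1 by (intro sum.cong) auto
    then show ?thesis using k1 by (simp add: sum.distrib sum.delta)
  qed
  then have "(\<integral>\<^sup>+v. ennreal (prod_gamma_density n c v * exp (v (k - 1) - v k)) \<partial>leb n) = ennreal (inverse (c k - 1) * c (k - 1))"
    using prod_gamma_density_moment[of n c ?s, OF pos] unfolding e by simp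
  moreover have "inverse (c k - 1) * c (k - 1) \<le> 1"
    using c[OF k1(2)] gap by (simp add: field_simps)
  ultimately show ?thesis by (simp add: ennreal_le_1)
qed

lemma prod_gamma_density_nonneg: "(\<And>i. i \<in> {1..n} \<Longrightarrow> c i > 0) \<Longrightarrow> prod_gamma_density n c v \<ge> 0"
  unfolding prod_gamma_density_def by (intro prod_nonneg ballI divide_nonneg_pos) auto

lemma prod_gamma_density_measurable [measurable]: "prod_gamma_density n c \<in> borel_measurable (leb n)"
  unfolding prod_gamma_density_def
  by (intro borel_measurable_prod borel_measurable_divide leb_measurable_intros) auto

abbreviation seq_borel :: "(nat \<Rightarrow> real) measure" where
  "seq_borel \<equiv> PiM UNIV (\<lambda>_. borel)"

text \<open>
  The part of the potential that remains after the translation. The coordinates of \<open>\<omega>\<close> are logarithms of the random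
  weights on the bonds \<open>exp (x j - x (j + 1))\<close>, so that the weights are positive automatically.
\<close>

definition tilt :: "nat \<Rightarrow> (nat \<Rightarrow> real) \<Rightarrow> (nat \<Rightarrow> real) \<Rightarrow> real" where
  "tilt n \<omega> x = (\<Sum>j=1..<n. exp (\<omega> j + x j - x (j + 1)))"

text \<open>The weights for \<open>n + 1\<close> particles in terms of those for \<open>n\<close> and of the translated last row \<open>v\<close>.\<close>

definition next_weight :: "(nat \<Rightarrow> real) \<Rightarrow> (nat \<Rightarrow> real) \<Rightarrow> nat \<Rightarrow> real" where
  "next_weight v \<omega> k = exp (- v k) + (if k = 1 then 0 else exp (\<omega> (k - 1) + v (k - 1) - v k))"

lemma next_weight_pos: "next_weight v \<omega> k > 0"
  by (auto simp: next_weight_def intro!: add_pos_nonneg)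

lemma toda_kernel_real_shift:
  assumes n: "n \<ge> 1"
  shows "toda_kernel_real n an x (\<lambda>i\<in>{1..n}. 1 * v i + x (i + 1)) * exp (\<Sum>i=1..n. b i * (\<lambda>i\<in>{1..n}. 1 * v i + x (i + 1)) i)
     * exp (- tilt n \<omega> (\<lambda>i\<in>{1..n}. 1 * v i + x (i + 1)))
   = exp (an * x 1 + (\<Sum>i=1..n. b i * x (i + 1))) * (exp (\<Sum>i=1..n. (b i - an) * v i - exp (v i)))
     * exp (- tilt (Suc n) (\<lambda>k. ln (next_weight v \<omega> k)) x)"
proof -
  let ?y = "\<lambda>i\<in>{1..n}. 1 * v i + x (i + 1)"
  have X: "(\<Sum>i=1..n+1. x i) = x 1 + (\<Sum>i=1..n. x (i + 1))"
    using sum.atLeast_Suc_atMost[of 1 "n + 1" x] sum.shift_bounds_cl_Suc_ivl[of x 1 n] by simp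
  have Y: "(\<Sum>i=1..n. ?y i) = (\<Sum>i=1..n. v i) + (\<Sum>i=1..n. x (i + 1))"
    by (simp add: sum.distrib)
  have B: "(\<Sum>i=1..n. b i * ?y i) = (\<Sum>i=1..n. b i * v i) + (\<Sum>i=1..n. b i * x (i + 1))"
    by (simp add: sum.distrib algebra_simps)
  have E2: "(\<Sum>k=1..n. exp (?y k - x (k + 1))) = (\<Sum>k=1..n. exp (v k))" by simp
  have E1: "(\<Sum>k=1..n. exp (x k - ?y k)) = (\<Sum>k=1..n. exp (- v k) * exp (x k - x (k + 1)))"
    by (intro sum.cong) (auto simp flip: exp_add)
  have T1: "tilt n \<omega> ?y = (\<Sum>j=1..<n. exp (\<omega> j + v j - v (j + 1)) * exp (x (j + 1) - x (j + 2)))"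
    unfolding tilt_def by (intro sum.cong) (auto simp flip: exp_add simp: algebra_simps)
  have T1': "tilt n \<omega> ?y = (\<Sum>k=1..n. (if k = 1 then 0 else exp (\<omega> (k - 1) + v (k - 1) - v k)) * exp (x k - x (k + 1)))"
  proof -
    have "(\<Sum>k=1..n. (if k = 1 then 0 else exp (\<omega> (k - 1) + v (k - 1) - v k)) * exp (x k - x (k + 1)))
       = (\<Sum>k=Suc 1..n. (if k = 1 then 0 else exp (\<omega> (k - 1) + v (k - 1) - v k)) * exp (x k - x (k + 1)))"
      using n by (subst sum.atLeast_Suc_atMost) auto
    also have "\<dots> = (\<Sum>k=Suc 1..<Suc n. (if k = 1 then 0 else exp (\<omega> (k - 1) + v (k - 1) - v k)) * exp (x k - x (k + 1)))"
      by (simp add: atLeastLessThanSuc_atLeastAtMost)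
    also have "\<dots> = (\<Sum>j=1..<n. exp (\<omega> j + v j - v (j + 1)) * exp (x (j + 1) - x (j + 2)))"
      by (subst sum.shift_bounds_Suc_ivl) simp
    finally show ?thesis unfolding T1 by simp
  qed
  have T2: "tilt (Suc n) (\<lambda>k. ln (next_weight v \<omega> k)) x = (\<Sum>k=1..n. next_weight v \<omega> k * exp (x k - x (k + 1)))"
    unfolding tilt_def atLeastLessThanSuc_atLeastAtMost
    by (intro sum.cong refl) (simp add: add_diff_eq[symmetric] exp_add next_weight_pos)
  have T: "tilt (Suc n) (\<lambda>k. ln (next_weight v \<omega> k)) x = (\<Sum>k=1..n. exp (x k - ?y k)) + tilt n \<omega> ?y"
    unfolding T2 T1' E1 sum.distrib[symmetric] by (intro sum.cong refl) (simp only: next_weight_def distrib_right)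
  have V: "(\<Sum>i=1..n. (b i - an) * v i - exp (v i)) = (\<Sum>i=1..n. b i * v i) - an * (\<Sum>i=1..n. v i) - (\<Sum>k=1..n. exp (v k))"
    by (simp add: sum_subtractf left_diff_distrib sum_distrib_left)
  show ?thesis
    unfolding toda_kernel_real_def X Y B E2 T V exp_add[symmetric]
    by (intro arg_cong[where f=exp]) (simp add: algebra_simps)
qed

text \<open>
  The substitution \<open>y i = x (i + 1) + v i\<close> turns the bonds from \<open>y i\<close> to \<open>x (i + 1)\<close> into a Gamma density for \<open>v\<close>, which is
  independent of \<open>x\<close>. All remaining bonds carry a factor \<open>exp (x j - x (j + 1))\<close> and form the tilt. The mean weight of the bond \<open>j\<close> is at
  most \<open>j\<close>, whatever the spectral parameters are, as long as their gaps are at least \<open>2\<close>: the new weight is \<open>exp (- v k)\<close>, of mean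
  \<open>1 / (c k - 1)\<close>, plus the preceding weight times \<open>exp (v (k - 1) - v k)\<close>, of mean \<open>c (k - 1) / (c k - 1)\<close>, and both means
  are at most \<open>1\<close>. This uniformity is what the asymptotics below rest on.
\<close>

theorem wp_laplace:
  assumes "\<And>k. 1 \<le> k \<Longrightarrow> k < n \<Longrightarrow> a k \<ge> a (k + 1) + 2" and "n \<ge> 1"
  shows "\<exists>C M. C > 0 \<and> emeasure M (space M) = 1 \<and> sets M = sets seq_borel \<and>
    (\<forall>x\<in>Rn n. wp n a x = ennreal (C * exp (\<Sum>i=1..n. a (n + 1 - i) * x i)) * (\<integral>\<^sup>+\<omega>. ennreal (exp (- tilt n \<omega> x)) \<partial>M)) \<and>
    (\<forall>j\<in>{1..<n}. (\<integral>\<^sup>+\<omega>. ennreal (exp (\<omega> j)) \<partial>M) \<le> of_nat j)"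
  using assms(2,1)
proof (induction n rule: nat_induct_at_least)
  case base
  let ?M = "distr (count_space {()}) seq_borel (\<lambda>_ _. 0 :: real)"
  have m: "(\<lambda>_ _. 0 :: real) \<in> measurable (count_space {()}) seq_borel" by (auto simp: space_PiM)
  have "(\<integral>\<^sup>+\<omega>. f \<omega> \<partial>?M) = f (\<lambda>_. 0)" if "f \<in> borel_measurable seq_borel" for f :: "_ \<Rightarrow> ennreal"
    using that by (subst nn_integral_distr[OF m]) (auto simp: nn_integral_count_space_finite)
  from this[of "\<lambda>_. 1"] have 1: "emeasure ?M (space ?M) = 1" by (simp only: nn_integral_const mult_1) simp
  have w: "wp 1 a x = ennreal (exp (a 1 * x 1))" for x
  proof -
    have "wp 0 a = (\<lambda>_. 1)" by (intro ext) (rule wp_0)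
    then show ?thesis using wp_Suc[of 0 a x] by (simp add: leb_def space_PiM_empty toda_kernel_real_def)
  qed
  show ?case
    by (rule exI[of _ 1], rule exI[of _ ?M]) (use 1 in \<open>auto simp: w[unfolded One_nat_def] tilt_def simp del: space_distr\<close>)
next
  case (Suc n)
  then obtain C M where C: "C > 0" and M: "emeasure M (space M) = 1" "sets M = sets seq_borel"
    and rep: "\<And>x. x \<in> Rn n \<Longrightarrow> wp n a x = ennreal (C * exp (\<Sum>i=1..n. a (n + 1 - i) * x i)) * (\<integral>\<^sup>+\<omega>. ennreal (exp (- tilt n \<omega> x)) \<partial>M)"
    and mom: "\<And>j. j \<in> {1..<n} \<Longrightarrow> (\<integral>\<^sup>+\<omega>. ennreal (exp (\<omega> j)) \<partial>M) \<le> of_nat j"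
    by force
  interpret M: finite_measure M by (rule finite_measureI) (simp add: M(1))
  have coord [measurable]: "(\<lambda>\<omega>. \<omega> j) \<in> borel_measurable M" for j
    using measurable_component_singleton[of j UNIV "\<lambda>_. borel :: real measure"] by (simp add: measurable_cong_sets[OF M(2) refl])
  define b where "b i = a (n + 1 - i)" for i
  define c where "c i = b i - a (Suc n)" for i
  have mono: "a j \<ge> a (Suc n) + 2" if "1 \<le> j" "j \<le> n" for j
  proof -
    have "a (Suc n) + 2 \<le> a n" using Suc.prems[of n] Suc.hyps by auto
    moreover have "a n \<le> a j" using that(2,1)
    proof (induction j rule: inc_induct)
      case (step m)
      then show ?case using Suc.prems[of m] by force
    qed simp
    ultimately show ?thesis by linarith
  qed
  have c2: "c i \<ge> 2" if "i \<in> {1..n}" for i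
  proof -
    have "1 \<le> n + 1 - i" "n + 1 - i \<le> n" using that by auto
    from mono[OF this] show ?thesis by (simp add: c_def b_def)
  qed
  have c0: "c i > 0" if "i \<in> {1..n}" for i using c2[OF that] by linarith
  have cgap: "c (k - 1) + 1 \<le> c k" if "k \<in> {2..n}" for k
  proof -
    have "n + 1 - (k - 1) = (n + 1 - k) + 1" using that by auto
    moreover have "1 \<le> n + 1 - k" "n + 1 - k < Suc n" using that by auto
    ultimately show ?thesis using Suc.prems[of "n + 1 - k"] by (simp add: c_def b_def)
  qed
  let ?D = "prod_gamma_density n c"
  let ?L = "leb n"
  \<comment> \<open>The new measure: distribution of the new log-weights for independent \<open>v\<close> and \<open>\<omega>\<close>.\<close>
  define W where "W = (\<lambda>(v, \<omega>). (\<lambda>k. if k \<in> {1..n} then ln (next_weight v \<omega> k) else (0::real)))"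
  define P where "P = density (?L \<Otimes>\<^sub>M M) (\<lambda>(v, \<omega>). ennreal (?D v))"
  define M' where "M' = distr P seq_borel W"
  have vm: "(\<lambda>p. fst p i) \<in> borel_measurable (?L \<Otimes>\<^sub>M M)" if "i \<in> {1..n}" for i
    using measurable_compose[OF measurable_fst measurable_leb_component[OF that]] .
  have \<omega>m: "(\<lambda>p. snd p i) \<in> borel_measurable (?L \<Otimes>\<^sub>M M)" for i
    using measurable_compose[OF measurable_snd coord] .
  have Wk: "(\<lambda>p. next_weight (fst p) (snd p) k) \<in> borel_measurable (?L \<Otimes>\<^sub>M M)" if "k \<in> {1..n}" for k
  proof (cases "k = 1")
    case True
    then show ?thesis using vm[OF that] unfolding next_weight_def by simp
  next
    case False
    then have "k - 1 \<in> {1..n}" using that by auto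
    then show ?thesis using vm[OF that] vm[of "k - 1"] \<omega>m[of "k - 1"] False unfolding next_weight_def by simp
  qed
  have Wm: "W \<in> measurable (?L \<Otimes>\<^sub>M M) seq_borel"
  proof (rule measurable_PiM_single')
    fix k
    show "(\<lambda>p. W p k) \<in> borel_measurable (?L \<Otimes>\<^sub>M M)"
    proof (cases "k \<in> {1..n}")
      case True
      then show ?thesis using Wk[OF True] by (simp add: W_def case_prod_beta')
    qed (auto simp: W_def case_prod_beta')
  qed (auto simp: W_def)
  then have Wm': "W \<in> measurable P seq_borel" by (simp add: P_def)
  have Dm: "(\<lambda>(v, \<omega>). ennreal (?D v)) \<in> borel_measurable (?L \<Otimes>\<^sub>M M)"
    using measurable_compose[OF measurable_fst prod_gamma_density_measurable] by (simp add: case_prod_beta')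
  have integ: "(\<integral>\<^sup>+\<omega>. F \<omega> \<partial>M') = (\<integral>\<^sup>+v. ennreal (?D v) * (\<integral>\<^sup>+\<omega>. F (W (v, \<omega>)) \<partial>M) \<partial>?L)"
    if F: "F \<in> borel_measurable seq_borel" for F
  proof -
    have Fm: "(\<lambda>p. F (W p)) \<in> borel_measurable (?L \<Otimes>\<^sub>M M)" using measurable_compose[OF Wm F] .
    have "(\<integral>\<^sup>+\<omega>. F \<omega> \<partial>M') = (\<integral>\<^sup>+p. F (W p) \<partial>P)"
      unfolding M'_def by (rule nn_integral_distr[OF Wm']) (use F in simp)
    also have "\<dots> = (\<integral>\<^sup>+p. (case p of (v, \<omega>) \<Rightarrow> ennreal (?D v)) * F (W p) \<partial>(?L \<Otimes>\<^sub>M M))"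
      unfolding P_def by (rule nn_integral_density[OF Dm Fm])
    also have "\<dots> = (\<integral>\<^sup>+v. \<integral>\<^sup>+\<omega>. ennreal (?D v) * F (W (v, \<omega>)) \<partial>M \<partial>?L)"
      using Dm Fm by (subst M.nn_integral_fst[symmetric]) auto
    also have "\<dots> = (\<integral>\<^sup>+v. ennreal (?D v) * (\<integral>\<^sup>+\<omega>. F (W (v, \<omega>)) \<partial>M) \<partial>?L)"
    proof (rule nn_integral_cong)
      fix v assume "v \<in> space ?L"
      then have "(\<lambda>\<omega>. F (W (v, \<omega>))) \<in> borel_measurable M"
        using measurable_compose[OF measurable_Pair1' Fm] by blast
      then show "(\<integral>\<^sup>+\<omega>. ennreal (?D v) * F (W (v, \<omega>)) \<partial>M) = ennreal (?D v) * (\<integral>\<^sup>+\<omega>. F (W (v, \<omega>)) \<partial>M)"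
        by (rule nn_integral_cmult)
    qed
    finally show ?thesis .
  qed
  have "emeasure M' (space M') = 1"
  proof -
    have "emeasure M' (space M') = (\<integral>\<^sup>+\<omega>. 1 \<partial>M')" by simp
    also have "\<dots> = (\<integral>\<^sup>+v. ennreal (?D v) * (\<integral>\<^sup>+\<omega>. 1 \<partial>M) \<partial>?L)" by (rule integ) simp
    also have "\<dots> = 1" using prod_gamma_density_total[of n c, OF c0] by (simp add: M(1))
    finally show ?thesis .
  qed
  moreover have "sets M' = sets seq_borel" by (simp add: M'_def)
  moreover have "wp (Suc n) a x = ennreal ((C * (\<Prod>i=1..n. Gamma (c i))) * exp (\<Sum>i=1..Suc n. a (Suc n + 1 - i) * x i)) * (\<integral>\<^sup>+\<omega>. ennreal (exp (- tilt (Suc n) \<omega> x)) \<partial>M')"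
    if x: "x \<in> Rn (Suc n)" for x
  proof -
    let ?y = "\<lambda>v. \<lambda>i\<in>{1..n}. 1 * v i + x (i + 1)"
    let ?k = "toda_kernel_real n (a (Suc n)) x"
    let ?E = "exp (a (Suc n) * x 1 + (\<Sum>i=1..n. b i * x (i + 1)))"
    let ?\<Gamma> = "\<Prod>i=1..n. Gamma (c i)"
    have \<Gamma>: "?\<Gamma> > 0" using c0 by (intro prod_pos) auto
    have "continuous_on (Rn n) (psi n (\<lambda>k. - \<i> * of_real (a k)))" using tame.controlled_continuous[OF psi_tame] .
    from borel_measurable_leb_continuous[OF this]
    have rm: "(\<lambda>y. Re (psi n (\<lambda>k. - \<i> * of_real (a k)) y)) \<in> borel_measurable (leb n)" by simp
    have wm: "wp n a \<in> borel_measurable (leb n)"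
      by (rule measurable_cong[THEN iffD2, of _ _ "\<lambda>y. ennreal (Re (psi n (\<lambda>k. - \<i> * of_real (a k)) y))"])
        (use rm psi_real in auto)
    have km: "?k \<in> borel_measurable (leb n)"
      unfolding toda_kernel_real_def by (intro leb_measurable_intros) auto
    have f_m: "(\<lambda>y. ennreal (?k y) * wp n a y) \<in> borel_measurable (PiM {1..n} (\<lambda>_. lborel))"
      using wm km unfolding leb_def by (intro borel_measurable_times_ennreal) auto
    have dens: "exp (\<Sum>i=1..n. (b i - a (Suc n)) * v i - exp (v i)) = ?\<Gamma> * ?D v" for v
    proof -
      have "?\<Gamma> * ?D v = (\<Prod>i=1..n. exp (c i * v i - exp (v i)))"
        unfolding prod_gamma_density_def prod.distrib[symmetric]
      proof (intro prod.cong refl)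
        fix i assume "i \<in> {1..n}"
        then have "Gamma (c i) \<noteq> 0" using Gamma_real_pos[OF c0] by fastforce
        then show "Gamma (c i) * (exp (c i * v i - exp (v i)) / Gamma (c i)) = exp (c i * v i - exp (v i))" by simp
      qed
      then show ?thesis by (simp add: c_def exp_sum)
    qed
    have tilt_m: "(\<lambda>\<omega>. exp (- tilt (Suc n) \<omega> x)) \<in> borel_measurable seq_borel"
      unfolding tilt_def by measurable
    have tilt_W: "tilt (Suc n) (W (v, \<omega>)) x = tilt (Suc n) (\<lambda>k. ln (next_weight v \<omega> k)) x" for v \<omega>
      unfolding tilt_def W_def by (intro sum.cong) auto
    have pull_in: "ennreal K * (ennreal (C * L) * (\<integral>\<^sup>+\<omega>. ennreal (f \<omega>) \<partial>M)) = (\<integral>\<^sup>+\<omega>. ennreal (C * (K * L * f \<omega>)) \<partial>M)"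
      if "K \<ge> 0" "L \<ge> 0" "\<And>\<omega>. f \<omega> \<ge> 0" "(\<lambda>\<omega>. ennreal (f \<omega>)) \<in> borel_measurable M" for K L f
    proof -
      have "ennreal (C * (K * L * f \<omega>)) = ennreal K * ennreal (C * L) * ennreal (f \<omega>)" for \<omega>
        using that C by (simp add: ennreal_mult[symmetric] mult_ac)
      then show ?thesis using that(4) by (simp add: nn_integral_cmult mult.assoc)
    qed
    have inner: "ennreal (?k (?y v)) * wp n a (?y v) = ennreal (C * ?\<Gamma> * ?E) * (ennreal (?D v) * (\<integral>\<^sup>+\<omega>. ennreal (exp (- tilt (Suc n) (W (v, \<omega>)) x)) \<partial>M))" for v
    proof -
      have D0: "?D v \<ge> 0" using c0 by (rule prod_gamma_density_nonneg)
      have tm: "(\<lambda>\<omega>. ennreal (exp (- tilt n \<omega> (?y v)))) \<in> borel_measurable M"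
        unfolding tilt_def by measurable
      have tm': "(\<lambda>\<omega>. ennreal (exp (- tilt (Suc n) (\<lambda>k. ln (next_weight v \<omega> k)) x))) \<in> borel_measurable M"
        unfolding tilt_def next_weight_def by measurable
      have "ennreal (?k (?y v)) * wp n a (?y v)
         = ennreal (?k (?y v)) * (ennreal (C * exp (\<Sum>i=1..n. b i * ?y v i)) * (\<integral>\<^sup>+\<omega>. ennreal (exp (- tilt n \<omega> (?y v))) \<partial>M))"
        unfolding rep[OF restrict_in_Rn] b_def ..
      also have "\<dots> = (\<integral>\<^sup>+\<omega>. ennreal (C * (?k (?y v) * exp (\<Sum>i=1..n. b i * ?y v i) * exp (- tilt n \<omega> (?y v)))) \<partial>M)"
        by (rule pull_in) (use tm C in \<open>auto simp: toda_kernel_real_def\<close>)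
      also have "\<dots> = (\<integral>\<^sup>+\<omega>. ennreal (C * ?\<Gamma> * ?E * ?D v) * ennreal (exp (- tilt (Suc n) (\<lambda>k. ln (next_weight v \<omega> k)) x)) \<partial>M)"
        unfolding toda_kernel_real_shift[OF Suc.hyps] dens using C \<Gamma> D0
        by (simp add: ennreal_mult[symmetric] mult_ac)
      also have "\<dots> = ennreal (C * ?\<Gamma> * ?E * ?D v) * (\<integral>\<^sup>+\<omega>. ennreal (exp (- tilt (Suc n) (W (v, \<omega>)) x)) \<partial>M)"
        unfolding tilt_W by (rule nn_integral_cmult[OF tm'])
      finally show ?thesis using C \<Gamma> D0 by (simp add: ennreal_mult mult.assoc)
    qed
    have "wp (Suc n) a x = (\<integral>\<^sup>+y. ennreal (?k y) * wp n a y \<partial>PiM {1..n} (\<lambda>_. lborel))"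
      unfolding wp_Suc[OF wm] leb_def ..
    also have "\<dots> = (\<integral>\<^sup>+v. ennreal (?k (?y v)) * wp n a (?y v) \<partial>PiM {1..n} (\<lambda>_. lborel))"
      by (rule nn_integral_PiM_lborel_coordinatewise[symmetric, OF _ _ _ f_m]) (auto simp: bij_betw_def)
    also have "\<dots> = (\<integral>\<^sup>+v. ennreal (C * ?\<Gamma> * ?E) * (ennreal (?D v) * (\<integral>\<^sup>+\<omega>. ennreal (exp (- tilt (Suc n) (W (v, \<omega>)) x)) \<partial>M)) \<partial>?L)"
      unfolding inner leb_def ..
    also have "\<dots> = ennreal (C * ?\<Gamma> * ?E) * (\<integral>\<^sup>+v. ennreal (?D v) * (\<integral>\<^sup>+\<omega>. ennreal (exp (- tilt (Suc n) (W (v, \<omega>)) x)) \<partial>M) \<partial>?L)"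
    proof (rule nn_integral_cmult)
      have "(\<lambda>p. ennreal (exp (- tilt (Suc n) (W p) x))) \<in> borel_measurable (?L \<Otimes>\<^sub>M M)"
        using measurable_compose[OF Wm tilt_m] by simp
      then show "(\<lambda>v. ennreal (?D v) * (\<integral>\<^sup>+\<omega>. ennreal (exp (- tilt (Suc n) (W (v, \<omega>)) x)) \<partial>M)) \<in> borel_measurable ?L"
        by (intro borel_measurable_times_ennreal M.borel_measurable_nn_integral) (auto simp: case_prod_beta')
    qed
    also have "(\<integral>\<^sup>+v. ennreal (?D v) * (\<integral>\<^sup>+\<omega>. ennreal (exp (- tilt (Suc n) (W (v, \<omega>)) x)) \<partial>M) \<partial>?L)
       = (\<integral>\<^sup>+\<omega>. ennreal (exp (- tilt (Suc n) \<omega> x)) \<partial>M')"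
      by (rule integ[symmetric]) (use tilt_m in simp)
    also have "a (Suc n) * x 1 + (\<Sum>i=1..n. b i * x (i + 1)) = (\<Sum>i=1..Suc n. a (Suc n + 1 - i) * x i)"
      using sum.atLeast_Suc_atMost[of 1 "Suc n" "\<lambda>i. a (Suc n + 1 - i) * x i"] sum.shift_bounds_cl_Suc_ivl[of "\<lambda>i. a (Suc n + 1 - i) * x i" 1 n]
      by (simp add: b_def)
    finally show ?thesis .
  qed
  moreover have "(\<integral>\<^sup>+\<omega>. ennreal (exp (\<omega> k)) \<partial>M') \<le> of_nat k" if k: "k \<in> {1..<Suc n}" for k
  proof -
    have k': "k \<in> {1..n}" using k by auto
    have D0: "?D v \<ge> 0" for v using c0 by (rule prod_gamma_density_nonneg)
    have cm: "(\<lambda>v. v i) \<in> borel_measurable ?L" if "i \<in> {1..n}" for i by (rule measurable_leb_component[OF that])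
    have "(\<integral>\<^sup>+\<omega>. ennreal (exp (\<omega> k)) \<partial>M') = (\<integral>\<^sup>+v. ennreal (?D v) * (\<integral>\<^sup>+\<omega>. ennreal (next_weight v \<omega> k) \<partial>M) \<partial>?L)"
      using k' by (subst integ) (auto simp: W_def next_weight_pos)
    also have "\<dots> \<le> of_nat k"
    proof (cases "k = 1")
      case True
      have "(\<integral>\<^sup>+v. ennreal (?D v) * (\<integral>\<^sup>+\<omega>. ennreal (next_weight v \<omega> k) \<partial>M) \<partial>?L) = (\<integral>\<^sup>+v. ennreal (?D v * exp (- v k)) \<partial>?L)"
        using D0 True by (intro nn_integral_cong) (simp add: next_weight_def M(1) ennreal_mult)
      also have "\<dots> \<le> 1" by (rule prod_gamma_density_inv_moment[OF c2 k'])
      finally show ?thesis using True by simp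
    next
      case False
      then have k2: "k \<in> {2..n}" "k - 1 \<in> {1..<n}" "k - 1 \<in> {1..n}" using k' by auto
      have "(\<integral>\<^sup>+v. ennreal (?D v) * (\<integral>\<^sup>+\<omega>. ennreal (next_weight v \<omega> k) \<partial>M) \<partial>?L)
         \<le> (\<integral>\<^sup>+v. ennreal (?D v * exp (- v k)) + of_nat (k - 1) * ennreal (?D v * exp (v (k - 1) - v k)) \<partial>?L)"
      proof (intro nn_integral_mono)
        fix v
        have "(\<integral>\<^sup>+\<omega>. ennreal (next_weight v \<omega> k) \<partial>M) = (\<integral>\<^sup>+\<omega>. ennreal (exp (- v k)) + ennreal (exp (v (k - 1) - v k)) * ennreal (exp (\<omega> (k - 1))) \<partial>M)"
        proof (intro nn_integral_cong)
          fix \<omega>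
          have "next_weight v \<omega> k = exp (- v k) + exp (v (k - 1) - v k) * exp (\<omega> (k - 1))"
            using False by (simp add: next_weight_def exp_add[symmetric] algebra_simps)
          then show "ennreal (next_weight v \<omega> k) = ennreal (exp (- v k)) + ennreal (exp (v (k - 1) - v k)) * ennreal (exp (\<omega> (k - 1)))"
            by (simp add: ennreal_mult)
        qed
        also have "\<dots> = ennreal (exp (- v k)) + ennreal (exp (v (k - 1) - v k)) * (\<integral>\<^sup>+\<omega>. ennreal (exp (\<omega> (k - 1))) \<partial>M)"
          by (subst nn_integral_add) (auto simp: nn_integral_cmult M(1))
        also have "\<dots> \<le> ennreal (exp (- v k)) + ennreal (exp (v (k - 1) - v k)) * of_nat (k - 1)"
          by (intro add_left_mono mult_left_mono mom k2) auto
        finally have "ennreal (?D v) * (\<integral>\<^sup>+\<omega>. ennreal (next_weight v \<omega> k) \<partial>M) \<le> ennreal (?D v) * (ennreal (exp (- v k)) + ennreal (exp (v (k - 1) - v k)) * of_nat (k - 1))"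
          by (rule mult_left_mono) simp
        also have "\<dots> = ennreal (?D v * exp (- v k)) + of_nat (k - 1) * ennreal (?D v * exp (v (k - 1) - v k))"
          using D0[of v] by (simp add: ennreal_mult distrib_left mult_ac)
        finally show "ennreal (?D v) * (\<integral>\<^sup>+\<omega>. ennreal (next_weight v \<omega> k) \<partial>M) \<le> ennreal (?D v * exp (- v k)) + of_nat (k - 1) * ennreal (?D v * exp (v (k - 1) - v k))" .
      qed
      also have "\<dots> = (\<integral>\<^sup>+v. ennreal (?D v * exp (- v k)) \<partial>?L) + of_nat (k - 1) * (\<integral>\<^sup>+v. ennreal (?D v * exp (v (k - 1) - v k)) \<partial>?L)"
        using cm[OF k'] cm[OF k2(3)] by (subst nn_integral_add) (auto simp: nn_integral_cmult)
      also have "\<dots> \<le> 1 + of_nat (k - 1) * 1"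
        by (intro add_mono mult_left_mono prod_gamma_density_inv_moment[OF c2 k'] prod_gamma_density_ratio_moment[OF c2 k2(1) cgap[OF k2(1)]]) auto
      also have "\<dots> = of_nat k" using k' by (metis Suc_diff_1 atLeastAtMost_iff less_eq_Suc_le mult.right_neutral of_nat_Suc One_nat_def)
      finally show ?thesis .
    qed
    finally show ?thesis .
  qed
  moreover have "C * (\<Prod>i=1..n. Gamma (c i)) > 0" using C c0 by (intro mult_pos_pos prod_pos) auto
  ultimately show ?case by blast
qed

section \<open>Jets of Whittaker functions\<close>

text \<open>
  Extended by \<open>0\<close> to the ends of the chain, so that the rule for differentiating in \<open>x i\<close>, which involves the bonds \<open>i\<close> and
  \<open>i - 1\<close>, holds at the ends as well.
\<close>

definition bond_weight :: "nat \<Rightarrow> (nat \<Rightarrow> real) \<Rightarrow> (nat \<Rightarrow> real) \<Rightarrow> nat \<Rightarrow> real" where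
  "bond_weight n \<omega> x j = (if j \<in> {1..<n} then exp (\<omega> j + x j - x (j + 1)) else 0)"

definition tilt_monom :: "nat \<Rightarrow> nat list \<Rightarrow> (nat \<Rightarrow> real) \<Rightarrow> (nat \<Rightarrow> real) \<Rightarrow> real" where
  "tilt_monom n js \<omega> x = prod_list (map (bond_weight n \<omega> x) js) * exp (- tilt n \<omega> x)"

lemma bond_weight_nonneg [simp]: "bond_weight n \<omega> x j \<ge> 0"
  by (simp add: bond_weight_def)

lemma tilt_bond_weight: "tilt n \<omega> x = (\<Sum>j=1..<n. bond_weight n \<omega> x j)"
  unfolding tilt_def bond_weight_def by (intro sum.cong) auto

lemma bond_weight_le_tilt: "bond_weight n \<omega> x j \<le> tilt n \<omega> x"
proof (cases "j \<in> {1..<n}")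
  case True
  then show ?thesis unfolding tilt_bond_weight by (intro member_le_sum) auto
next
  case False
  then have "bond_weight n \<omega> x j = 0" unfolding bond_weight_def by simp
  then show ?thesis unfolding tilt_bond_weight by (simp add: sum_nonneg)
qed

text \<open>
  Every derivative of \<open>exp (- tilt n \<omega> x)\<close> in \<open>x\<close> is a combination of these monomials. They are bounded, uniformly in
  \<open>\<omega>\<close> and \<open>x\<close>, because each bond weight is at most the tilt \<open>u\<close> and \<open>u ^ N * exp (- u) \<le> fact N\<close>.
\<close>

lemma tilt_monom_bounds: "0 \<le> tilt_monom n js \<omega> x" "tilt_monom n js \<omega> x \<le> fact (length js)"
proof -
  have t: "tilt n \<omega> x \<ge> 0" unfolding tilt_bond_weight by (simp add: sum_nonneg)
  have "0 \<le> prod_list (map (bond_weight n \<omega> x) js) \<and> prod_list (map (bond_weight n \<omega> x) js) \<le> tilt n \<omega> x ^ length js"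
    by (induction js) (auto intro!: mult_mono bond_weight_le_tilt t)
  then have p: "0 \<le> prod_list (map (bond_weight n \<omega> x) js)" "prod_list (map (bond_weight n \<omega> x) js) \<le> tilt n \<omega> x ^ length js"
    by auto
  show "0 \<le> tilt_monom n js \<omega> x" using p by (simp add: tilt_monom_def)
  have "tilt_monom n js \<omega> x \<le> (fact (length js) * exp (tilt n \<omega> x)) * exp (- tilt n \<omega> x)"
    unfolding tilt_monom_def using p(2) power_le_fact_exp[OF t, of "length js"] by (intro mult_right_mono) auto
  then show "tilt_monom n js \<omega> x \<le> fact (length js)" by (simp add: mult.assoc flip: exp_add)
qed

lemma bond_weight_deriv:
  assumes "i \<ge> 1"
  shows "((\<lambda>s. bond_weight n \<omega> (x(i := s)) j) has_real_derivative
    bond_weight n \<omega> x j * ((if j = i then 1 else 0) - (if j = i - 1 then 1 else 0))) (at (x i))"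
proof (cases "j \<in> {1..<n}")
  case True
  have eq: "bond_weight n \<omega> z j = exp (\<omega> j + z j - z (j + 1))" for z
    unfolding bond_weight_def using True by simp
  consider "j = i" | "j + 1 = i" | "j \<noteq> i" "j + 1 \<noteq> i" by blast
  then show ?thesis
  proof cases
    case 1
    then show ?thesis unfolding eq using assms by (auto intro!: derivative_eq_intros)
  next
    case 2
    then show ?thesis unfolding eq using assms by (auto intro!: derivative_eq_intros)
  next
    case 3
    then have "j \<noteq> i - 1" using assms by auto
    then show ?thesis unfolding eq using 3 by simp
  qed
next
  case False
  then have "bond_weight n \<omega> z j = 0" for z unfolding bond_weight_def by simp
  then show ?thesis by simp
qed

definition count_diff :: "nat list \<Rightarrow> nat \<Rightarrow> real" where
  "count_diff js i = real (count_list js i) - real (count_list js (i - 1))"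

lemma tilt_monom_deriv:
  assumes i: "i \<ge> 1"
  shows "((\<lambda>s. tilt_monom n js \<omega> (x(i := s))) has_real_derivative
    count_diff js i * tilt_monom n js \<omega> x - tilt_monom n (i # js) \<omega> x + tilt_monom n ((i - 1) # js) \<omega> x) (at (x i))"
proof -
  let ?P = "\<lambda>js z. prod_list (map (bond_weight n \<omega> z) js)"
  have P: "((\<lambda>s. ?P js (x(i := s))) has_real_derivative count_diff js i * ?P js x) (at (x i))"
  proof (induction js)
    case Nil
    then show ?case by (simp add: count_diff_def)
  next
    case (Cons j js)
    have "((\<lambda>s. bond_weight n \<omega> (x(i := s)) j * ?P js (x(i := s))) has_real_derivative
       bond_weight n \<omega> x j * ((if j = i then 1 else 0) - (if j = i - 1 then 1 else 0)) * ?P js x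
        + count_diff js i * ?P js x * bond_weight n \<omega> x j) (at (x i))"
      using DERIV_mult[OF bond_weight_deriv[OF i, of n \<omega> x j] Cons.IH] by (simp only: fun_upd_triv)
    moreover have "bond_weight n \<omega> x j * ((if j = i then 1 else 0) - (if j = i - 1 then 1 else 0)) * ?P js x
        + count_diff js i * ?P js x * bond_weight n \<omega> x j = count_diff (j # js) i * (bond_weight n \<omega> x j * ?P js x)"
      using i by (auto simp: count_diff_def algebra_simps)
    ultimately show ?case by (simp only: list.map prod_list.Cons)
  qed
  have t: "((\<lambda>s. tilt n \<omega> (x(i := s))) has_real_derivative bond_weight n \<omega> x i - bond_weight n \<omega> x (i - 1)) (at (x i))"
  proof -
    have "((\<lambda>s. tilt n \<omega> (x(i := s))) has_real_derivative
       (\<Sum>j=1..<n. bond_weight n \<omega> x j * ((if j = i then 1 else 0) - (if j = i - 1 then 1 else 0)))) (at (x i))"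
      unfolding tilt_bond_weight by (intro DERIV_sum bond_weight_deriv i)
    also have "(\<Sum>j=1..<n. bond_weight n \<omega> x j * ((if j = i then 1 else 0) - (if j = i - 1 then 1 else 0)))
       = (\<Sum>j=1..<n. if j = i then bond_weight n \<omega> x j else 0) - (\<Sum>j=1..<n. if j = i - 1 then bond_weight n \<omega> x j else 0)"
      unfolding sum_subtractf[symmetric] by (intro sum.cong) auto
    also have "\<dots> = bond_weight n \<omega> x i - bond_weight n \<omega> x (i - 1)"
      by (auto simp: sum.delta bond_weight_def)
    finally show ?thesis .
  qed
  have e: "((\<lambda>s. exp (- tilt n \<omega> (x(i := s)))) has_real_derivative
     exp (- tilt n \<omega> x) * - (bond_weight n \<omega> x i - bond_weight n \<omega> x (i - 1))) (at (x i))"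
    using DERIV_chain2[OF DERIV_exp DERIV_minus[OF t]] by simp
  show ?thesis
    unfolding tilt_monom_def using DERIV_mult[OF P e] by (simp add: algebra_simps)
qed

lemma tilt_monom_measurable:
  assumes "sets M = sets seq_borel"
  shows "(\<lambda>\<omega>. tilt_monom n js \<omega> x) \<in> borel_measurable M"
proof -
  have b: "(\<lambda>\<omega>. bond_weight n \<omega> x j) \<in> borel_measurable seq_borel" for j
    unfolding bond_weight_def by measurable
  have "(\<lambda>\<omega>. prod_list (map (bond_weight n \<omega> x) js)) \<in> borel_measurable seq_borel"
    by (induction js) (auto intro!: borel_measurable_times b)
  moreover have "(\<lambda>\<omega>. tilt n \<omega> x) \<in> borel_measurable seq_borel"
    unfolding tilt_bond_weight by (intro borel_measurable_sum b)
  ultimately have "(\<lambda>\<omega>. tilt_monom n js \<omega> x) \<in> borel_measurable seq_borel"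
    unfolding tilt_monom_def by (intro borel_measurable_times borel_measurable_exp_comp borel_measurable_uminus)
  then show ?thesis by (simp only: measurable_cong_sets[OF assms refl])
qed

definition laplace_moment :: "nat \<Rightarrow> (nat \<Rightarrow> real) measure \<Rightarrow> nat list \<Rightarrow> (nat \<Rightarrow> real) \<Rightarrow> real" where
  "laplace_moment n M js x = (LINT \<omega>|M. tilt_monom n js \<omega> x)"

lemma tilt_monom_integrable:
  assumes "finite_measure M" "sets M = sets seq_borel"
  shows "integrable M (\<lambda>\<omega>. tilt_monom n js \<omega> x)"
  using tilt_monom_bounds[of n js _ x]
  by (intro finite_measure.integrable_const_bound[OF assms(1), where B="fact (length js)"] tilt_monom_measurable[OF assms(2)])
    auto

lemma laplace_moment_deriv:
  assumes M: "finite_measure M" "sets M = sets seq_borel" and i: "i \<ge> 1"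
  shows "((\<lambda>s. complex_of_real (laplace_moment n M js (x(i := s)))) has_vector_derivative
    of_real (count_diff js i * laplace_moment n M js x - laplace_moment n M (i # js) x + laplace_moment n M ((i - 1) # js) x)) (at (x i))"
proof -
  interpret finite_measure M by fact
  note int = tilt_monom_integrable[OF finite_measure_axioms M(2)]
  let ?d = "\<lambda>z \<omega>. count_diff js i * tilt_monom n js \<omega> z - tilt_monom n (i # js) \<omega> z + tilt_monom n ((i - 1) # js) \<omega> z"
  let ?B = "\<bar>count_diff js i\<bar> * fact (length js) + 2 * fact (Suc (length js))"
  have "((\<lambda>s. LINT \<omega>|M. complex_of_real (tilt_monom n js \<omega> (x(i := s)))) has_vector_derivative
     (LINT \<omega>|M. complex_of_real (?d (x(i := x i)) \<omega>))) (at (x i))"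
  proof (rule has_vector_derivative_integral_dominated[where f'="\<lambda>s \<omega>. complex_of_real (?d (x(i := s)) \<omega>)" and g="\<lambda>_. ?B"])
    fix s \<omega>
    show "((\<lambda>s. complex_of_real (tilt_monom n js \<omega> (x(i := s)))) has_vector_derivative complex_of_real (?d (x(i := s)) \<omega>)) (at s)"
      using tilt_monom_deriv[OF i, of n js \<omega> "x(i := s)"] by (intro has_vector_derivative_of_real) simp
    have "\<bar>?d z \<omega>\<bar> \<le> ?B" for z
    proof -
      have "\<bar>count_diff js i * tilt_monom n js \<omega> z\<bar> \<le> \<bar>count_diff js i\<bar> * fact (length js)"
        using tilt_monom_bounds[of n js \<omega> z] by (simp add: abs_mult mult_left_mono)
      then show ?thesis
        using tilt_monom_bounds[of n "i # js" \<omega> z] tilt_monom_bounds[of n "(i - 1) # js" \<omega> z] by (simp del: fact_Suc)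
    qed
    then show "norm (complex_of_real (?d (x(i := s)) \<omega>)) \<le> ?B" by (simp only: norm_of_real)
  next
    show "integrable M (\<lambda>\<omega>. complex_of_real (tilt_monom n js \<omega> (x(i := s))))" for s
      by (intro integrable_of_real int)
    have "integrable M (\<lambda>\<omega>. complex_of_real (?d (x(i := x i)) \<omega>))"
      by (intro integrable_of_real Bochner_Integration.integrable_add Bochner_Integration.integrable_diff integrable_mult_right int)
    then show "(\<lambda>\<omega>. complex_of_real (?d (x(i := x i)) \<omega>)) \<in> borel_measurable M"
      by (rule borel_measurable_integrable)
  qed auto
  moreover have "(LINT \<omega>|M. complex_of_real (?d (x(i := x i)) \<omega>)) = of_real (count_diff js i * laplace_moment n M js x - laplace_moment n M (i # js) x + laplace_moment n M ((i - 1) # js) x)"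
    unfolding laplace_moment_def integral_complex_of_real using int by simp
  ultimately show ?thesis unfolding laplace_moment_def by (simp only: integral_complex_of_real)
qed

lemma laplace_moment_bounds:
  assumes M: "emeasure M (space M) = 1" "sets M = sets seq_borel"
  shows "0 \<le> laplace_moment n M js x" "laplace_moment n M js x \<le> fact (length js)"
proof -
  interpret finite_measure M by (rule finite_measureI) (simp add: M(1))
  show "0 \<le> laplace_moment n M js x"
    unfolding laplace_moment_def by (intro Bochner_Integration.integral_nonneg tilt_monom_bounds)
  have "laplace_moment n M js x \<le> (LINT \<omega>|M. fact (length js))"
    unfolding laplace_moment_def by (intro integral_mono tilt_monom_integrable finite_measure_axioms M integrable_const tilt_monom_bounds)
  then show "laplace_moment n M js x \<le> fact (length js)" by (simp add: measure_def M(1))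
qed

text \<open>
  Jensen's inequality: \<open>exp (- u)\<close> lies above its tangent line at the bound of the mean of the tilt. The
  resulting lower bound is the same for all measures in question.
\<close>

lemma laplace_moment_lower_bound:
  assumes M: "emeasure M (space M) = 1" "sets M = sets seq_borel"
    and mom: "\<And>j. j \<in> {1..<n} \<Longrightarrow> (\<integral>\<^sup>+\<omega>. ennreal (exp (\<omega> j)) \<partial>M) \<le> of_nat j"
  shows "exp (- (\<Sum>j=1..<n. real j * exp (x j - x (j + 1)))) \<le> laplace_moment n M [] x"
proof -
  interpret finite_measure M by (rule finite_measureI) (simp add: M(1))
  let ?k = "\<Sum>j=1..<n. real j * exp (x j - x (j + 1))"
  have coord: "(\<lambda>\<omega>. \<omega> j) \<in> borel_measurable M" for j
    using measurable_component_singleton[of j UNIV "\<lambda>_. borel :: real measure"] by (simp add: measurable_cong_sets[OF M(2) refl])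
  have i: "integrable M (\<lambda>\<omega>. exp (\<omega> j))" if "j \<in> {1..<n}" for j
  proof (rule integrableI_nonneg)
    have "(\<integral>\<^sup>+\<omega>. ennreal (exp (\<omega> j)) \<partial>M) \<le> of_nat j" by (rule mom[OF that])
    also have "\<dots> < \<infinity>" by (simp add: of_nat_less_top)
    finally show "(\<integral>\<^sup>+\<omega>. ennreal (exp (\<omega> j)) \<partial>M) < \<infinity>" .
  qed (use coord[of j] in auto)
  have e: "(LINT \<omega>|M. exp (\<omega> j)) \<le> real j" if "j \<in> {1..<n}" for j
  proof -
    have "ennreal (LINT \<omega>|M. exp (\<omega> j)) = (\<integral>\<^sup>+\<omega>. ennreal (exp (\<omega> j)) \<partial>M)"
      by (rule nn_integral_eq_integral[symmetric, OF i[OF that]]) auto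
    also have "\<dots> \<le> ennreal (real j)" using mom[OF that] by (simp add: ennreal_of_nat_eq_real_of_nat)
    finally show ?thesis by simp
  qed
  have tilt: "tilt n \<omega> x = (\<Sum>j=1..<n. exp (x j - x (j + 1)) * exp (\<omega> j))" for \<omega>
    unfolding tilt_def by (intro sum.cong refl) (simp add: exp_add[symmetric] algebra_simps)
  have ti: "integrable M (\<lambda>\<omega>. tilt n \<omega> x)"
    unfolding tilt by (intro Bochner_Integration.integrable_sum integrable_mult_right i)
  have "(LINT \<omega>|M. tilt n \<omega> x) = (\<Sum>j=1..<n. exp (x j - x (j + 1)) * (LINT \<omega>|M. exp (\<omega> j)))"
    unfolding tilt using i by (subst Bochner_Integration.integral_sum) auto
  also have "\<dots> \<le> (\<Sum>j=1..<n. exp (x j - x (j + 1)) * real j)" by (intro sum_mono mult_left_mono e) auto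
  finally have et: "(LINT \<omega>|M. tilt n \<omega> x) \<le> ?k" by (simp add: mult.commute)
  have m1: "measure M (space M) = 1" by (simp add: measure_def M(1))
  have "exp (- ?k) \<le> exp (- ?k) * (1 + ?k - (LINT \<omega>|M. tilt n \<omega> x))" using et by simp
  also have "\<dots> = (LINT \<omega>|M. exp (- ?k) * (1 + ?k - tilt n \<omega> x))" using ti m1 by simp
  also have "\<dots> \<le> laplace_moment n M [] x"
    unfolding laplace_moment_def
  proof (rule integral_mono)
    show "integrable M (\<lambda>\<omega>. exp (- ?k) * (1 + ?k - tilt n \<omega> x))"
      by (intro integrable_mult_right Bochner_Integration.integrable_diff integrable_const ti)
    show "integrable M (\<lambda>\<omega>. tilt_monom n [] \<omega> x)" by (rule tilt_monom_integrable[OF finite_measure_axioms M(2)])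
    fix \<omega>
    have "1 + (?k - tilt n \<omega> x) \<le> exp (?k - tilt n \<omega> x)" by (rule exp_ge_add_one_self)
    then have "exp (- ?k) * (1 + (?k - tilt n \<omega> x)) \<le> exp (- ?k) * exp (?k - tilt n \<omega> x)"
      by (rule mult_left_mono) simp
    also have "\<dots> = tilt_monom n [] \<omega> x" by (simp add: tilt_monom_def flip: exp_add)
    finally show "exp (- ?k) * (1 + ?k - tilt n \<omega> x) \<le> tilt_monom n [] \<omega> x" by (simp add: add_diff_eq)
  qed
  finally show ?thesis .
qed

text \<open>
  A one-parameter family of such Laplace transforms, multiplied by plane waves whose exponents are powers of the large
  parameter \<open>T\<close>.
\<close>

locale laplace_family =
  fixes n :: nat and wt :: "nat \<Rightarrow> nat" and M :: "real \<Rightarrow> (nat \<Rightarrow> real) measure" and T0 :: real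
  assumes T0: "T0 \<ge> 1" and wt: "\<And>i. i \<in> {1..n} \<Longrightarrow> wt i \<ge> 1"
    and M1: "\<And>T. T \<ge> T0 \<Longrightarrow> emeasure (M T) (space (M T)) = 1" and Ms: "\<And>T. T \<ge> T0 \<Longrightarrow> sets (M T) = sets seq_borel"
begin

definition plane_wave :: "real \<Rightarrow> (nat \<Rightarrow> real) \<Rightarrow> real" where
  "plane_wave T x = exp (\<Sum>i=1..n. T ^ wt i * x i)"

definition E :: "real \<Rightarrow> nat list \<Rightarrow> cfun" where
  "E T js x = of_real (plane_wave T x * laplace_moment n (M T) js x)"

lemma E_bound: "T \<ge> T0 \<Longrightarrow> norm (E T js x) \<le> fact (length js) * plane_wave T x"
  using laplace_moment_bounds[OF M1 Ms, of T n js x]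
  by (simp add: E_def norm_mult plane_wave_def mult.commute)

lemma E_deriv:
  assumes T: "T \<ge> T0" and i: "i \<in> {1..n}"
  shows "((\<lambda>s. E T js (x(i := s))) has_vector_derivative
     of_real (T ^ wt i + count_diff js i) * E T js x - E T (i # js) x + E T ((i - 1) # js) x) (at (x i))"
proof -
  have fin: "finite_measure (M T)" by (rule finite_measureI) (simp add: M1[OF T])
  have "((\<lambda>s. \<Sum>k=1..n. T ^ wt k * (x(i := s)) k) has_real_derivative (\<Sum>k=1..n. if k = i then T ^ wt i else 0)) (at (x i))"
    by (intro DERIV_sum) (auto intro!: derivative_eq_intros)
  then have s: "((\<lambda>s. \<Sum>k=1..n. T ^ wt k * (x(i := s)) k) has_real_derivative T ^ wt i) (at (x i))"
    using i by (simp add: sum.delta)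
  have "((\<lambda>s. plane_wave T (x(i := s))) has_real_derivative plane_wave T x * T ^ wt i) (at (x i))"
    unfolding plane_wave_def using DERIV_chain2[OF DERIV_exp s] by simp
  from has_vector_derivative_mult[OF has_vector_derivative_of_real[OF this] laplace_moment_deriv[OF fin Ms[OF T], of i n js x]]
  show ?thesis using i by (simp add: E_def algebra_simps)
qed

text \<open>
  Finite sums of terms of order at most \<open>v\<close> in \<open>T\<close>. Differentiation in \<open>x i\<close> raises the order by at most \<open>wt i\<close>.
\<close>

inductive Err :: "nat \<Rightarrow> (real \<Rightarrow> cfun) \<Rightarrow> bool" for v where
  single: "(\<And>T. T \<ge> T0 \<Longrightarrow> norm (\<kappa> T) \<le> K * T ^ v) \<Longrightarrow> Err v (\<lambda>T x. \<kappa> T * E T js x)"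
| plus: "Err v \<phi> \<Longrightarrow> Err v \<theta> \<Longrightarrow> Err v (\<lambda>T x. \<phi> T x + \<theta> T x)"

lemma Err_bound: "Err v \<phi> \<Longrightarrow> \<exists>K. \<forall>T\<ge>T0. norm (\<phi> T x) \<le> K * T ^ v * plane_wave T x"
proof (induction rule: Err.induct)
  case (single \<kappa> K js)
  have "norm (\<kappa> T * E T js x) \<le> (K * fact (length js)) * T ^ v * plane_wave T x" if T: "T \<ge> T0" for T
  proof -
    have "norm (\<kappa> T * E T js x) \<le> (K * T ^ v) * (fact (length js) * plane_wave T x)"
      unfolding norm_mult using single[OF T] E_bound[OF T] by (intro mult_mono) (auto intro: order_trans[OF norm_ge_zero])
    then show ?thesis by (simp add: mult_ac)
  qed
  then show ?case by blast
next
  case (plus \<phi> \<theta>)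
  then obtain K1 K2 where "\<And>T. T \<ge> T0 \<Longrightarrow> norm (\<phi> T x) \<le> K1 * T ^ v * plane_wave T x" "\<And>T. T \<ge> T0 \<Longrightarrow> norm (\<theta> T x) \<le> K2 * T ^ v * plane_wave T x"
    by blast
  then have "norm (\<phi> T x + \<theta> T x) \<le> (K1 + K2) * T ^ v * plane_wave T x" if "T \<ge> T0" for T
    using norm_triangle_le[OF add_mono, of "\<phi> T x" _ "\<theta> T x"] that by (fastforce simp: algebra_simps)
  then show ?case by blast
qed

lemma Err_mono:
  assumes "Err v \<phi>" "v \<le> v'"
  shows "Err v' \<phi>"
  using assms(1)
proof (induction rule: Err.induct)
  case (single \<kappa> K js)
  have "norm (\<kappa> T) \<le> \<bar>K\<bar> * T ^ v'" if T: "T \<ge> T0" for T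
  proof -
    have "norm (\<kappa> T) \<le> K * T ^ v" by (rule single[OF T])
    also have "\<dots> \<le> \<bar>K\<bar> * T ^ v'"
      using T T0 assms(2) by (intro mult_mono power_increasing) auto
    finally show ?thesis .
  qed
  then show ?case by (rule Err.single)
qed (rule Err.plus)

lemma Err_deriv:
  assumes i: "i \<in> {1..n}"
  shows "Err v \<phi> \<Longrightarrow> \<exists>\<phi>'. Err (v + wt i) \<phi>' \<and>
    (\<forall>T\<ge>T0. \<forall>x\<in>Rn n. ((\<lambda>s. \<phi> T (x(i := s))) has_vector_derivative \<phi>' T x) (at (x i)))"
proof (induction rule: Err.induct)
  case (single \<kappa> K js)
  let ?\<phi> = "\<lambda>T x. (\<kappa> T * of_real (T ^ wt i + count_diff js i)) * E T js x + ((- \<kappa> T) * E T (i # js) x + \<kappa> T * E T ((i - 1) # js) x)"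
  have k: "Err (v + wt i) (\<lambda>T x. (\<kappa> T * of_real (T ^ wt i + count_diff js i)) * E T js x)"
  proof (rule Err.single)
    fix T assume T: "T \<ge> T0"
    have T1: "1 \<le> T ^ wt i" using T T0 by (intro one_le_power) auto
    have "norm (complex_of_real (T ^ wt i + count_diff js i)) \<le> T ^ wt i + \<bar>count_diff js i\<bar> * T ^ wt i"
      using T1 mult_left_mono[OF T1, of "\<bar>count_diff js i\<bar>"] by (simp only: norm_of_real) simp
    then have "norm (\<kappa> T * of_real (T ^ wt i + count_diff js i)) \<le> (K * T ^ v) * (T ^ wt i + \<bar>count_diff js i\<bar> * T ^ wt i)"
      unfolding norm_mult using single[OF T] by (intro mult_mono) (auto intro: order_trans[OF norm_ge_zero])
    then show "norm (\<kappa> T * of_real (T ^ wt i + count_diff js i)) \<le> (K * (1 + \<bar>count_diff js i\<bar>)) * T ^ (v + wt i)"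
      by (simp add: algebra_simps power_add)
  qed
  have e1: "Err (v + wt i) (\<lambda>T x. (- \<kappa> T) * E T (i # js) x)"
    by (rule Err_mono[OF Err.single[where K=K and v=v]]) (use single in auto)
  have e2: "Err (v + wt i) (\<lambda>T x. \<kappa> T * E T ((i - 1) # js) x)"
    by (rule Err_mono[OF Err.single[where K=K and v=v]]) (use single in auto)
  have "Err (v + wt i) ?\<phi>" by (intro Err.plus k e1 e2)
  moreover have "((\<lambda>s. \<kappa> T * E T js (x(i := s))) has_vector_derivative ?\<phi> T x) (at (x i))" if "T \<ge> T0" for T x
    using has_vector_derivative_mult_right[OF E_deriv[OF that i, of js x], of "\<kappa> T"] by (simp add: algebra_simps)
  ultimately show ?case by blast
next
  case (plus \<phi> \<theta>)
  then obtain \<phi>' \<theta>' where h: "Err (v + wt i) \<phi>'" "Err (v + wt i) \<theta>'"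
    "\<And>T x. T \<ge> T0 \<Longrightarrow> x \<in> Rn n \<Longrightarrow> ((\<lambda>s. \<phi> T (x(i := s))) has_vector_derivative \<phi>' T x) (at (x i))"
    "\<And>T x. T \<ge> T0 \<Longrightarrow> x \<in> Rn n \<Longrightarrow> ((\<lambda>s. \<theta> T (x(i := s))) has_vector_derivative \<theta>' T x) (at (x i))" by blast
  then show ?case by (intro exI[of _ "\<lambda>T x. \<phi>' T x + \<theta>' T x"] conjI allI impI ballI Err.plus has_vector_derivative_add)
qed

text \<open>The leading term is exact and the remainder is smaller by a factor \<open>T\<close>; this is preserved by differentiation because \<open>wt i \<ge> 1\<close>.\<close>

definition Lead :: "nat \<Rightarrow> (real \<Rightarrow> cfun) \<Rightarrow> bool" where
  "Lead v \<phi> \<longleftrightarrow> (\<exists>\<eta>. Err v \<eta> \<and> (\<forall>T\<ge>T0. \<forall>x\<in>Rn n. \<phi> T x = of_real (T ^ v) * E T [] x + \<eta> T x / of_real T))"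

lemma Lead_partial:
  assumes "Lead v \<phi>" and i: "i \<in> {1..n}"
  shows "Lead (v + wt i) (\<lambda>T. partial i (\<phi> T))"
proof -
  obtain \<eta> where \<eta>: "Err v \<eta>" "\<And>T x. T \<ge> T0 \<Longrightarrow> x \<in> Rn n \<Longrightarrow> \<phi> T x = of_real (T ^ v) * E T [] x + \<eta> T x / of_real T"
    using assms(1) unfolding Lead_def by blast
  obtain \<eta>' where \<eta>': "Err (v + wt i) \<eta>'" "\<And>T x. T \<ge> T0 \<Longrightarrow> x \<in> Rn n \<Longrightarrow> ((\<lambda>s. \<eta> T (x(i := s))) has_vector_derivative \<eta>' T x) (at (x i))"
    using Err_deriv[OF i \<eta>(1)] by blast
  let ?\<zeta> = "\<lambda>T x. \<eta>' T x + ((- of_real (T ^ (v + 1))) * E T [i] x + of_real (T ^ (v + 1)) * E T [i - 1] x)"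
  have e1: "Err (v + wt i) (\<lambda>T x. (- of_real (T ^ (v + 1))) * E T [i] x)"
    by (rule Err_mono[OF Err.single[where K=1 and v="v + 1"]]) (use T0 wt[OF i] in \<open>auto simp: norm_power norm_mult\<close>)
  have e2: "Err (v + wt i) (\<lambda>T x. of_real (T ^ (v + 1)) * E T [i - 1] x)"
    by (rule Err_mono[OF Err.single[where K=1 and v="v + 1"]]) (use T0 wt[OF i] in \<open>auto simp: norm_power norm_mult\<close>)
  have Z: "Err (v + wt i) ?\<zeta>" by (intro Err.plus \<eta>' e1 e2)
  have "partial i (\<phi> T) x = of_real (T ^ (v + wt i)) * E T [] x + ?\<zeta> T x / of_real T" if T: "T \<ge> T0" and x: "x \<in> Rn n" for T x
  proof (rule partial_eqI)
    have T0': "T \<noteq> 0" using T T0 by auto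
    have "((\<lambda>s. of_real (T ^ v) * E T [] (x(i := s)) + \<eta> T (x(i := s)) / of_real T) has_vector_derivative
       of_real (T ^ v) * (of_real (T ^ wt i + count_diff [] i) * E T [] x - E T [i] x + E T [i - 1] x) + \<eta>' T x / of_real T) (at (x i))"
      unfolding divide_inverse
      by (intro has_vector_derivative_add has_vector_derivative_mult_right has_vector_derivative_mult_left E_deriv T i \<eta>'(2) x)
    moreover have "of_real (T ^ v) * (of_real (T ^ wt i + count_diff [] i) * E T [] x - E T [i] x + E T [i - 1] x) + \<eta>' T x / of_real T
       = of_real (T ^ (v + wt i)) * E T [] x + ?\<zeta> T x / of_real T"
      using T0' by (simp add: count_diff_def power_add field_simps)
    ultimately show "((\<lambda>s. \<phi> T (x(i := s))) has_vector_derivative of_real (T ^ (v + wt i)) * E T [] x + ?\<zeta> T x / of_real T) (at (x i))"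
      using \<eta>(2)[OF T] x i by simp
  qed
  with Z show ?thesis unfolding Lead_def by blast
qed

lemma Lead_word:
  assumes "Lead 0 \<phi>"
  shows "w \<in> lists {1..n} \<Longrightarrow> Lead (sum_list (map wt w)) (\<lambda>T. foldr partial w (\<phi> T))"
proof (induction w)
  case (Cons i w)
  then have "Lead (sum_list (map wt w) + wt i) (\<lambda>T. partial i (foldr partial w (\<phi> T)))"
    by (intro Lead_partial) auto
  then show ?case by (simp add: add.commute)
qed (use assms in simp)

end

lemma (in growth_class) foldr_partial_cmult:
  assumes f: "controlled f"
  shows "w \<in> lists {1..n} \<Longrightarrow> x \<in> Rn n \<Longrightarrow> foldr partial w (\<lambda>x. c * f x) x = c * foldr partial w f x \<and> controlled (foldr partial w f)"
proof (induction w arbitrary: x)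
  case (Cons i w)
  then have i: "i \<in> {1..n}" and w: "w \<in> lists {1..n}" by auto
  have g: "controlled (foldr partial w f)" using Cons.IH[OF w Cons.prems(2)] by blast
  have "partial i (foldr partial w (\<lambda>x. c * f x)) x = partial i (\<lambda>x. c * foldr partial w f x) x"
    using Cons.IH[OF w] by (intro partial_cong_Rn[OF _ i Cons.prems(2)]) blast
  also have "\<dots> = c * partial i (foldr partial w f) x"
    by (intro partial_eqI has_vector_derivative_mult_right controlled_has_partial[OF g i Cons.prems(2)])
  finally show ?case using controlled_partial[OF g i] by simp
qed (use f in simp)

lemma funpow_partial: "(partial i ^^ m) f = foldr partial (replicate m i) f"
  by (induction m) auto

fun mi_word :: "nat \<Rightarrow> (nat \<Rightarrow> nat) \<Rightarrow> nat list" where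
  "mi_word 0 \<alpha> = []"
| "mi_word (Suc k) \<alpha> = replicate (\<alpha> (Suc k)) (Suc k) @ mi_word k \<alpha>"

lemma multi_partial_word: "multi_partial k \<alpha> f = foldr partial (mi_word k \<alpha>) f"
  by (induction k) (simp_all only: multi_partial.simps mi_word.simps foldr_append funpow_partial foldr_Nil id_apply)

lemma mi_word_lists: "k \<le> n \<Longrightarrow> mi_word k \<alpha> \<in> lists {1..n}"
  by (induction k) auto

lemma mi_word_weight: "sum_list (map wt (mi_word k \<alpha>)) = (\<Sum>i=1..k. \<alpha> i * wt i)"
  by (induction k) (auto simp: sum_list_replicate)

lemma multi_partial_cong: "(\<And>i. i \<in> {1..k} \<Longrightarrow> \<alpha> i = \<beta> i) \<Longrightarrow> multi_partial k \<alpha> f = multi_partial k \<beta> f"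
  by (induction k) auto

lemma foldr_partial_cong_Rn:
  assumes "\<And>x. x \<in> Rn n \<Longrightarrow> f x = g x"
  shows "w \<in> lists {1..n} \<Longrightarrow> x \<in> Rn n \<Longrightarrow> foldr partial w f x = foldr partial w g x"
proof (induction w arbitrary: x)
  case (Cons i w)
  then show ?case by (auto intro!: partial_cong_Rn[where n=n])
qed (use assms in simp)

lemma multi_partial_cong_Rn:
  assumes "\<And>x. x \<in> Rn n \<Longrightarrow> f x = g x" "x \<in> Rn n"
  shows "multi_partial n \<alpha> f x = multi_partial n \<alpha> g x"
  unfolding multi_partial_word using assms by (intro foldr_partial_cong_Rn mi_word_lists) auto

lemma digit_sum_less:
  fixes B :: nat
  assumes "\<And>i. i \<in> {1..n} \<Longrightarrow> \<alpha> i < B" "B \<ge> 1"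
  shows "(\<Sum>i=1..n. \<alpha> i * B ^ i) < B ^ (n + 1)"
  using assms(1)
proof (induction n)
  case (Suc n)
  have "(\<Sum>i=1..Suc n. \<alpha> i * B ^ i) < B ^ (n + 1) + \<alpha> (Suc n) * B ^ (n + 1)" using Suc by simp
  also have "\<dots> = (\<alpha> (Suc n) + 1) * B ^ (n + 1)" by simp
  also have "\<dots> \<le> B * B ^ (n + 1)" using Suc.prems[of "Suc n"] by (intro mult_right_mono) auto
  finally show ?case by simp
qed (use assms(2) in auto)

text \<open>
  Multi-indices are encoded by their digits in base \<open>B\<close>, so that different derivatives have different orders in \<open>T\<close>.
\<close>

lemma digit_sum_inj:
  fixes B :: nat
  assumes B: "B \<ge> 1"
  shows "(\<And>i. i \<in> {1..n} \<Longrightarrow> \<alpha> i < B) \<Longrightarrow> (\<And>i. i \<in> {1..n} \<Longrightarrow> \<beta> i < B) \<Longrightarrow>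
    (\<Sum>i=1..n. \<alpha> i * B ^ i) = (\<Sum>i=1..n. \<beta> i * B ^ i) \<Longrightarrow> i \<in> {1..n} \<Longrightarrow> \<alpha> i = \<beta> i"
proof (induction n)
  case (Suc n)
  have l: "(\<Sum>i=1..n. \<alpha> i * B ^ i) < B ^ (n + 1)" "(\<Sum>i=1..n. \<beta> i * B ^ i) < B ^ (n + 1)"
    using Suc.prems B by (intro digit_sum_less; auto)+
  have eq: "(\<Sum>i=1..n. \<alpha> i * B ^ i) + \<alpha> (Suc n) * B ^ (n + 1) = (\<Sum>i=1..n. \<beta> i * B ^ i) + \<beta> (Suc n) * B ^ (n + 1)"
    using Suc.prems(3) by simp
  then have "((\<Sum>i=1..n. \<alpha> i * B ^ i) + \<alpha> (Suc n) * B ^ (n + 1)) div B ^ (n + 1) = ((\<Sum>i=1..n. \<beta> i * B ^ i) + \<beta> (Suc n) * B ^ (n + 1)) div B ^ (n + 1)"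
    by (rule arg_cong)
  then have top: "\<alpha> (Suc n) = \<beta> (Suc n)" using l B by simp
  then have "(\<Sum>i=1..n. \<alpha> i * B ^ i) = (\<Sum>i=1..n. \<beta> i * B ^ i)" using eq by simp
  then show ?case using Suc top by (cases "i = Suc n") auto
qed simp

text \<open>
  The exponent of the plane wave at \<open>x i\<close> belongs to the parameter of index \<open>n + 1 - i\<close>, hence the reversed powers. With
  \<open>B, T \<ge> 2\<close> consecutive exponents differ by at least \<open>2\<close>.
\<close>

lemma whittaker_laplace_family:
  assumes n: "n \<ge> 1" and B: "B \<ge> 2"
  defines "lam \<equiv> \<lambda>T k. - \<i> * complex_of_real (T ^ (B ^ (n + 1 - k)))"
  shows "\<exists>M C. laplace_family n (\<lambda>i. B ^ i) M 2 \<and>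
     (\<forall>T\<ge>2. C T > (0::real) \<and> (\<forall>x\<in>Rn n. psi n (lam T) x = of_real (C T) * laplace_family.E n (\<lambda>i. B ^ i) M T [] x) \<and>
       (\<forall>j\<in>{1..<n}. (\<integral>\<^sup>+\<omega>. ennreal (exp (\<omega> j)) \<partial>M T) \<le> of_nat j))"
proof -
  let ?a = "\<lambda>T k. T ^ (B ^ (n + 1 - k)) :: real"
  define R where "R T C M \<longleftrightarrow> C > 0 \<and> emeasure M (space M) = 1 \<and> sets M = sets seq_borel \<and>
    (\<forall>x\<in>Rn n. wp n (?a T) x = ennreal (C * exp (\<Sum>i=1..n. ?a T (n + 1 - i) * x i)) * (\<integral>\<^sup>+\<omega>. ennreal (exp (- tilt n \<omega> x)) \<partial>M)) \<and>
    (\<forall>j\<in>{1..<n}. (\<integral>\<^sup>+\<omega>. ennreal (exp (\<omega> j)) \<partial>M) \<le> of_nat j)" for T and C :: real and M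
  have ex: "\<exists>C M. R T C M" if T: "T \<ge> 2" for T
    unfolding R_def
  proof (rule wp_laplace[OF _ n])
    fix k assume k: "1 \<le> k" "k < n"
    let ?i = "n - k"
    have e: "n + 1 - k = Suc ?i" "n + 1 - (k + 1) = ?i" using k by auto
    have "B ^ ?i + 1 \<le> B ^ Suc ?i"
    proof -
      have "B ^ ?i + 1 \<le> B ^ ?i + B ^ ?i" using B by simp
      also have "\<dots> \<le> B * B ^ ?i" using B by (metis mult_2 mult_le_mono1)
      finally show ?thesis by simp
    qed
    then have "T ^ (B ^ ?i + 1) \<le> T ^ (B ^ Suc ?i)" using T by (intro power_increasing) auto
    moreover have "2 * T ^ (B ^ ?i) \<le> T ^ (B ^ ?i + 1)" using T by (simp add: mult_right_mono)
    moreover have "2 \<le> T ^ (B ^ ?i)"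
      using power_increasing[of 1 "B ^ ?i" T] T B by simp
    ultimately show "?a T (k + 1) + 2 \<le> ?a T k" unfolding e by linarith
  qed
  then obtain C M where "\<And>T. T \<ge> 2 \<Longrightarrow> R T (C T) (M T)" by metis
  note CM = this[unfolded R_def]
  interpret laplace_family n "\<lambda>i. B ^ i" M 2
    by standard (use CM B in auto)
  have "psi n (lam T) x = of_real (C T) * E T [] x" if T: "T \<ge> 2" and x: "x \<in> Rn n" for T x
  proof -
    have fin: "finite_measure (M T)" by (rule finite_measureI) (simp add: M1[OF T])
    interpret finite_measure "M T" by fact
    have C: "C T > 0" using CM[OF T] by blast
    have r: "psi n (lam T) x = of_real (Re (psi n (lam T) x))" "Re (psi n (lam T) x) \<ge> 0" "wp n (?a T) x = ennreal (Re (psi n (lam T) x))"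
      using psi_real[OF x, of "?a T"] unfolding lam_def by auto
    have "(\<integral>\<^sup>+\<omega>. ennreal (exp (- tilt n \<omega> x)) \<partial>M T) = ennreal (laplace_moment n (M T) [] x)"
      using nn_integral_eq_integral[OF tilt_monom_integrable[OF fin Ms[OF T], of n "[]" x]] tilt_monom_bounds(1)
      by (simp add: laplace_moment_def tilt_monom_def)
    moreover have "(\<Sum>i=1..n. ?a T (n + 1 - i) * x i) = (\<Sum>i=1..n. T ^ B ^ i * x i)"
      by (intro sum.cong refl) (simp add: Suc_diff_le)
    ultimately have "ennreal (Re (psi n (lam T) x)) = ennreal (C T * plane_wave T x) * ennreal (laplace_moment n (M T) [] x)"
      using CM[OF T] x r(3) by (simp add: plane_wave_def)
    also have "\<dots> = ennreal (C T * plane_wave T x * laplace_moment n (M T) [] x)"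
      using C laplace_moment_bounds(1)[OF M1[OF T] Ms[OF T]] by (intro ennreal_mult[symmetric]) (auto simp: plane_wave_def)
    finally have "Re (psi n (lam T) x) = C T * plane_wave T x * laplace_moment n (M T) [] x"
      using C r(2) laplace_moment_bounds(1)[OF M1[OF T] Ms[OF T]] by (subst (asm) ennreal_inj) (auto simp: plane_wave_def)
    then show ?thesis using r(1) by (simp add: E_def)
  qed
  then show ?thesis using CM laplace_family_axioms by blast
qed

lemma finite_has_maximal_weight:
  fixes f :: "'a \<Rightarrow> nat"
  assumes "finite S" "S \<noteq> {}"
  shows "\<exists>a\<in>S. \<forall>b\<in>S. f b \<le> f a"
proof -
  have "Max (f ` S) \<in> f ` S" using assms by (intro Max_in) auto
  then obtain a where "a \<in> S" "f a = Max (f ` S)" by auto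
  then show ?thesis using assms by (intro bexI[of _ a]) auto
qed

text \<open>
  Among the functions that a combination of derivatives at \<open>x\<close> has to annihilate, the Whittaker functions with imaginary parameters suffice. Multi-indices that agree
  on \<open>1, \<dots>, n\<close> denote the same derivative and are first collected. Among the derivatives that then have a
  nonzero coefficient, the one of the highest order in \<open>T\<close> dominates the others as \<open>T\<close> grows, which is a contradiction.
\<close>

theorem whittaker_jets_span:
  fixes c :: "'i \<Rightarrow> complex" and \<alpha> :: "'i \<Rightarrow> nat \<Rightarrow> nat"
  assumes n: "n \<ge> 1" and x: "x \<in> Rn n" and I: "finite I"
    and zero: "\<And>a::nat \<Rightarrow> real. (\<Sum>i\<in>I. c i * multi_partial n (\<alpha> i) (psi n (\<lambda>k. - \<i> * of_real (a k))) x) = 0"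
  shows "(\<Sum>i\<in>I. c i * multi_partial n (\<alpha> i) f x) = 0"
proof -
  define r :: "'i \<Rightarrow> nat \<Rightarrow> nat" where "r i = (\<lambda>j. if j \<in> {1..n} then \<alpha> i j else 0)" for i
  define d where "d \<beta> = (\<Sum>i\<in>{i\<in>I. r i = \<beta>}. c i)" for \<beta>
  let ?A = "r ` I"
  have fA: "finite ?A" using I by simp
  have regroup: "(\<Sum>i\<in>I. c i * multi_partial n (\<alpha> i) g x) = (\<Sum>\<beta>\<in>?A. d \<beta> * multi_partial n \<beta> g x)" for g
  proof -
    have "(\<Sum>i\<in>I. c i * multi_partial n (\<alpha> i) g x) = (\<Sum>i\<in>I. c i * multi_partial n (r i) g x)"
      by (intro sum.cong refl arg_cong2[where f="(*)"] fun_cong[OF multi_partial_cong]) (simp add: r_def)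
    also have "\<dots> = (\<Sum>\<beta>\<in>?A. \<Sum>i\<in>{i\<in>I. r i = \<beta>}. c i * multi_partial n (r i) g x)"
      by (rule sum.image_gen[OF I])
    also have "\<dots> = (\<Sum>\<beta>\<in>?A. d \<beta> * multi_partial n \<beta> g x)"
      unfolding d_def sum_distrib_right by (intro sum.cong) auto
    finally show ?thesis .
  qed
  have "d \<beta> = 0" if "\<beta> \<in> ?A" for \<beta>
  proof (rule ccontr)
    assume nz: "d \<beta> \<noteq> 0"
    \<comment> \<open>The base exceeds every entry of the finitely many multi-indices.\<close>
    define B where "B = 2 + (\<Sum>\<alpha>\<in>?A. \<Sum>i=1..n. \<alpha> i)"
    have B2: "B \<ge> 2" by (simp add: B_def)
    have dig: "\<alpha> i < B" if "\<alpha> \<in> ?A" "i \<in> {1..n}" for \<alpha> i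
    proof -
      have "\<alpha> i \<le> (\<Sum>i=1..n. \<alpha> i)" using that(2) by (intro member_le_sum) auto
      also have "\<dots> \<le> (\<Sum>\<alpha>\<in>?A. \<Sum>i=1..n. \<alpha> i)" using that(1) fA by (intro member_le_sum) auto
      finally show ?thesis by (simp add: B_def)
    qed
    define wgt where "wgt \<alpha> = (\<Sum>i=1..n. \<alpha> i * B ^ i)" for \<alpha> :: "nat \<Rightarrow> nat"
    have wgt_inj: "\<alpha> = \<alpha>'" if "\<alpha> \<in> ?A" "\<alpha>' \<in> ?A" "wgt \<alpha> = wgt \<alpha>'" for \<alpha> \<alpha>'
    proof
      fix i
      show "\<alpha> i = \<alpha>' i"
      proof (cases "i \<in> {1..n}")
        case True
        then show ?thesis using digit_sum_inj[of B n \<alpha> \<alpha>' i] B2 dig that unfolding wgt_def by auto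
      next
        case False
        then show ?thesis using that(1,2) by (auto simp: r_def)
      qed
    qed
    let ?S = "{\<alpha>\<in>?A. d \<alpha> \<noteq> 0}"
    have "finite ?S" "?S \<noteq> {}" using fA nz that by auto
    then obtain \<alpha>s where \<alpha>s: "\<alpha>s \<in> ?S" "\<And>\<alpha>. \<alpha> \<in> ?S \<Longrightarrow> wgt \<alpha> \<le> wgt \<alpha>s"
      using finite_has_maximal_weight[of ?S wgt] by blast
    define lam where "lam T k = - \<i> * complex_of_real (T ^ (B ^ (n + 1 - k)))" for T k
    obtain M C where L: "laplace_family n (\<lambda>i. B ^ i) M 2" and C: "\<And>T. T \<ge> 2 \<Longrightarrow> C T > (0::real)"
      and psiE: "\<And>T x. T \<ge> 2 \<Longrightarrow> x \<in> Rn n \<Longrightarrow> psi n (lam T) x = of_real (C T) * laplace_family.E n (\<lambda>i. B ^ i) M T [] x"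
      and mom: "\<And>T j. T \<ge> 2 \<Longrightarrow> j \<in> {1..<n} \<Longrightarrow> (\<integral>\<^sup>+\<omega>. ennreal (exp (\<omega> j)) \<partial>M T) \<le> of_nat j"
      using whittaker_laplace_family[OF n B2] unfolding lam_def by blast
    interpret L: laplace_family n "\<lambda>i. B ^ i" M 2 by (rule L)
    \<comment> \<open>Normalized Whittaker functions: plane waves times Laplace transforms of probability measures.\<close>
    define \<phi> where "\<phi> T = (\<lambda>x. inverse (of_real (C T)) * psi n (lam T) x)" for T
    define D where "D \<alpha> T = multi_partial n \<alpha> (\<phi> T) x" for \<alpha> T
    have sumD: "(\<Sum>\<alpha>\<in>?A. d \<alpha> * D \<alpha> T) = 0" if "T \<ge> 2" for T
    proof -
      have "D \<alpha> T = inverse (of_real (C T)) * multi_partial n \<alpha> (psi n (lam T)) x" for \<alpha>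
        unfolding D_def \<phi>_def multi_partial_word
        using tame.foldr_partial_cmult[OF psi_tame mi_word_lists[OF order_refl] x] by blast
      then have "(\<Sum>\<alpha>\<in>?A. d \<alpha> * D \<alpha> T) = inverse (of_real (C T)) * (\<Sum>\<alpha>\<in>?A. d \<alpha> * multi_partial n \<alpha> (psi n (lam T)) x)"
        by (simp add: sum_distrib_left mult_ac)
      also have "(\<Sum>\<alpha>\<in>?A. d \<alpha> * multi_partial n \<alpha> (psi n (lam T)) x) = 0"
      proof -
        have "lam T = (\<lambda>k. - \<i> * complex_of_real (T ^ (B ^ (n + 1 - k))))" by (intro ext) (simp only: lam_def)
        then show ?thesis using zero[of "\<lambda>k. T ^ (B ^ (n + 1 - k))"] unfolding regroup by (simp only:)
      qed
      finally show ?thesis by simp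
    qed
    have "L.Err 0 (\<lambda>T x. 0 * L.E T [] x)" by (rule L.Err.single[where K=0]) simp
    then have "L.Lead 0 \<phi>"
      unfolding L.Lead_def using C psiE by (intro exI[of _ "\<lambda>T x. 0 * L.E T [] x"]) (force simp: \<phi>_def)
    then have lead: "L.Lead (wgt \<alpha>) (\<lambda>T. multi_partial n \<alpha> (\<phi> T))" for \<alpha>
      using L.Lead_word[OF _ mi_word_lists[OF order_refl], of \<phi> \<alpha>] unfolding multi_partial_word mi_word_weight wgt_def by blast
    have "\<exists>\<eta> K. \<forall>T\<ge>2. D \<alpha> T = of_real (T ^ wgt \<alpha>) * L.E T [] x + \<eta> T / of_real T \<and> norm (\<eta> T) \<le> K * T ^ wgt \<alpha> * L.plane_wave T x" for \<alpha>
    proof -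
      obtain \<eta> where e: "L.Err (wgt \<alpha>) \<eta>" and D: "\<And>T. T \<ge> 2 \<Longrightarrow> D \<alpha> T = of_real (T ^ wgt \<alpha>) * L.E T [] x + \<eta> T x / of_real T"
        using lead[of \<alpha>] x unfolding L.Lead_def D_def by blast
      obtain K where "\<And>T. T \<ge> 2 \<Longrightarrow> norm (\<eta> T x) \<le> K * T ^ wgt \<alpha> * L.plane_wave T x"
        using L.Err_bound[OF e, of x] by blast
      with D show ?thesis by (intro exI[of _ "\<lambda>T. \<eta> T x"] exI[of _ K]) auto
    qed
    then obtain \<eta> where "\<forall>\<alpha>. \<exists>K. \<forall>T\<ge>2. D \<alpha> T = of_real (T ^ wgt \<alpha>) * L.E T [] x + \<eta> \<alpha> T / of_real T \<and> norm (\<eta> \<alpha> T) \<le> K * T ^ wgt \<alpha> * L.plane_wave T x"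
      using choice[of "\<lambda>\<alpha> \<eta>. \<exists>K. \<forall>T\<ge>2. D \<alpha> T = of_real (T ^ wgt \<alpha>) * L.E T [] x + \<eta> T / of_real T \<and> norm (\<eta> T) \<le> K * T ^ wgt \<alpha> * L.plane_wave T x"] by blast
    from choice[OF this] obtain K where \<eta>: "\<And>\<alpha> T. T \<ge> 2 \<Longrightarrow> D \<alpha> T = of_real (T ^ wgt \<alpha>) * L.E T [] x + \<eta> \<alpha> T / of_real T"
      and K: "\<And>\<alpha> T. T \<ge> 2 \<Longrightarrow> norm (\<eta> \<alpha> T) \<le> K \<alpha> * T ^ wgt \<alpha> * L.plane_wave T x" by blast
    have pw: "L.plane_wave T x > 0" for T by (simp add: L.plane_wave_def)
    have K0: "K \<alpha> \<ge> 0" for \<alpha>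
    proof -
      have "0 \<le> K \<alpha> * (2 ^ wgt \<alpha> * L.plane_wave 2 x)" using order_trans[OF norm_ge_zero K[of 2 \<alpha>]] by (simp add: mult.assoc)
      moreover have "2 ^ wgt \<alpha> * L.plane_wave 2 x > 0" using pw[of 2] by simp
      ultimately show ?thesis by (metis zero_le_mult_iff not_less)
    qed
    define \<kappa> where "\<kappa> = exp (- (\<Sum>j=1..<n. real j * exp (x j - x (j + 1))))"
    define Kb where "Kb = norm (d \<alpha>s) * K \<alpha>s + (\<Sum>\<alpha>\<in>?A - {\<alpha>s}. norm (d \<alpha>) * (1 + K \<alpha>))"
    \<comment> \<open>The dominant term is bounded below by \<open>\<kappa>\<close>, and all others lose at least one factor \<open>T\<close>.\<close>
    have main: "norm (d \<alpha>s) * \<kappa> * T \<le> Kb" if T: "T \<ge> 2" for T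
    proof -
      let ?p = "T ^ wgt \<alpha>s * L.plane_wave T x"
      have p: "?p > 0" using T pw[of T] by simp
      have small: "norm (d \<alpha> * D \<alpha> T) * T \<le> (norm (d \<alpha>) * (1 + K \<alpha>)) * ?p" if \<alpha>: "\<alpha> \<in> ?A - {\<alpha>s}" for \<alpha>
      proof (cases "d \<alpha> = 0")
        case False
        then have "wgt \<alpha> \<le> wgt \<alpha>s" "wgt \<alpha> \<noteq> wgt \<alpha>s" using \<alpha> \<alpha>s wgt_inj[of \<alpha> \<alpha>s] by auto
        then have pow: "T ^ wgt \<alpha> * T \<le> T ^ wgt \<alpha>s"
          using power_increasing[of "Suc (wgt \<alpha>)" "wgt \<alpha>s" T] T by (simp add: mult.commute)
        have E1: "norm (L.E T [] x) \<le> L.plane_wave T x" using L.E_bound[OF T, of "[]" x] by simp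
        have "norm (D \<alpha> T) \<le> T ^ wgt \<alpha> * norm (L.E T [] x) + norm (\<eta> \<alpha> T) / T"
          unfolding \<eta>[OF T] using T by (intro norm_triangle_le) (simp add: norm_mult norm_power norm_divide)
        also have "\<dots> \<le> T ^ wgt \<alpha> * L.plane_wave T x + K \<alpha> * T ^ wgt \<alpha> * L.plane_wave T x"
        proof (rule add_mono)
          show "T ^ wgt \<alpha> * norm (L.E T [] x) \<le> T ^ wgt \<alpha> * L.plane_wave T x"
            using E1 T by (intro mult_left_mono) auto
          have "norm (\<eta> \<alpha> T) / T \<le> norm (\<eta> \<alpha> T) / 1" using T by (intro divide_left_mono) auto
          then show "norm (\<eta> \<alpha> T) / T \<le> K \<alpha> * T ^ wgt \<alpha> * L.plane_wave T x" using K[OF T, of \<alpha>] by simp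
        qed
        finally have "norm (D \<alpha> T) * T \<le> (1 + K \<alpha>) * (T ^ wgt \<alpha> * T) * L.plane_wave T x"
          using T mult_right_mono[of "norm (D \<alpha> T)" _ T] by (fastforce simp: algebra_simps)
        also have "\<dots> \<le> (1 + K \<alpha>) * T ^ wgt \<alpha>s * L.plane_wave T x"
          using pow K0[of \<alpha>] pw[of T] by (intro mult_right_mono mult_left_mono) auto
        finally have "norm (d \<alpha>) * (norm (D \<alpha> T) * T) \<le> norm (d \<alpha>) * ((1 + K \<alpha>) * T ^ wgt \<alpha>s * L.plane_wave T x)"
          by (rule mult_left_mono) simp
        then show ?thesis by (simp add: norm_mult mult_ac)
      qed simp
      have "d \<alpha>s * D \<alpha>s T = - (\<Sum>\<alpha>\<in>?A - {\<alpha>s}. d \<alpha> * D \<alpha> T)"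
        using sumD[OF T] \<alpha>s(1) fA by (simp add: sum.remove[of ?A \<alpha>s] add_eq_0_iff)
      then have "norm (d \<alpha>s * D \<alpha>s T) * T \<le> (\<Sum>\<alpha>\<in>?A - {\<alpha>s}. norm (d \<alpha> * D \<alpha> T)) * T"
        using T by (intro mult_right_mono) (auto simp: norm_sum)
      also have "\<dots> \<le> (\<Sum>\<alpha>\<in>?A - {\<alpha>s}. norm (d \<alpha>) * (1 + K \<alpha>)) * ?p"
        unfolding sum_distrib_right by (intro sum_mono small)
      finally have 1: "norm (d \<alpha>s * D \<alpha>s T) * T \<le> (\<Sum>\<alpha>\<in>?A - {\<alpha>s}. norm (d \<alpha>) * (1 + K \<alpha>)) * ?p" .
      have "of_real (T ^ wgt \<alpha>s) * L.E T [] x = D \<alpha>s T - \<eta> \<alpha>s T / of_real T" using \<eta>[OF T, of \<alpha>s] by simp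
      then have "T ^ wgt \<alpha>s * norm (L.E T [] x) = norm (D \<alpha>s T - \<eta> \<alpha>s T / of_real T)"
        using T by (metis abs_of_nonneg norm_mult norm_of_real order_trans zero_le_numeral zero_le_power)
      also have "\<dots> \<le> norm (D \<alpha>s T) + norm (\<eta> \<alpha>s T) / T"
        using norm_triangle_ineq4[of "D \<alpha>s T" "\<eta> \<alpha>s T / of_real T"] T by (simp add: norm_divide)
      finally have "(T ^ wgt \<alpha>s * norm (L.E T [] x)) * T \<le> (norm (D \<alpha>s T) + norm (\<eta> \<alpha>s T) / T) * T"
        using T by (intro mult_right_mono) auto
      also have "\<dots> = norm (D \<alpha>s T) * T + norm (\<eta> \<alpha>s T)" using T by (simp add: distrib_right)
      also have "\<dots> \<le> norm (D \<alpha>s T) * T + K \<alpha>s * ?p" using K[OF T, of \<alpha>s] by (simp add: mult.assoc)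
      finally have 2: "(T ^ wgt \<alpha>s * norm (L.E T [] x)) * T \<le> norm (D \<alpha>s T) * T + K \<alpha>s * ?p" .
      have "\<kappa> \<le> laplace_moment n (M T) [] x"
        unfolding \<kappa>_def by (rule laplace_moment_lower_bound[OF L.M1[OF T] L.Ms[OF T] mom[OF T]])
      then have "L.plane_wave T x * \<kappa> \<le> norm (L.E T [] x)"
        using pw[of T] laplace_moment_bounds(1)[OF L.M1[OF T] L.Ms[OF T], of n "[]" x]
        by (simp add: L.E_def norm_mult mult_left_mono)
      then have "?p * (\<kappa> * T) \<le> (T ^ wgt \<alpha>s * norm (L.E T [] x)) * T"
        using T by (simp add: mult.assoc mult_left_mono mult_right_mono mult.left_commute[of _ T] mult.commute[of _ T])
      then have "norm (d \<alpha>s) * (?p * (\<kappa> * T)) \<le> norm (d \<alpha>s) * (norm (D \<alpha>s T) * T + K \<alpha>s * ?p)"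
        using 2 by (intro mult_left_mono) auto
      also have "\<dots> \<le> Kb * ?p" using 1 by (simp add: Kb_def norm_mult algebra_simps)
      finally have "(norm (d \<alpha>s) * \<kappa> * T) * ?p \<le> Kb * ?p" by (simp add: mult_ac)
      then show ?thesis using p by (rule mult_right_le_imp_le)
    qed
    have q: "norm (d \<alpha>s) * \<kappa> > 0" using \<alpha>s(1) by (simp add: \<kappa>_def)
    define T where "T = max 2 (Kb / (norm (d \<alpha>s) * \<kappa>) + 1)"
    have "Kb / (norm (d \<alpha>s) * \<kappa>) < T" by (simp add: T_def)
    then have "Kb < norm (d \<alpha>s) * \<kappa> * T" using q by (simp add: divide_less_eq mult_ac)
    with main[of T] show False by (simp add: T_def)
  qed
  then show ?thesis unfolding regroup by simp
qed

section \<open>Normal forms of differential operators\<close>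

lemma multi_partial_zero: "multi_partial k (\<lambda>_. 0) f = f"
  by (induction k) auto

text \<open>
  The operator is a combination of derivatives in the first \<open>k\<close> variables with coefficients that do not depend on the later ones. Derivatives
  in \<open>multi_partial\<close> are taken in increasing order of the variables, which is also the order in the recursion of \<open>toda_T\<close>; hence
  the normal form is found without exchanging partial derivatives. Terms form a list, since multi-indices may repeat.
\<close>

definition expands :: "nat \<Rightarrow> nat \<Rightarrow> oper \<Rightarrow> bool" where
  "expands n k D \<longleftrightarrow> (\<exists>ts.
     (\<forall>t\<in>set ts. \<forall>x\<in>Rn n. \<forall>j\<in>{k<..n}. \<forall>s. fst t (x(j := s)) = fst t x) \<and>
     (\<forall>f. smooth n f \<longrightarrow> (\<forall>x\<in>Rn n. D f x = (\<Sum>t\<leftarrow>ts. fst t x * multi_partial k (snd t) f x))))"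

lemma expandsE:
  assumes "expands n k D"
  obtains ts where "\<And>t x j s. t \<in> set ts \<Longrightarrow> x \<in> Rn n \<Longrightarrow> j \<in> {k<..n} \<Longrightarrow> fst t (x(j := s)) = fst t x"
    and "\<And>f x. smooth n f \<Longrightarrow> x \<in> Rn n \<Longrightarrow> D f x = (\<Sum>t\<leftarrow>ts. fst t x * multi_partial k (snd t) f x)"
proof -
  from assms obtain ts where h: "\<forall>t\<in>set ts. \<forall>x\<in>Rn n. \<forall>j\<in>{k<..n}. \<forall>s. fst t (x(j := s)) = fst t x"
    "\<forall>f. smooth n f \<longrightarrow> (\<forall>x\<in>Rn n. D f x = (\<Sum>t\<leftarrow>ts. fst t x * multi_partial k (snd t) f x))"
    unfolding expands_def by (elim exE conjE)
  show ?thesis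
  proof (rule that[of ts])
    show "fst t (x(j := s)) = fst t x" if "t \<in> set ts" "x \<in> Rn n" "j \<in> {k<..n}" for t x j s
      using h(1) that by blast
    show "D f x = (\<Sum>t\<leftarrow>ts. fst t x * multi_partial k (snd t) f x)" if "smooth n f" "x \<in> Rn n" for f x
      using h(2) that by simp
  qed
qed

lemma expandsI:
  assumes "\<And>t x j s. t \<in> set ts \<Longrightarrow> x \<in> Rn n \<Longrightarrow> j \<in> {k<..n} \<Longrightarrow> fst t (x(j := s)) = fst t x"
    and "\<And>f x. smooth n f \<Longrightarrow> x \<in> Rn n \<Longrightarrow> D f x = (\<Sum>t\<leftarrow>ts. fst t x * multi_partial k (snd t) f x)"
  shows "expands n k D"
  unfolding expands_def by (rule exI[of _ ts], intro conjI ballI allI impI assms)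

lemma expands_id: "expands n k (\<lambda>f. f)"
  by (rule expandsI[of "[(\<lambda>_. 1, \<lambda>_. 0)]"]) (auto simp: multi_partial_zero)

lemma expands_add:
  assumes "expands n k D1" "expands n k D2"
  shows "expands n k (\<lambda>f x. D1 f x + D2 f x)"
proof -
  obtain ts where 1: "\<And>t x j s. t \<in> set ts \<Longrightarrow> x \<in> Rn n \<Longrightarrow> j \<in> {k<..n} \<Longrightarrow> fst t (x(j := s)) = fst t x"
    "\<And>f x. smooth n f \<Longrightarrow> x \<in> Rn n \<Longrightarrow> D1 f x = (\<Sum>t\<leftarrow>ts. fst t x * multi_partial k (snd t) f x)"
    by (rule expandsE[OF assms(1)]) (rule that)
  obtain us where 2: "\<And>t x j s. t \<in> set us \<Longrightarrow> x \<in> Rn n \<Longrightarrow> j \<in> {k<..n} \<Longrightarrow> fst t (x(j := s)) = fst t x"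
    "\<And>f x. smooth n f \<Longrightarrow> x \<in> Rn n \<Longrightarrow> D2 f x = (\<Sum>t\<leftarrow>us. fst t x * multi_partial k (snd t) f x)"
    by (rule expandsE[OF assms(2)]) (rule that)
  show ?thesis
    by (rule expandsI[of "ts @ us"]) (use 1(1) 2(1) in auto, simp add: 1(2) 2(2))
qed

lemma expands_mult:
  assumes D: "expands n k D" and g: "\<And>x j s. x \<in> Rn n \<Longrightarrow> j \<in> {k<..n} \<Longrightarrow> g (x(j := s)) = g x"
  shows "expands n k (\<lambda>f x. g x * D f x)"
proof -
  obtain ts where 1: "\<And>t x j s. t \<in> set ts \<Longrightarrow> x \<in> Rn n \<Longrightarrow> j \<in> {k<..n} \<Longrightarrow> fst t (x(j := s)) = fst t x"
    "\<And>f x. smooth n f \<Longrightarrow> x \<in> Rn n \<Longrightarrow> D f x = (\<Sum>t\<leftarrow>ts. fst t x * multi_partial k (snd t) f x)"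
    by (rule expandsE[OF D]) (rule that)
  show ?thesis
    by (rule expandsI[of "map (\<lambda>t. (\<lambda>x. g x * fst t x, snd t)) ts"])
      (use 1(1) g in auto, simp add: 1(2) o_def mult.assoc sum_list_const_mult)
qed

lemma expands_sum:
  assumes "finite S" "\<And>j. j \<in> S \<Longrightarrow> expands n k (D j)"
  shows "expands n k (\<lambda>f x. \<Sum>j\<in>S. D j f x)"
  using assms
proof (induction S rule: finite_induct)
  case empty
  show ?case by (rule expandsI[of "[]"]) auto
next
  case (insert j S)
  then show ?case using expands_add[of n k "D j" "\<lambda>f x. \<Sum>j\<in>S. D j f x"] by simp
qed

lemma expands_diff_op:
  assumes "diff_op n D"
  shows "expands n n D"
proof -
  obtain A a where A: "finite A" and D: "D = (\<lambda>f x. \<Sum>\<alpha>\<in>A. a \<alpha> x * multi_partial n \<alpha> f x)"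
    using assms unfolding diff_op_def by blast
  have "expands n n (\<lambda>f x. a \<alpha> x * multi_partial n \<alpha> f x)" for \<alpha>
    by (rule expandsI[of "[(a \<alpha>, \<alpha>)]"]) auto
  then show ?thesis unfolding D by (intro expands_sum A)
qed

lemma expands_toda_t:
  assumes "toda_hamiltonians n H"
  shows "expands n n (toda_t n H \<mu>)"
proof -
  have "expands n n (H j)" if "j \<in> {0..n}" for j
    using assms that expands_id[of n n] by (cases "j = 0") (auto simp: toda_hamiltonians_def intro: expands_diff_op)
  then have "expands n n (\<lambda>f x. \<Sum>j=0..n. ((-1) ^ j * \<mu> ^ (n - j)) * H j f x)"
    by (intro expands_sum expands_mult) auto
  moreover have "toda_t n H \<mu> = (\<lambda>f x. \<Sum>j=0..n. ((-1) ^ j * \<mu> ^ (n - j)) * H j f x)"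
    by (intro ext) (simp only: toda_t_def)
  ultimately show ?thesis by (simp only:)
qed

lemma expands_Suc:
  assumes "expands n k D"
  shows "expands n (Suc k) D"
proof -
  obtain ts where 1: "\<And>t x j s. t \<in> set ts \<Longrightarrow> x \<in> Rn n \<Longrightarrow> j \<in> {k<..n} \<Longrightarrow> fst t (x(j := s)) = fst t x"
    "\<And>f x. smooth n f \<Longrightarrow> x \<in> Rn n \<Longrightarrow> D f x = (\<Sum>t\<leftarrow>ts. fst t x * multi_partial k (snd t) f x)"
    by (rule expandsE[OF assms]) (rule that)
  have "multi_partial k (\<alpha>(Suc k := 0)) f = multi_partial k \<alpha> f" for \<alpha> f by (rule multi_partial_cong) auto
  then show ?thesis
    by (intro expandsI[of "map (\<lambda>t. (fst t, (snd t)(Suc k := 0))) ts"]) (use 1(1) in auto, simp add: 1(2) o_def)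
qed

lemma smooth_multi_partial:
  assumes "smooth n f" "k \<le> n"
  shows "smooth n (multi_partial k \<alpha> f)"
proof -
  have "w \<in> lists {1..n} \<Longrightarrow> smooth_class.controlled n (foldr partial w f)" for w
    by (induction w) (use assms(1) in \<open>auto simp: smooth_class_controlled intro: smooth_class.controlled_partial[unfolded smooth_class_controlled]\<close>)
  then show ?thesis unfolding multi_partial_word using mi_word_lists[OF assms(2)] by (simp only: smooth_class_controlled)
qed

lemma has_vector_derivative_sum_list:
  assumes "\<And>t. t \<in> set ts \<Longrightarrow> (g t has_vector_derivative g' t) F"
  shows "((\<lambda>s. \<Sum>t\<leftarrow>ts. g t s) has_vector_derivative (\<Sum>t\<leftarrow>ts. g' t)) F"
  using assms by (induction ts) (auto intro!: has_vector_derivative_add)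

lemma expands_partial:
  assumes D: "expands n k D" and k: "k < n"
  shows "expands n (Suc k) (\<lambda>f. partial (Suc k) (D f))"
proof -
  obtain ts where 1: "\<And>t x j s. t \<in> set ts \<Longrightarrow> x \<in> Rn n \<Longrightarrow> j \<in> {k<..n} \<Longrightarrow> fst t (x(j := s)) = fst t x"
    "\<And>f x. smooth n f \<Longrightarrow> x \<in> Rn n \<Longrightarrow> D f x = (\<Sum>t\<leftarrow>ts. fst t x * multi_partial k (snd t) f x)"
    by (rule expandsE[OF D]) (rule that)
  have i: "Suc k \<in> {1..n}" using k by auto
  have eq: "partial (Suc k) (D f) x = (\<Sum>t\<leftarrow>ts. fst t x * partial (Suc k) (multi_partial k (snd t) f) x)"
    if f: "smooth n f" and x: "x \<in> Rn n" for f x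
  proof (rule partial_eqI)
    have "((\<lambda>s. \<Sum>t\<leftarrow>ts. fst t x * multi_partial k (snd t) f (x(Suc k := s))) has_vector_derivative
       (\<Sum>t\<leftarrow>ts. fst t x * partial (Suc k) (multi_partial k (snd t) f) x)) (at (x (Suc k)))"
      using smooth_multi_partial[OF f] k
      by (intro has_vector_derivative_sum_list has_vector_derivative_mult_right
          smooth_class.controlled_has_partial[OF _ i x, unfolded smooth_class_controlled]) auto
    moreover have "D f (x(Suc k := s)) = (\<Sum>t\<leftarrow>ts. fst t x * multi_partial k (snd t) f (x(Suc k := s)))" for s
      unfolding 1(2)[OF f Rn_upd[OF x i]]
      by (intro arg_cong[where f=sum_list] map_cong refl arg_cong2[where f="(*)"] 1(1) x) (use k in auto)
    ultimately show "((\<lambda>s. D f (x(Suc k := s))) has_vector_derivative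
       (\<Sum>t\<leftarrow>ts. fst t x * partial (Suc k) (multi_partial k (snd t) f) x)) (at (x (Suc k)))" by (simp only:)
  qed
  have "multi_partial k (\<alpha>(Suc k := 1)) f = multi_partial k \<alpha> f" for \<alpha> f by (rule multi_partial_cong) auto
  then show ?thesis
    by (intro expandsI[of "map (\<lambda>t. (fst t, (snd t)(Suc k := 1))) ts"]) (use 1(1) in auto, simp add: eq o_def)
qed

lemma expands_toda_T: "k \<le> n \<Longrightarrow> expands n k (toda_T \<mu> k)"
proof (induction k rule: less_induct)
  case (less k)
  show ?case
  proof (cases k)
    case 0
    have "toda_T \<mu> 0 = (\<lambda>f. f)" by (intro ext) simp
    then show ?thesis using expands_id[of n 0] 0 by simp
  next
    case (Suc j)
    have 1: "expands n j (toda_T \<mu> j)" using less Suc by auto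
    have 2: "expands n (Suc j) (toda_T \<mu> (j - 1))"
    proof (cases j)
      case 0
      then show ?thesis using expands_Suc[OF 1] by simp
    next
      case (Suc i)
      then have "expands n i (toda_T \<mu> i)" using less \<open>k = Suc j\<close> by auto
      then show ?thesis using expands_Suc[OF expands_Suc] Suc by simp
    qed
    have "expands n (Suc j) (\<lambda>f x. (\<mu> * toda_T \<mu> j f x + \<i> * partial (Suc j) (toda_T \<mu> j f) x) + (- bond j x) * toda_T \<mu> (j - 1) f x)"
      by (intro expands_add expands_mult 2 expands_Suc[OF 1] expands_partial[OF 1]) (use less(2) Suc in \<open>auto simp: bond_def\<close>)
    moreover have "toda_T \<mu> (Suc j) = (\<lambda>f x. (\<mu> * toda_T \<mu> j f x + \<i> * partial (Suc j) (toda_T \<mu> j f) x) + (- bond j x) * toda_T \<mu> (j - 1) f x)"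
      by (intro ext) simp
    ultimately show ?thesis by (simp only: Suc)
  qed
qed

text \<open>
  Both operators have the same eigenvalue on every Whittaker function with imaginary spectral parameters, so their
  difference is a combination of derivatives that vanishes on all of these.
\<close>

theorem toda_t_eq_toda_T:
  assumes H: "toda_hamiltonians (l + 1) H" and f: "smooth (l + 1) f" and x: "x \<in> Rn (l + 1)"
  shows "toda_t (l + 1) H \<mu> f x = toda_T \<mu> (l + 1) f x"
proof -
  let ?n = "l + 1"
  have "expands ?n ?n (\<lambda>f x. toda_t ?n H \<mu> f x + (-1) * toda_T \<mu> ?n f x)"
    by (intro expands_add expands_mult expands_toda_t[OF H] expands_toda_T order_refl refl)
  then obtain ts where ts: "\<And>f x. smooth ?n f \<Longrightarrow> x \<in> Rn ?n \<Longrightarrow>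
      toda_t ?n H \<mu> f x + (-1) * toda_T \<mu> ?n f x = (\<Sum>t\<leftarrow>ts. fst t x * multi_partial ?n (snd t) f x)"
    by (rule expandsE) (rule that)
  define c where "c i = fst (ts ! i) x" for i
  define \<alpha> where "\<alpha> i = snd (ts ! i)" for i
  let ?I = "{0..<length ts}"
  have c: "toda_t ?n H \<mu> f x + (-1) * toda_T \<mu> ?n f x = (\<Sum>i\<in>?I. c i * multi_partial ?n (\<alpha> i) f x)" if "smooth ?n f" for f
    unfolding ts[OF that x] c_def \<alpha>_def by (subst sum_list_sum_nth) simp
  have "(\<Sum>i\<in>?I. c i * multi_partial ?n (\<alpha> i) (psi ?n (\<lambda>k. - \<i> * of_real (a k))) x) = 0" for a :: "nat \<Rightarrow> real"
  proof -
    let ?lam = "\<lambda>k. - \<i> * complex_of_real (a k)"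
    let ?W = "whittaker ?n ?lam" and ?P = "psi ?n ?lam"
    have eq: "?W y = ?P y" if "y \<in> Rn ?n" for y
      using whittaker_eq_psi[of y l a] that by simp
    have P: "tame.controlled ?n ?P" by (rule psi_tame)
    have W: "tame.controlled ?n ?W" by (rule tame.controlled_cong[OF P eq])
    have "(\<Sum>i\<in>?I. c i * multi_partial ?n (\<alpha> i) ?P x) = (\<Sum>i\<in>?I. c i * multi_partial ?n (\<alpha> i) ?W x)"
      by (intro sum.cong refl arg_cong2[where f="(*)"] multi_partial_cong_Rn[OF eq[symmetric] x])
    also have "\<dots> = toda_t ?n H \<mu> ?W x + (-1) * toda_T \<mu> ?n ?W x"
      by (rule c[symmetric, OF tame.controlled_imp_smooth[OF W]])
    also have "toda_T \<mu> ?n ?W x = toda_T \<mu> ?n ?P x" by (rule toda_T_cong_Rn[OF eq order_refl x])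
    also have "\<dots> = (\<Prod>j=1..?n. \<mu> - ?lam j) * ?W x" unfolding eq[OF x] by (rule toda_T_psi[OF x])
    also have "toda_t ?n H \<mu> ?W x = (\<Prod>j=1..?n. \<mu> - ?lam j) * ?W x"
      using H x unfolding toda_hamiltonians_def by blast
    finally show ?thesis by simp
  qed
  from whittaker_jets_span[OF _ x _ this] have "(\<Sum>i\<in>?I. c i * multi_partial ?n (\<alpha> i) f x) = 0"
    by (simp only: le_add2 finite_atLeastLessThan)
  with c[OF f] have "toda_t ?n H \<mu> f x + (-1) * toda_T \<mu> ?n f x = 0" by (rule trans)
  then show ?thesis by (simp only: mult_minus1 add_uminus_conv_diff right_minus_eq)
qed

section \<open>Test functions\<close>

lemma test_fun_partial_support:
  assumes f: "\<And>x. x \<in> Rn n \<Longrightarrow> \<exists>i\<in>{1..n}. \<bar>x i\<bar> > R \<Longrightarrow> f x = 0"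
  shows "w \<in> lists {1..n} \<Longrightarrow> x \<in> Rn n \<Longrightarrow> \<exists>i\<in>{1..n}. \<bar>x i\<bar> > R \<Longrightarrow> foldr partial w f x = 0"
proof (induction w arbitrary: x)
  case (Cons j w)
  then have j: "j \<in> {1..n}" by auto
  obtain i where i: "i \<in> {1..n}" "\<bar>x i\<bar> > R" using Cons.prems(3) by blast
  have "((\<lambda>s. foldr partial w f (x(j := s))) has_vector_derivative 0) (at (x j))"
  proof (rule has_vector_derivative_transform_within_open[where S="{s. j = i \<longrightarrow> \<bar>s\<bar> > R}" and f="\<lambda>_. 0"])
    show "open {s. j = i \<longrightarrow> \<bar>s\<bar> > R}"
    proof (cases "j = i")
      case True
      then show ?thesis using open_Collect_less[of "\<lambda>_. R" "\<lambda>s::real. \<bar>s\<bar>"] by (simp add: continuous_intros)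
    qed simp
    show "0 = foldr partial w f (x(j := s))" if "s \<in> {s. j = i \<longrightarrow> \<bar>s\<bar> > R}" for s
    proof -
      have "\<exists>i\<in>{1..n}. \<bar>(x(j := s)) i\<bar> > R" using i that by (intro bexI[of _ i]) auto
      from Cons.IH[OF _ Rn_upd[OF Cons.prems(2) j] this] Cons.prems(1) show ?thesis by (simp del: fun_upd_apply)
    qed
  qed (use i in auto)
  then show ?case by (simp add: partial_eqI)
qed (use f in auto)

text \<open>
  The box is compact by Tychonoff's theorem: as a product over all natural numbers, its factors beyond \<open>n\<close> are single points.
\<close>

lemma continuous_bounded_on_box:
  assumes "continuous_on (Rn n) f"
  shows "\<exists>B. \<forall>x\<in>Rn n. (\<forall>i\<in>{1..n}. \<bar>x i\<bar> \<le> R) \<longrightarrow> norm (f x :: complex) \<le> B"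
proof -
  let ?S = "\<lambda>i. if i \<in> {1..n} then {- R..R} else {undefined :: real}"
  have "compactin (product_topology (\<lambda>_. euclidean) UNIV) (PiE (UNIV :: nat set) ?S)"
    by (subst compactin_PiE) (auto simp: compactin_euclidean_iff)
  then have c: "compact (PiE (UNIV :: nat set) ?S)" by (simp add: euclidean_product_topology compactin_euclidean_iff)
  have sub: "PiE UNIV ?S \<subseteq> Rn n"
    by (auto simp: Rn_def PiE_def Pi_def extensional_def split: if_splits)
  have "compact (f ` PiE UNIV ?S)" by (intro compact_continuous_image continuous_on_subset[OF assms sub] c)
  from compact_imp_bounded[OF this] obtain B where "\<forall>y\<in>f ` PiE UNIV ?S. norm y \<le> B"
    unfolding bounded_iff by (elim exE)
  then have B: "norm (f x) \<le> B" if "x \<in> PiE UNIV ?S" for x using that by (rule bspec[OF _ imageI])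
  have "x \<in> PiE UNIV ?S" if "x \<in> Rn n" "\<forall>i\<in>{1..n}. \<bar>x i\<bar> \<le> R" for x
  proof -
    have "x i \<in> ?S i" for i
      using that by (auto simp: Rn_def PiE_def extensional_def abs_le_iff minus_le_iff)
    then show ?thesis by (auto simp: PiE_def Pi_def)
  qed
  with B show ?thesis by blast
qed

lemma test_fun_paired:
  assumes f: "test_fun n f" and mn: "m \<le> n"
  shows "paired.controlled n m lam f"
proof -
  obtain R where sm: "smooth n f" and R: "\<And>x. x \<in> Rn n \<Longrightarrow> \<exists>i\<in>{1..n}. \<bar>x i\<bar> > R \<Longrightarrow> f x = 0"
    using f unfolding test_fun_def by blast
  have "dominated n m lam (foldr partial w f)" if w: "w \<in> lists {1..n}" for w
  proof -
    let ?g = "foldr partial w f"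
    have supp: "\<bar>x i\<bar> \<le> R" if "x \<in> Rn n" "?g x \<noteq> 0" "i \<in> {1..n}" for x i
    proof (rule ccontr)
      assume "\<not> \<bar>x i\<bar> \<le> R"
      then have "\<exists>i\<in>{1..n}. \<bar>x i\<bar> > R" using that(3) by (intro bexI[of _ i]) auto
      from test_fun_partial_support[where f=f and R=R, OF _ w that(1) this] R that(2) show False by simp
    qed
    have "continuous_on (Rn n) ?g" using sm[unfolded smooth_def, THEN bspec, OF w] by (rule conjunct1)
    from continuous_bounded_on_box[OF this, of R] obtain B where
      B: "\<forall>x\<in>Rn n. (\<forall>i\<in>{1..n}. \<bar>x i\<bar> \<le> R) \<longrightarrow> norm (?g x) \<le> B" by (elim exE)
    show ?thesis
    proof (rule dominated_bounded_support[OF _ _ mn])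
      show "norm (?g y) \<le> \<bar>B\<bar>" if "y \<in> Rn n" for y
      proof (cases "?g y = 0")
        case False
        then have "\<forall>i\<in>{1..n}. \<bar>y i\<bar> \<le> R" using supp[OF that] by simp
        then have "norm (?g y) \<le> B" using B that by simp
        then show ?thesis by linarith
      qed simp
      show "sumabs n y \<le> (\<Sum>i=1..n. R)" if "y \<in> Rn n" "?g y \<noteq> 0" for y
        unfolding sumabs_def by (intro sum_mono supp that)
    qed
  qed
  then show ?thesis using sm unfolding paired.controlled_def by blast
qed

section \<open>The relations of the Baxter operator\<close>

theorem theorem2p3:
  fixes l :: nat and H :: "nat \<Rightarrow> oper"
  assumes "l \<ge> 1"
    and "toda_hamiltonians (l + 1) H"
  shows
    "(\<forall>lam lam'.
        kernel_comp_conv (l + 1) (l + 1) (l + 1) (baxter_Q (l + 1) lam) (baxter_Q (l + 1) lam') \<longrightarrow>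
        kernel_comp_conv (l + 1) (l + 1) (l + 1) (baxter_Q (l + 1) lam') (baxter_Q (l + 1) lam) \<longrightarrow>
        (\<forall>x\<in>Rn (l + 1). \<forall>z\<in>Rn (l + 1).
           kernel_comp (l + 1) (baxter_Q (l + 1) lam) (baxter_Q (l + 1) lam') x z =
           kernel_comp (l + 1) (baxter_Q (l + 1) lam') (baxter_Q (l + 1) lam) x z)) \<and>
     (\<forall>\<gamma> lam.
        kernel_comp_conv (l + 1) (l + 1) l (baxter_Q (l + 1) \<gamma>) (recursive_Q l lam) \<longrightarrow>
        kernel_comp_conv (l + 1) l l (recursive_Q l lam) (baxter_Q l \<gamma>) \<longrightarrow>
        (\<forall>x\<in>Rn (l + 1). \<forall>z\<in>Rn l.
           kernel_comp (l + 1) (baxter_Q (l + 1) \<gamma>) (recursive_Q l lam) x z =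
           Gamma (\<i> * \<gamma> - \<i> * lam) * kernel_comp l (recursive_Q l lam) (baxter_Q l \<gamma>) x z)) \<and>
     (\<forall>lam lam'. \<forall>f. test_fun (l + 1) f \<longrightarrow>
        (\<forall>x\<in>Rn (l + 1).
           int_op (l + 1) (baxter_Q (l + 1) lam) (toda_t (l + 1) H lam' f) x =
           toda_t (l + 1) H lam' (int_op (l + 1) (baxter_Q (l + 1) lam) f) x)) \<and>
     (\<forall>lam. \<forall>x\<in>Rn (l + 1). \<forall>y\<in>Rn (l + 1).
        baxter_Q (l + 1) (lam - \<i>) x y =
        \<i> ^ (l + 1) * op_kernel_comp (toda_t (l + 1) H lam) (baxter_Q (l + 1) lam) x y)"
proof (intro conjI allI impI ballI)
  fix lam lam' x z
  assume "x \<in> Rn (l + 1)" "z \<in> Rn (l + 1)"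
  then show "kernel_comp (l + 1) (baxter_Q (l + 1) lam) (baxter_Q (l + 1) lam') x z =
    kernel_comp (l + 1) (baxter_Q (l + 1) lam') (baxter_Q (l + 1) lam) x z"
    by (rule baxter_Q_commute)
next
  fix \<gamma> lam x z
  assume "kernel_comp_conv (l + 1) (l + 1) l (baxter_Q (l + 1) \<gamma>) (recursive_Q l lam)"
    and "x \<in> Rn (l + 1)" "z \<in> Rn l"
  then show "kernel_comp (l + 1) (baxter_Q (l + 1) \<gamma>) (recursive_Q l lam) x z =
    Gamma (\<i> * \<gamma> - \<i> * lam) * kernel_comp l (recursive_Q l lam) (baxter_Q l \<gamma>) x z"
    by (rule baxter_Q_recursive_Q[OF assms(1)])
next
  fix lam lam' f x
  assume f: "test_fun (l + 1) f" and x: "x \<in> Rn (l + 1)"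
  have sm: "smooth (l + 1) f" using f by (simp add: test_fun_def)
  have p: "paired.controlled (l + 1) l lam f" by (rule test_fun_paired[OF f]) simp
  have op: "int_op (l + 1) (baxter_Q (l + 1) lam) g = (\<lambda>x. LINT y|leb (l + 1). toda_kernel (l + 1) l lam x y * g y)" for g
    by (intro ext) (simp only: int_op_def baxter_Q_toda_kernel)
  have "int_op (l + 1) (baxter_Q (l + 1) lam) (toda_t (l + 1) H lam' f) x
      = (LINT y|leb (l + 1). toda_kernel (l + 1) l lam x y * toda_T lam' (l + 1) f y)"
    unfolding op using toda_t_eq_toda_T[OF assms(2) sm]
    by (intro Bochner_Integration.integral_cong refl) (simp only: leb_simps)
  also have "\<dots> = toda_T lam' (l + 1) (int_op (l + 1) (baxter_Q (l + 1) lam) f) x"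
    unfolding op by (rule toda_T_baxter_integral(1)[OF p x, symmetric])
  also have "\<dots> = toda_t (l + 1) H lam' (int_op (l + 1) (baxter_Q (l + 1) lam) f) x"
    unfolding op
    by (rule toda_t_eq_toda_T[OF assms(2) tame.controlled_imp_smooth[OF toda_T_baxter_integral(2)[OF p x]] x, symmetric])
  finally show "int_op (l + 1) (baxter_Q (l + 1) lam) (toda_t (l + 1) H lam' f) x =
    toda_t (l + 1) H lam' (int_op (l + 1) (baxter_Q (l + 1) lam) f) x" .
next
  fix lam x y
  assume x: "x \<in> Rn (l + 1)" and "y \<in> Rn (l + 1)"
  have "\<i> ^ (l + 1) * op_kernel_comp (toda_t (l + 1) H lam) (baxter_Q (l + 1) lam) x y
      = \<i> ^ (l + 1) * toda_T lam (l + 1) (\<lambda>z. toda_kernel (l + 1) l lam z y) x"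
    unfolding op_kernel_comp_def baxter_Q_toda_kernel
    by (simp only: toda_t_eq_toda_T[OF assms(2) tame.controlled_imp_smooth[OF toda_T_baxter_kernel(2)[OF x]] x])
  also have "\<dots> = (\<i> * - \<i>) ^ (l + 1) * toda_kernel (l + 1) l (lam - \<i>) x y"
    unfolding toda_T_baxter_kernel(1)[OF x] power_mult_distrib by (simp only: mult.assoc)
  also have "\<dots> = baxter_Q (l + 1) (lam - \<i>) x y"
    unfolding baxter_Q_toda_kernel by simp
  finally show "baxter_Q (l + 1) (lam - \<i>) x y = \<i> ^ (l + 1) * op_kernel_comp (toda_t (l + 1) H lam) (baxter_Q (l + 1) lam) x y" by simp
qed

end
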